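(* Let $B$ be a pointed Poisson Hopf algebra over $k$ with group of group-like elements $G$, such that $\{g,t\}=0$ for all $g,t\in G$. Let $C=\mathrm{gr}\,B$ be the associated graded Poisson Hopf algebra, let $\pi:C\to kG$ be the canonical projection, and let $R=\{x\in C:(\mathrm{id}\otimes\pi)\Delta(x)=x\otimes1\}$. Then: (1) $R$ is a Poisson subalgebra of $C$; (2) $\{g,\{y,g^{-1}\}\}\in R$ and $g^{-1}\{g,y\}\in R$ for all $y\in R$ and $g\in G$.
   Context: $k$ is a field. A Poisson algebra is a commutative $k$-algebra with a Lie bracket $\{\cdot,\cdot\}$ such that $\{a,bc\}=\{a,b\}c+b\{a,c\}$; $A\otimes A$ is Poisson with $\{a\otimes b,c\otimes d\}=ac\otimes\{b,d\}+\{a,c\}\otimes bd$. A Poisson Hopf algebra is a commutative Hopf algebra with a Poisson bracket such that $\Delta(\{a,b\})=\{\Delta(a),\Delta(b)\}$; pointed means pointed as a coalgebra. Let $\{B_n\}$ be the coradical filtration of $B$ and $C=\mathrm{gr}\,B=\bigoplus_nC(n)$, $C(n)=B_n/B_{n-1}$. Under the hypothesis, $\{B_i,B_j\}\subset B_{i+j}$, and $C$ is a Poisson Hopf algebra with bracket $\{\overline x,\overline y\}=\overline{\{x,y\}}\in C(i+j)$ for $x\in B_i$, $y\in B_j$. Here $C(0)=kG$, and $\pi:C\to kG$ is the projection with kernel $\bigoplus_{i\ge1}C(i)$. *)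

theory Defs
  imports "HOL-Algebra.Module" "HOL-Algebra.Subrings"
begin

section \<open>Tensor products over a field\<close>

text \<open>
  An element of \<open>M \<otimes> N\<close> is a class of finite formal sums of pairs, the list
  \<open>[(a1, b1), \<dots>, (an, bn)]\<close> standing for \<open>a1 \<otimes> b1 + \<dots> + an \<otimes> bn\<close>.
  Two lists are identified by the smallest congruence for concatenation that makes it commutative
  and the pairing biadditive and \<open>k\<close>-balanced. Scalars and negatives are absorbed into the
  entries of the pairs. The rule \<open>zero\<close> cannot be dropped: without it the empty list would
  only be equivalent to itself.
\<close>

inductive tensor_eq ::
    "('k, 'r) ring_scheme \<Rightarrow> ('k, 'a, 'm) module_scheme \<Rightarrow> ('k, 'b, 'n) module_scheme
      \<Rightarrow> ('a \<times> 'b) list \<Rightarrow> ('a \<times> 'b) list \<Rightarrow> bool"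
  for k :: "('k, 'r) ring_scheme" and M :: "('k, 'a, 'm) module_scheme"
    and N :: "('k, 'b, 'n) module_scheme"
where
  refl: "set xs \<subseteq> carrier M \<times> carrier N \<Longrightarrow> tensor_eq k M N xs xs"
| sym: "tensor_eq k M N xs ys \<Longrightarrow> tensor_eq k M N ys xs"
| trans: "tensor_eq k M N xs ys \<Longrightarrow> tensor_eq k M N ys zs \<Longrightarrow> tensor_eq k M N xs zs"
| append: "tensor_eq k M N xs xs' \<Longrightarrow> tensor_eq k M N ys ys'
    \<Longrightarrow> tensor_eq k M N (xs @ ys) (xs' @ ys')"
| commute: "set xs \<subseteq> carrier M \<times> carrier N \<Longrightarrow> set ys \<subseteq> carrier M \<times> carrier N
    \<Longrightarrow> tensor_eq k M N (xs @ ys) (ys @ xs)"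
| zero: "b \<in> carrier N \<Longrightarrow> tensor_eq k M N [(\<zero>\<^bsub>M\<^esub>, b)] []"
| add_left: "a \<in> carrier M \<Longrightarrow> a' \<in> carrier M \<Longrightarrow> b \<in> carrier N
    \<Longrightarrow> tensor_eq k M N [(a \<oplus>\<^bsub>M\<^esub> a', b)] [(a, b), (a', b)]"
| add_right: "a \<in> carrier M \<Longrightarrow> b \<in> carrier N \<Longrightarrow> b' \<in> carrier N
    \<Longrightarrow> tensor_eq k M N [(a, b \<oplus>\<^bsub>N\<^esub> b')] [(a, b), (a, b')]"
| balanced: "r \<in> carrier k \<Longrightarrow> a \<in> carrier M \<Longrightarrow> b \<in> carrier N
    \<Longrightarrow> tensor_eq k M N [(r \<odot>\<^bsub>M\<^esub> a, b)] [(a, r \<odot>\<^bsub>N\<^esub> b)]"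

definition tensor_sum ::
    "('k, 'r) ring_scheme \<Rightarrow> ('k, 'a, 'm) module_scheme \<Rightarrow> ('k, 'b, 'n) module_scheme
      \<Rightarrow> ('a \<times> 'b) list \<Rightarrow> ('a \<times> 'b) list set"
  where "tensor_sum k M N xs = {ys. tensor_eq k M N xs ys}"

definition pure_tensor ::
    "('k, 'r) ring_scheme \<Rightarrow> ('k, 'a, 'm) module_scheme \<Rightarrow> ('k, 'b, 'n) module_scheme
      \<Rightarrow> 'a \<Rightarrow> 'b \<Rightarrow> ('a \<times> 'b) list set"
  where "pure_tensor k M N a b = tensor_sum k M N [(a, b)]"

text \<open>The image of \<open>X \<otimes> Y\<close> in \<open>M \<otimes> N\<close>, for subspaces \<open>X\<close> and \<open>Y\<close>.\<close>

definition tensor_subspace ::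
    "('k, 'r) ring_scheme \<Rightarrow> ('k, 'a, 'm) module_scheme \<Rightarrow> ('k, 'b, 'n) module_scheme
      \<Rightarrow> 'a set \<Rightarrow> 'b set \<Rightarrow> ('a \<times> 'b) list set set"
  where "tensor_subspace k M N X Y = {tensor_sum k M N xs | xs. set xs \<subseteq> X \<times> Y}"

text \<open>Only the linear structure of the following record is meaningful; \<open>mult\<close> and \<open>one\<close> are
  inherited fields of the record type \<open>module\<close>.\<close>

definition tensor_space ::
    "('k, 'r) ring_scheme \<Rightarrow> ('k, 'a, 'm) module_scheme \<Rightarrow> ('k, 'b, 'n) module_scheme
      \<Rightarrow> ('k, ('a \<times> 'b) list set) module"
  where "tensor_space k M N =
    \<lparr>carrier = tensor_subspace k M N (carrier M) (carrier N),
     mult = undefined,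
     one = undefined,
     zero = tensor_sum k M N [],
     add = (\<lambda>s t. \<Union>xs\<in>s. \<Union>ys\<in>t. tensor_sum k M N (xs @ ys)),
     smult = (\<lambda>r s. \<Union>xs\<in>s. tensor_sum k M N (map (\<lambda>(a, b). (r \<odot>\<^bsub>M\<^esub> a, b)) xs))\<rparr>"

text \<open>The linear map \<open>M \<otimes> N \<rightarrow> W\<close> induced by a bilinear map \<open>\<beta>\<close>, evaluated at \<open>s\<close>.\<close>

definition tensor_lift ::
    "('w, 'x) ring_scheme \<Rightarrow> ('a \<Rightarrow> 'b \<Rightarrow> 'w) \<Rightarrow> ('a \<times> 'b) list set \<Rightarrow> 'w"
  where "tensor_lift W \<beta> s =
    (THE w. \<forall>xs\<in>s. w = foldr (\<lambda>(a, b) v. \<beta> a b \<oplus>\<^bsub>W\<^esub> v) xs \<zero>\<^bsub>W\<^esub>)"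

text \<open>The map \<open>f \<otimes> g\<close> with values in \<open>M \<otimes> N\<close>.\<close>

definition tensor_map ::
    "('k, 'r) ring_scheme \<Rightarrow> ('k, 'c, 'm) module_scheme \<Rightarrow> ('k, 'd, 'n) module_scheme
      \<Rightarrow> ('a \<Rightarrow> 'c) \<Rightarrow> ('b \<Rightarrow> 'd) \<Rightarrow> ('a \<times> 'b) list set \<Rightarrow> ('c \<times> 'd) list set"
  where "tensor_map k M N f g =
    tensor_lift (tensor_space k M N) (\<lambda>a b. pure_tensor k M N (f a) (g b))"

text \<open>The canonical map \<open>(L \<otimes> M) \<otimes> N \<rightarrow> L \<otimes> (M \<otimes> N)\<close>.\<close>

definition tensor_assoc ::
    "('k, 'r) ring_scheme \<Rightarrow> ('k, 'a, 'l) module_scheme \<Rightarrow> ('k, 'b, 'm) module_scheme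
      \<Rightarrow> ('k, 'c, 'n) module_scheme
      \<Rightarrow> (('a \<times> 'b) list set \<times> 'c) list set \<Rightarrow> ('a \<times> ('b \<times> 'c) list set) list set"
  where "tensor_assoc k L M N =
    (let MN = tensor_space k M N; W = tensor_space k L MN in
      tensor_lift W (\<lambda>s c.
        tensor_lift W (\<lambda>a b. pure_tensor k L MN a (pure_tensor k M N b c)) s))"

definition tensor_algebra ::
    "('k, 'r) ring_scheme \<Rightarrow> ('k, 'a, 'm) module_scheme \<Rightarrow> ('k, 'b, 'n) module_scheme
      \<Rightarrow> ('k, ('a \<times> 'b) list set) module"
  where "tensor_algebra k A B = (tensor_space k A B)
    \<lparr>mult := (\<lambda>s t. tensor_lift (tensor_space k A B) (\<lambda>a b.
        tensor_lift (tensor_space k A B) (\<lambda>c d.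
          pure_tensor k A B (a \<otimes>\<^bsub>A\<^esub> c) (b \<otimes>\<^bsub>B\<^esub> d)) t) s),
     one := pure_tensor k A B \<one>\<^bsub>A\<^esub> \<one>\<^bsub>B\<^esub>\<rparr>"


section \<open>Poisson algebras\<close>

record ('k, 'a) poisson = "('k, 'a) module" +
  bracket :: "'a \<Rightarrow> 'a \<Rightarrow> 'a"

locale poisson_algebra = algebra k A + field k
  for k :: "('k, 'r) ring_scheme" and A :: "('k, 'a, 'm) poisson_scheme" +
  assumes bracket_closed:
      "\<lbrakk>a \<in> carrier A; b \<in> carrier A\<rbrakk> \<Longrightarrow> bracket A a b \<in> carrier A"
    and bracket_add_left:
      "\<lbrakk>a \<in> carrier A; b \<in> carrier A; c \<in> carrier A\<rbrakk>
        \<Longrightarrow> bracket A (a \<oplus>\<^bsub>A\<^esub> b) c = bracket A a c \<oplus>\<^bsub>A\<^esub> bracket A b c"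
    and bracket_add_right:
      "\<lbrakk>a \<in> carrier A; b \<in> carrier A; c \<in> carrier A\<rbrakk>
        \<Longrightarrow> bracket A a (b \<oplus>\<^bsub>A\<^esub> c) = bracket A a b \<oplus>\<^bsub>A\<^esub> bracket A a c"
    and bracket_smult_left:
      "\<lbrakk>r \<in> carrier k; a \<in> carrier A; b \<in> carrier A\<rbrakk>
        \<Longrightarrow> bracket A (r \<odot>\<^bsub>A\<^esub> a) b = r \<odot>\<^bsub>A\<^esub> bracket A a b"
    and bracket_smult_right:
      "\<lbrakk>r \<in> carrier k; a \<in> carrier A; b \<in> carrier A\<rbrakk>
        \<Longrightarrow> bracket A a (r \<odot>\<^bsub>A\<^esub> b) = r \<odot>\<^bsub>A\<^esub> bracket A a b"
    and bracket_alternating: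
      "a \<in> carrier A \<Longrightarrow> bracket A a a = \<zero>\<^bsub>A\<^esub>"
    and jacobi:
      "\<lbrakk>a \<in> carrier A; b \<in> carrier A; c \<in> carrier A\<rbrakk>
        \<Longrightarrow> bracket A a (bracket A b c) \<oplus>\<^bsub>A\<^esub> bracket A b (bracket A c a)
            \<oplus>\<^bsub>A\<^esub> bracket A c (bracket A a b) = \<zero>\<^bsub>A\<^esub>"
    and leibniz:
      "\<lbrakk>a \<in> carrier A; b \<in> carrier A; c \<in> carrier A\<rbrakk>
        \<Longrightarrow> bracket A a (b \<otimes>\<^bsub>A\<^esub> c) =
            bracket A a b \<otimes>\<^bsub>A\<^esub> c \<oplus>\<^bsub>A\<^esub> b \<otimes>\<^bsub>A\<^esub> bracket A a c"

definition poisson_subalgebra ::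
    "('k, 'r) ring_scheme \<Rightarrow> ('k, 'a, 'm) poisson_scheme \<Rightarrow> 'a set \<Rightarrow> bool"
  where "poisson_subalgebra k A H \<longleftrightarrow>
    submodule H k A \<and> subring H A \<and> (\<forall>x\<in>H. \<forall>y\<in>H. bracket A x y \<in> H)"

text \<open>\<open>{a \<otimes> b, c \<otimes> d} = ac \<otimes> {b, d} + {a, c} \<otimes> bd\<close>, extended bilinearly.\<close>

definition tensor_bracket ::
    "('k, 'r) ring_scheme \<Rightarrow> ('k, 'a, 'm) poisson_scheme \<Rightarrow> ('k, 'b, 'n) poisson_scheme
      \<Rightarrow> ('a \<times> 'b) list set \<Rightarrow> ('a \<times> 'b) list set \<Rightarrow> ('a \<times> 'b) list set"
  where "tensor_bracket k A B s t =
    tensor_lift (tensor_space k A B) (\<lambda>a b.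
      tensor_lift (tensor_space k A B) (\<lambda>c d.
        pure_tensor k A B (a \<otimes>\<^bsub>A\<^esub> c) (bracket B b d) \<oplus>\<^bsub>tensor_space k A B\<^esub>
        pure_tensor k A B (bracket A a c) (b \<otimes>\<^bsub>B\<^esub> d)) t) s"


section \<open>Coalgebras and Poisson Hopf algebras\<close>

record ('k, 'a) poisson_hopf = "('k, 'a) poisson" +
  comult :: "'a \<Rightarrow> ('a \<times> 'a) list set"
  counit :: "'a \<Rightarrow> 'k"

locale coalgebra = module k A + field k
  for k :: "('k, 'r) ring_scheme" and A :: "('k, 'a, 'm) poisson_hopf_scheme" +
  assumes comult_closed:
      "a \<in> carrier A \<Longrightarrow> comult A a \<in> carrier (tensor_space k A A)"
    and comult_add:
      "\<lbrakk>a \<in> carrier A; b \<in> carrier A\<rbrakk>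
        \<Longrightarrow> comult A (a \<oplus>\<^bsub>A\<^esub> b) = comult A a \<oplus>\<^bsub>tensor_space k A A\<^esub> comult A b"
    and comult_smult:
      "\<lbrakk>r \<in> carrier k; a \<in> carrier A\<rbrakk>
        \<Longrightarrow> comult A (r \<odot>\<^bsub>A\<^esub> a) = r \<odot>\<^bsub>tensor_space k A A\<^esub> comult A a"
    and counit_closed:
      "a \<in> carrier A \<Longrightarrow> counit A a \<in> carrier k"
    and counit_add:
      "\<lbrakk>a \<in> carrier A; b \<in> carrier A\<rbrakk>
        \<Longrightarrow> counit A (a \<oplus>\<^bsub>A\<^esub> b) = counit A a \<oplus>\<^bsub>k\<^esub> counit A b"
    and counit_smult:
      "\<lbrakk>r \<in> carrier k; a \<in> carrier A\<rbrakk>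
        \<Longrightarrow> counit A (r \<odot>\<^bsub>A\<^esub> a) = r \<otimes>\<^bsub>k\<^esub> counit A a"
    and coassoc:
      "a \<in> carrier A \<Longrightarrow>
        tensor_assoc k A A A (tensor_map k (tensor_space k A A) A (comult A) id (comult A a)) =
        tensor_map k A (tensor_space k A A) id (comult A) (comult A a)"
    and counit_left:
      "a \<in> carrier A \<Longrightarrow> tensor_lift A (\<lambda>x y. counit A x \<odot>\<^bsub>A\<^esub> y) (comult A a) = a"
    and counit_right:
      "a \<in> carrier A \<Longrightarrow> tensor_lift A (\<lambda>x y. counit A y \<odot>\<^bsub>A\<^esub> x) (comult A a) = a"

definition is_antipode ::
    "('k, 'r) ring_scheme \<Rightarrow> ('k, 'a, 'm) poisson_hopf_scheme \<Rightarrow> ('a \<Rightarrow> 'a) \<Rightarrow> bool"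
  where "is_antipode k A S \<longleftrightarrow>
    (\<forall>a\<in>carrier A. S a \<in> carrier A) \<and>
    (\<forall>a\<in>carrier A. \<forall>b\<in>carrier A. S (a \<oplus>\<^bsub>A\<^esub> b) = S a \<oplus>\<^bsub>A\<^esub> S b) \<and>
    (\<forall>r\<in>carrier k. \<forall>a\<in>carrier A. S (r \<odot>\<^bsub>A\<^esub> a) = r \<odot>\<^bsub>A\<^esub> S a) \<and>
    (\<forall>a\<in>carrier A.
      tensor_lift A (\<lambda>x y. S x \<otimes>\<^bsub>A\<^esub> y) (comult A a) = counit A a \<odot>\<^bsub>A\<^esub> \<one>\<^bsub>A\<^esub> \<and>
      tensor_lift A (\<lambda>x y. x \<otimes>\<^bsub>A\<^esub> S y) (comult A a) = counit A a \<odot>\<^bsub>A\<^esub> \<one>\<^bsub>A\<^esub>)"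

locale poisson_hopf_algebra = poisson_algebra k A + coalgebra k A
  for k :: "('k, 'r) ring_scheme" and A :: "('k, 'a, 'm) poisson_hopf_scheme" +
  assumes comult_mult:
      "\<lbrakk>a \<in> carrier A; b \<in> carrier A\<rbrakk>
        \<Longrightarrow> comult A (a \<otimes>\<^bsub>A\<^esub> b) = comult A a \<otimes>\<^bsub>tensor_algebra k A A\<^esub> comult A b"
    and comult_one:
      "comult A \<one>\<^bsub>A\<^esub> = \<one>\<^bsub>tensor_algebra k A A\<^esub>"
    and counit_mult:
      "\<lbrakk>a \<in> carrier A; b \<in> carrier A\<rbrakk>
        \<Longrightarrow> counit A (a \<otimes>\<^bsub>A\<^esub> b) = counit A a \<otimes>\<^bsub>k\<^esub> counit A b"
    and counit_one:
      "counit A \<one>\<^bsub>A\<^esub> = \<one>\<^bsub>k\<^esub>"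
    and antipode_exists:
      "\<exists>S. is_antipode k A S"
    and comult_bracket:
      "\<lbrakk>a \<in> carrier A; b \<in> carrier A\<rbrakk>
        \<Longrightarrow> comult A (bracket A a b) = tensor_bracket k A A (comult A a) (comult A b)"

definition grouplikes :: "('k, 'r) ring_scheme \<Rightarrow> ('k, 'a, 'm) poisson_hopf_scheme \<Rightarrow> 'a set"
  where "grouplikes k A =
    {g \<in> carrier A. comult A g = pure_tensor k A A g g \<and> counit A g = \<one>\<^bsub>k\<^esub>}"


section \<open>Coradical filtration and pointedness\<close>

definition subcoalgebra ::
    "('k, 'r) ring_scheme \<Rightarrow> ('k, 'a, 'm) poisson_hopf_scheme \<Rightarrow> 'a set \<Rightarrow> bool"
  where "subcoalgebra k A D \<longleftrightarrow>
    submodule D k A \<and> (\<forall>d\<in>D. comult A d \<in> tensor_subspace k A A D D)"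

definition simple_subcoalgebra ::
    "('k, 'r) ring_scheme \<Rightarrow> ('k, 'a, 'm) poisson_hopf_scheme \<Rightarrow> 'a set \<Rightarrow> bool"
  where "simple_subcoalgebra k A D \<longleftrightarrow>
    subcoalgebra k A D \<and> D \<noteq> {\<zero>\<^bsub>A\<^esub>} \<and>
    (\<forall>E. subcoalgebra k A E \<and> E \<subseteq> D \<longrightarrow> E = {\<zero>\<^bsub>A\<^esub>} \<or> E = D)"

definition pointed :: "('k, 'r) ring_scheme \<Rightarrow> ('k, 'a, 'm) poisson_hopf_scheme \<Rightarrow> bool"
  where "pointed k A \<longleftrightarrow>
    (\<forall>D. simple_subcoalgebra k A D \<longrightarrow>
      (\<exists>d\<in>carrier A. d \<noteq> \<zero>\<^bsub>A\<^esub> \<and> D = {r \<odot>\<^bsub>A\<^esub> d | r. r \<in> carrier k}))"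

definition linear_span ::
    "('k, 'r) ring_scheme \<Rightarrow> ('k, 'a, 'm) module_scheme \<Rightarrow> 'a set \<Rightarrow> 'a set"
  where "linear_span k M X = \<Inter>{H. submodule H k M \<and> X \<subseteq> H}"

definition coradical :: "('k, 'r) ring_scheme \<Rightarrow> ('k, 'a, 'm) poisson_hopf_scheme \<Rightarrow> 'a set"
  where "coradical k A = linear_span k A (\<Union>{D. simple_subcoalgebra k A D})"

text \<open>\<open>A\<^sub>n\<^sub>+\<^sub>1 = \<Delta>\<^sup>-\<^sup>1(A \<otimes> A\<^sub>n + A\<^sub>0 \<otimes> A)\<close>.\<close>

primrec coradical_filt ::
    "('k, 'r) ring_scheme \<Rightarrow> ('k, 'a, 'm) poisson_hopf_scheme \<Rightarrow> nat \<Rightarrow> 'a set"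
  where
    "coradical_filt k A 0 = coradical k A"
  | "coradical_filt k A (Suc n) =
      {a \<in> carrier A. comult A a \<in>
        tensor_subspace k A A (carrier A) (coradical_filt k A n)
          <+>\<^bsub>tensor_space k A A\<^esub> tensor_subspace k A A (coradical k A) (carrier A)}"


section \<open>The associated graded Poisson Hopf algebra\<close>

text \<open>The class of \<open>x\<close> in \<open>B\<^sub>n / B\<^sub>n\<^sub>-\<^sub>1\<close>, where \<open>B\<^sub>-\<^sub>1 = 0\<close>.\<close>

definition gr_class ::
    "('k, 'r) ring_scheme \<Rightarrow> ('k, 'b, 'm) poisson_hopf_scheme \<Rightarrow> nat \<Rightarrow> 'b \<Rightarrow> 'b set"
  where "gr_class k B n x =
    (case n of 0 \<Rightarrow> {\<zero>\<^bsub>B\<^esub>} | Suc m \<Rightarrow> coradical_filt k B m) +>\<^bsub>B\<^esub> x"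

definition representative :: "'b set \<Rightarrow> 'b"
  where "representative c = (SOME x. x \<in> c)"

text \<open>The homogeneous element \<open>x + B\<^sub>n\<^sub>-\<^sub>1\<close> of degree \<open>n\<close> as an element of the direct sum.\<close>

definition gr_elem ::
    "('k, 'r) ring_scheme \<Rightarrow> ('k, 'b, 'm) poisson_hopf_scheme \<Rightarrow> nat \<Rightarrow> 'b \<Rightarrow> nat \<Rightarrow> 'b set"
  where "gr_elem k B n x = (\<lambda>m. gr_class k B m (if m = n then x else \<zero>\<^bsub>B\<^esub>))"

text \<open>
  Elements of \<open>gr B\<close> are the finitely supported families \<open>u\<close> with \<open>u n \<in> B\<^sub>n / B\<^sub>n\<^sub>-\<^sub>1\<close>.
  All operations are induced from \<open>B\<close> and are computed on arbitrarily chosen representatives; under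
  the hypotheses on \<open>B\<close> the results do not depend on the choice. The product
  and the bracket are \<open>(u v)\<^sub>n = \<Sum> u\<^sub>i v\<^sub>n\<^sub>-\<^sub>i\<close> and \<open>{u, v}\<^sub>n = \<Sum> {u\<^sub>i, v\<^sub>n\<^sub>-\<^sub>i}\<close>.
\<close>

definition gr_poisson ::
    "('k, 'r) ring_scheme \<Rightarrow> ('k, 'b, 'm) poisson_hopf_scheme \<Rightarrow> ('k, nat \<Rightarrow> 'b set) poisson"
  where "gr_poisson k B =
    \<lparr>carrier = {u. (\<forall>n. u n \<in> gr_class k B n ` coradical_filt k B n) \<and>
                   finite {n. u n \<noteq> gr_class k B n \<zero>\<^bsub>B\<^esub>}},
     mult = (\<lambda>u v n. gr_class k B n
       (\<Oplus>\<^bsub>B\<^esub>i\<in>{..n}. representative (u i) \<otimes>\<^bsub>B\<^esub> representative (v (n - i)))),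
     one = gr_elem k B 0 \<one>\<^bsub>B\<^esub>,
     zero = (\<lambda>n. gr_class k B n \<zero>\<^bsub>B\<^esub>),
     add = (\<lambda>u v n. gr_class k B n (representative (u n) \<oplus>\<^bsub>B\<^esub> representative (v n))),
     smult = (\<lambda>r u n. gr_class k B n (r \<odot>\<^bsub>B\<^esub> representative (u n))),
     bracket = (\<lambda>u v n. gr_class k B n
       (\<Oplus>\<^bsub>B\<^esub>i\<in>{..n}. bracket B (representative (u i)) (representative (v (n - i)))))\<rparr>"

text \<open>
  The coproduct of the class of \<open>x \<in> B\<^sub>n\<close>: write \<open>\<Delta>(x)\<close> as a sum of terms \<open>a \<otimes> b\<close> with
  \<open>a \<in> B\<^sub>i\<close> and \<open>b \<in> B\<^sub>n\<^sub>-\<^sub>i\<close>, and replace \<open>a\<close> and \<open>b\<close> by their classes in degrees \<open>i\<close> and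
  \<open>n - i\<close>. A term is stored as \<open>(i, a, b)\<close>.
\<close>

definition gr_comult_hom ::
    "('k, 'r) ring_scheme \<Rightarrow> ('k, 'b, 'm) poisson_hopf_scheme \<Rightarrow> nat \<Rightarrow> 'b
      \<Rightarrow> ((nat \<Rightarrow> 'b set) \<times> (nat \<Rightarrow> 'b set)) list set"
  where "gr_comult_hom k B n x =
    (THE t. \<exists>ws.
      (\<forall>(i, a, b)\<in>set ws. i \<le> n \<and> a \<in> coradical_filt k B i \<and> b \<in> coradical_filt k B (n - i)) \<and>
      comult B x = tensor_sum k B B (map (\<lambda>(i, a, b). (a, b)) ws) \<and>
      t = tensor_sum k (gr_poisson k B) (gr_poisson k B)
            (map (\<lambda>(i, a, b). (gr_elem k B i a, gr_elem k B (n - i) b)) ws))"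

definition gr ::
    "('k, 'r) ring_scheme \<Rightarrow> ('k, 'b, 'm) poisson_hopf_scheme \<Rightarrow> ('k, nat \<Rightarrow> 'b set) poisson_hopf"
  where "gr k B = poisson.extend (gr_poisson k B)
    \<lparr>comult = (\<lambda>u. \<Oplus>\<^bsub>tensor_space k (gr_poisson k B) (gr_poisson k B)\<^esub>
         n\<in>{n. u n \<noteq> gr_class k B n \<zero>\<^bsub>B\<^esub>}. gr_comult_hom k B n (representative (u n))),
     counit = (\<lambda>u. counit B (representative (u 0)))\<rparr>"

text \<open>\<open>C(0) = kG\<close>, with the structure inherited from \<open>C = gr B\<close>, and the projection of \<open>C\<close> onto it.\<close>

definition gr_zero ::
    "('k, 'r) ring_scheme \<Rightarrow> ('k, 'b, 'm) poisson_hopf_scheme \<Rightarrow> ('k, nat \<Rightarrow> 'b set) poisson_hopf"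
  where "gr_zero k B = (gr k B)
    \<lparr>carrier := {u \<in> carrier (gr k B). \<forall>n>0. u n = gr_class k B n \<zero>\<^bsub>B\<^esub>}\<rparr>"

definition gr_proj ::
    "('k, 'r) ring_scheme \<Rightarrow> ('k, 'b, 'm) poisson_hopf_scheme \<Rightarrow> (nat \<Rightarrow> 'b set) \<Rightarrow> nat \<Rightarrow> 'b set"
  where "gr_proj k B u = (\<lambda>n. if n = 0 then u 0 else gr_class k B n \<zero>\<^bsub>B\<^esub>)"

definition gr_coinvariants ::
    "('k, 'r) ring_scheme \<Rightarrow> ('k, 'b, 'm) poisson_hopf_scheme \<Rightarrow> (nat \<Rightarrow> 'b set) set"
  where "gr_coinvariants k B =
    {x \<in> carrier (gr k B).
      tensor_map k (gr k B) (gr_zero k B) id (gr_proj k B) (comult (gr k B) x) =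
      pure_tensor k (gr k B) (gr_zero k B) x \<one>\<^bsub>gr_zero k B\<^esub>}"

end

theory Submission
  imports Defs
begin

text \<open>
  Everything is tested on linear functionals. Over a field, elements of \<open>V \<otimes> W\<close> are separated by
  the pairings \<open>f \<otimes> g\<close>, and for filtrations of \<open>V\<close> and \<open>W\<close> membership in \<open>\<Sum> P\<^sub>i \<otimes> Q\<^sub>i\<close> is
  detected by annihilators. With the convolution product of functionals this gives
  \<open>\<Delta>(B\<^sub>n) \<subseteq> \<Sum> B\<^sub>i \<otimes> B\<^sub>n\<^sub>-\<^sub>i\<close>, and, since \<open>B\<^sub>0\<close> is spanned by group-likes with trivial bracket,
  \<open>B\<^sub>i B\<^sub>j \<subseteq> B\<^sub>i\<^sub>+\<^sub>j\<close> and \<open>{B\<^sub>i, B\<^sub>j} \<subseteq> B\<^sub>i\<^sub>+\<^sub>j\<close>.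

  For \<open>h \<in> B\<close> call \<open>x \<in> B\<^sub>n\<close> an \<open>h\<close>-coinvariant if \<open>\<Delta>(x) - x \<otimes> h \<in> B\<^sub>n\<^sub>-\<^sub>1 \<otimes> B\<close>. The coinvariants
  \<open>R\<close> consist of the elements of \<open>C\<close> all of whose components are classes of \<open>1\<close>-coinvariants,
  and a group-like \<open>g\<close> is a \<open>g\<close>-coinvariant. Products of \<open>h\<close>- and \<open>l\<close>-coinvariants are
  \<open>h l\<close>-coinvariants, and so are their brackets when \<open>{h, l} = 0\<close>. Both claims follow by multiplying
  the labels: \<open>1 \<cdot> 1 = 1\<close>, \<open>g 1 g\<^sup>-\<^sup>1 = 1\<close> and \<open>g\<^sup>-\<^sup>1 g 1 = 1\<close>.
\<close>

section \<open>Linear functionals\<close>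

text \<open>Tensors are classes of lists, and the maps on them are definite descriptions, so
  equality of tensors is awkward to show directly. Functionals move each such question into k, where
  finite sums can be rearranged freely. They also replace computations in the quotients C(n): a
  functional on C amounts to a family of functionals on B, the n-th one killing
  \<open>lower n\<close>, so the coproduct of C is tested by convolutions on B.

  The label h answers an obstacle in (2). Neither g^-1 nor {y, g^-1} has to lie in R, so R alone is
  not stable under the steps of the computation. The elements c with (id \<otimes> \<pi>)\<Delta>(c)
  = c \<otimes> h, for varying group-like h, are stable, and R is the case h = 1. Testing the
  bracket of two of them against f \<otimes> g gives f(xy) g({h, l}) + f({x, y}) g(hl), and the
  hypothesis on G removes the first summand. The same hypothesis gives {B_0, B_0} = 0, where the
  induction for {B_i, B_j} starts.\<close>

definition dual :: "('k, 'r) ring_scheme \<Rightarrow> ('k, 'a, 'm) module_scheme \<Rightarrow> ('a \<Rightarrow> 'k) set"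
  where "dual k V = {f. f \<in> carrier V \<rightarrow> carrier k \<and>
    (\<forall>x\<in>carrier V. \<forall>y\<in>carrier V. f (x \<oplus>\<^bsub>V\<^esub> y) = f x \<oplus>\<^bsub>k\<^esub> f y) \<and>
    (\<forall>r\<in>carrier k. \<forall>x\<in>carrier V. f (r \<odot>\<^bsub>V\<^esub> x) = r \<otimes>\<^bsub>k\<^esub> f x)}"

definition annihilator ::
    "('k, 'r) ring_scheme \<Rightarrow> ('k, 'a, 'm) module_scheme \<Rightarrow> 'a set \<Rightarrow> ('a \<Rightarrow> 'k) set"
  where "annihilator k V X = {f \<in> dual k V. \<forall>x\<in>X. f x = \<zero>\<^bsub>k\<^esub>}"

lemma dualI:
  assumes "\<And>x. x \<in> carrier V \<Longrightarrow> f x \<in> carrier k"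
    and "\<And>x y. \<lbrakk>x \<in> carrier V; y \<in> carrier V\<rbrakk> \<Longrightarrow> f (x \<oplus>\<^bsub>V\<^esub> y) = f x \<oplus>\<^bsub>k\<^esub> f y"
    and "\<And>r x. \<lbrakk>r \<in> carrier k; x \<in> carrier V\<rbrakk> \<Longrightarrow> f (r \<odot>\<^bsub>V\<^esub> x) = r \<otimes>\<^bsub>k\<^esub> f x"
  shows "f \<in> dual k V"
  using assms by (auto simp: dual_def)

lemma annihilatorD:
  "f \<in> annihilator k V X \<Longrightarrow> f \<in> dual k V"
  "f \<in> annihilator k V X \<Longrightarrow> x \<in> X \<Longrightarrow> f x = \<zero>\<^bsub>k\<^esub>"
  by (auto simp: annihilator_def)

lemma annihilator_antimono: "X \<subseteq> Y \<Longrightarrow> annihilator k V Y \<subseteq> annihilator k V X"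
  by (auto simp: annihilator_def)

section \<open>Separation and extension of functionals\<close>

definition add_line ::
    "('k, 'r) ring_scheme \<Rightarrow> ('k, 'a, 'm) module_scheme \<Rightarrow> 'a set \<Rightarrow> 'a \<Rightarrow> 'a set"
  where "add_line k V H v = {h \<oplus>\<^bsub>V\<^esub> r \<odot>\<^bsub>V\<^esub> v | h r. h \<in> H \<and> r \<in> carrier k}"

locale linear_space = module k V + field k
  for k :: "('k, 'r) ring_scheme" (structure) and V :: "('k, 'a, 'm) module_scheme"
begin

lemma dual_closed [simp]: "f \<in> dual k V \<Longrightarrow> x \<in> carrier V \<Longrightarrow> f x \<in> carrier k"
  unfolding dual_def by blast

lemma dual_add [simp]:
  "f \<in> dual k V \<Longrightarrow> x \<in> carrier V \<Longrightarrow> y \<in> carrier V \<Longrightarrow> f (x \<oplus>\<^bsub>V\<^esub> y) = f x \<oplus> f y"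
  unfolding dual_def by blast

lemma dual_smult [simp]:
  "f \<in> dual k V \<Longrightarrow> r \<in> carrier k \<Longrightarrow> x \<in> carrier V \<Longrightarrow> f (r \<odot>\<^bsub>V\<^esub> x) = r \<otimes> f x"
  unfolding dual_def by blast

lemma dual_zero [simp]: "f \<in> dual k V \<Longrightarrow> f \<zero>\<^bsub>V\<^esub> = \<zero>"
  using dual_smult[of f \<zero> "\<zero>\<^bsub>V\<^esub>"] by simp

lemma dual_minus [simp]: "f \<in> dual k V \<Longrightarrow> x \<in> carrier V \<Longrightarrow> f (\<ominus>\<^bsub>V\<^esub> x) = \<ominus> f x"
  using dual_add[of f "\<ominus>\<^bsub>V\<^esub> x" x] R.minus_equality[of "f (\<ominus>\<^bsub>V\<^esub> x)" "f x"] by (simp add: M.l_neg)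

lemma zero_in_dual: "(\<lambda>_. \<zero>) \<in> dual k V"
  by (rule dualI) auto

lemma submodule_zero: "submodule {\<zero>\<^bsub>V\<^esub>} k V"
  by (rule submoduleI) auto

lemma submodule_carrier: "submodule (carrier V) k V"
  by (rule carrier_is_submodule)

lemma submodule_add_line:
  assumes H: "submodule H k V" and v: "v \<in> carrier V"
  shows "submodule (add_line k V H v) k V"
proof (rule submoduleI)
  note HE = submoduleE[OF H]
  have Hc: "h \<in> H \<Longrightarrow> h \<in> carrier V" for h using HE(1) by auto
  show "add_line k V H v \<subseteq> carrier V" using v Hc by (auto simp: add_line_def)
  obtain h where h: "h \<in> H" using HE(2) by auto
  have "\<zero>\<^bsub>V\<^esub> \<in> H" using HE(5)[OF h HE(3)[OF h]] Hc[OF h] by (simp add: M.r_neg)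
  then show "\<zero>\<^bsub>V\<^esub> \<in> add_line k V H v"
    using v by (auto simp: add_line_def intro!: exI[of _ "\<zero>\<^bsub>V\<^esub>"] exI[of _ \<zero>])
next
  note HE = submoduleE[OF H]
  have Hc: "h \<in> H \<Longrightarrow> h \<in> carrier V" for h using HE(1) by auto
  fix a assume "a \<in> add_line k V H v"
  then obtain h r where *: "a = h \<oplus>\<^bsub>V\<^esub> r \<odot>\<^bsub>V\<^esub> v" "h \<in> H" "r \<in> carrier k" by (auto simp: add_line_def)
  have "\<ominus>\<^bsub>V\<^esub> a = \<ominus>\<^bsub>V\<^esub> h \<oplus>\<^bsub>V\<^esub> (\<ominus> r) \<odot>\<^bsub>V\<^esub> v"
    using * v Hc by (simp add: M.minus_add smult_l_minus)
  then show "\<ominus>\<^bsub>V\<^esub> a \<in> add_line k V H v" using * HE(3) by (auto simp: add_line_def)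
  {
    fix b assume "b \<in> add_line k V H v"
    then obtain h' r' where **: "b = h' \<oplus>\<^bsub>V\<^esub> r' \<odot>\<^bsub>V\<^esub> v" "h' \<in> H" "r' \<in> carrier k"
      by (auto simp: add_line_def)
    have "a \<oplus>\<^bsub>V\<^esub> b = (h \<oplus>\<^bsub>V\<^esub> h') \<oplus>\<^bsub>V\<^esub> (r \<oplus> r') \<odot>\<^bsub>V\<^esub> v"
      using * ** v Hc by (simp add: smult_l_distr M.a_ac)
    then show "a \<oplus>\<^bsub>V\<^esub> b \<in> add_line k V H v" using * ** HE(5) by (auto simp: add_line_def)
  }
  {
    fix s assume s: "s \<in> carrier k"
    have "s \<odot>\<^bsub>V\<^esub> a = (s \<odot>\<^bsub>V\<^esub> h) \<oplus>\<^bsub>V\<^esub> (s \<otimes> r) \<odot>\<^bsub>V\<^esub> v"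
      using * s v Hc by (simp add: smult_r_distr smult_assoc1)
    then show "s \<odot>\<^bsub>V\<^esub> a \<in> add_line k V H v" using * s HE(4) by (auto simp: add_line_def)
  }
qed

lemma submodule_zero_mem: "submodule H k V \<Longrightarrow> \<zero>\<^bsub>V\<^esub> \<in> H"
  using submodule.axioms(1) subgroup.one_closed by fastforce

lemma add_line_subset: "submodule H k V \<Longrightarrow> v \<in> carrier V \<Longrightarrow> H \<subseteq> add_line k V H v"
  using submoduleE(1) by (force simp: add_line_def intro: exI[of _ \<zero>])

lemma add_line_mem: "submodule H k V \<Longrightarrow> v \<in> carrier V \<Longrightarrow> v \<in> add_line k V H v"
  using submodule_zero_mem
  by (auto simp: add_line_def intro!: exI[of _ "\<zero>\<^bsub>V\<^esub>"] exI[of _ \<one>])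

text \<open>A subspace \<open>H\<close> that is maximal among those containing \<open>X\<close> but not \<open>v\<close> is a hyperplane
  with complement \<open>k v\<close>, and the coordinate along \<open>v\<close> is the functional.\<close>

lemma separating_functional:
  assumes X: "submodule X k V" and v: "v \<in> carrier V" "v \<notin> X"
  obtains f where "f \<in> annihilator k V X" "f v = \<one>"
proof -
  define A where "A = {H. submodule H k V \<and> X \<subseteq> H \<and> v \<notin> H}"
  have "\<exists>H\<in>A. \<forall>K\<in>A. H \<subseteq> K \<longrightarrow> K = H"
  proof (rule subset_Zorn_nonempty)
    show "A \<noteq> {}" using X v by (auto simp: A_def)
    fix C assume C: "C \<noteq> {}" "subset.chain A C"
    have CA: "H \<in> C \<Longrightarrow> H \<in> A" for H using C(2) by (auto simp: subset.chain_def)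
    have "submodule (\<Union>C) k V"
    proof (rule submoduleI)
      show "\<Union>C \<subseteq> carrier V" using CA submoduleE(1) by (fastforce simp: A_def)
      show "\<zero>\<^bsub>V\<^esub> \<in> \<Union>C" using C(1) CA submodule_zero_mem by (fastforce simp: A_def)
      show "\<ominus>\<^bsub>V\<^esub> a \<in> \<Union>C" if "a \<in> \<Union>C" for a
        using that CA submoduleE(3) by (fastforce simp: A_def)
      show "r \<odot>\<^bsub>V\<^esub> a \<in> \<Union>C" if "r \<in> carrier k" "a \<in> \<Union>C" for r a
        using that CA submoduleE(4) by (fastforce simp: A_def)
      show "a \<oplus>\<^bsub>V\<^esub> b \<in> \<Union>C" if ab: "a \<in> \<Union>C" "b \<in> \<Union>C" for a b
      proof -
        obtain H K where HK: "a \<in> H" "H \<in> C" "b \<in> K" "K \<in> C" using ab by auto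
        then consider "H \<subseteq> K" | "K \<subseteq> H" using C(2) by (auto simp: subset.chain_def)
        then show ?thesis
        proof cases
          case 1
          then show ?thesis using HK CA[OF HK(4)] submoduleE(5)[of K a b] by (auto simp: A_def)
        next
          case 2
          then show ?thesis using HK CA[OF HK(2)] submoduleE(5)[of H a b] by (auto simp: A_def)
        qed
      qed
    qed
    then show "\<Union>C \<in> A" using C(1) CA by (fastforce simp: A_def)
  qed
  then obtain H where H: "submodule H k V" "X \<subseteq> H" "v \<notin> H"
    and max: "\<And>K. submodule K k V \<Longrightarrow> X \<subseteq> K \<Longrightarrow> v \<notin> K \<Longrightarrow> H \<subseteq> K \<Longrightarrow> K = H"
    unfolding A_def mem_Collect_eq by (elim bexE) (metis (mono_tags, lifting) mem_Collect_eq)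
  note HE = submoduleE[OF H(1)]
  have Hc: "h \<in> H \<Longrightarrow> h \<in> carrier V" for h using HE(1) by auto
  have ex: "\<exists>r\<in>carrier k. \<exists>h\<in>H. x = h \<oplus>\<^bsub>V\<^esub> r \<odot>\<^bsub>V\<^esub> v" if x: "x \<in> carrier V" for x
  proof (cases "x \<in> H")
    case True
    then show ?thesis using x v by (intro bexI[of _ \<zero>] bexI[of _ x]) auto
  next
    case False
    \<comment> \<open>Adding x to H gives a strictly larger subspace containing X, so by maximality
      it contains v. The coefficient of x in v is nonzero because v is not in H, hence x can be
      solved for.\<close>
    have "v \<in> add_line k V H x"
      using max[OF submodule_add_line[OF H(1) x]] add_line_subset[OF H(1) x]
        add_line_mem[OF H(1) x] False H(2) by auto
    then obtain h r where hr: "v = h \<oplus>\<^bsub>V\<^esub> r \<odot>\<^bsub>V\<^esub> x" "h \<in> H" "r \<in> carrier k"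
      by (auto simp: add_line_def)
    have "r \<noteq> \<zero>" using hr H(3) x Hc by auto
    then have r: "r \<in> Units k" using hr(3) by (simp add: field_Units)
    then have ri: "inv r \<in> carrier k" by auto
    have "inv r \<odot>\<^bsub>V\<^esub> v = inv r \<odot>\<^bsub>V\<^esub> h \<oplus>\<^bsub>V\<^esub> x"
      using hr x r ri Hc by (simp add: smult_r_distr smult_assoc1[symmetric])
    then have "x = \<ominus>\<^bsub>V\<^esub> (inv r \<odot>\<^bsub>V\<^esub> h) \<oplus>\<^bsub>V\<^esub> inv r \<odot>\<^bsub>V\<^esub> v"
      using ri hr(2) Hc x by (simp add: M.a_assoc[symmetric] M.l_neg)
    then show ?thesis using ri HE(3)[OF HE(4)[OF ri hr(2)]] by blast
  qed
  have uniq: "r = s" if rs: "h \<oplus>\<^bsub>V\<^esub> r \<odot>\<^bsub>V\<^esub> v = h' \<oplus>\<^bsub>V\<^esub> s \<odot>\<^bsub>V\<^esub> v" "h \<in> H" "h' \<in> H"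
      "r \<in> carrier k" "s \<in> carrier k" for r s h h'
  proof (rule ccontr)
    assume "r \<noteq> s"
    have c: "h \<in> carrier V" "h' \<in> carrier V" using rs Hc by auto
    have "r \<ominus> s \<noteq> \<zero>" using rs \<open>r \<noteq> s\<close> R.r_right_minus_eq by blast
    then have u: "r \<ominus> s \<in> Units k" using rs(4,5) by (simp add: field_Units)
    have rv: "r \<odot>\<^bsub>V\<^esub> v = \<ominus>\<^bsub>V\<^esub> h \<oplus>\<^bsub>V\<^esub> (h' \<oplus>\<^bsub>V\<^esub> s \<odot>\<^bsub>V\<^esub> v)"
      unfolding rs(1)[symmetric] using rs(4) c v by (simp add: M.r_neg1)
    have "(r \<ominus> s) \<odot>\<^bsub>V\<^esub> v = r \<odot>\<^bsub>V\<^esub> v \<oplus>\<^bsub>V\<^esub> \<ominus>\<^bsub>V\<^esub> (s \<odot>\<^bsub>V\<^esub> v)"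
      using rs v by (simp add: a_minus_def smult_l_distr smult_l_minus)
    also have "\<dots> = \<ominus>\<^bsub>V\<^esub> h \<oplus>\<^bsub>V\<^esub> h'"
      unfolding rv using rs c v by (simp add: M.a_assoc M.r_neg)
    finally have "(r \<ominus> s) \<odot>\<^bsub>V\<^esub> v \<in> H" using HE(3,5) rs by simp
    then have "inv (r \<ominus> s) \<odot>\<^bsub>V\<^esub> ((r \<ominus> s) \<odot>\<^bsub>V\<^esub> v) \<in> H" using u HE(4) by auto
    moreover have "inv (r \<ominus> s) \<odot>\<^bsub>V\<^esub> ((r \<ominus> s) \<odot>\<^bsub>V\<^esub> v) = v"
      using u rs v by (simp add: smult_assoc1[symmetric])
    ultimately show False using H(3) by simp
  qed
  define f where "f x = (SOME r. r \<in> carrier k \<and> (\<exists>h\<in>H. x = h \<oplus>\<^bsub>V\<^esub> r \<odot>\<^bsub>V\<^esub> v))" for x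
  have f: "f x = r" if "x = h \<oplus>\<^bsub>V\<^esub> r \<odot>\<^bsub>V\<^esub> v" "h \<in> H" "r \<in> carrier k" for x h r
  proof -
    have "f x \<in> carrier k \<and> (\<exists>h\<in>H. x = h \<oplus>\<^bsub>V\<^esub> f x \<odot>\<^bsub>V\<^esub> v)"
      unfolding f_def by (rule someI[of _ r]) (use that in blast)
    then obtain h' where "h' \<in> H" "x = h' \<oplus>\<^bsub>V\<^esub> f x \<odot>\<^bsub>V\<^esub> v" "f x \<in> carrier k"
      by blast
    then show ?thesis using uniq[of h' "f x" h r] that by simp
  qed
  have "f \<in> dual k V"
  proof (rule dualI)
    fix x assume x: "x \<in> carrier V"
    then obtain r h where rh: "r \<in> carrier k" "h \<in> H" "x = h \<oplus>\<^bsub>V\<^esub> r \<odot>\<^bsub>V\<^esub> v" using ex by blast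
    have fx: "f x = r" using f rh by auto
    then show "f x \<in> carrier k" using rh by simp
    {
      fix y assume y: "y \<in> carrier V"
      then obtain s h' where sh: "s \<in> carrier k" "h' \<in> H" "y = h' \<oplus>\<^bsub>V\<^esub> s \<odot>\<^bsub>V\<^esub> v" using ex by blast
      have "x \<oplus>\<^bsub>V\<^esub> y = (h \<oplus>\<^bsub>V\<^esub> h') \<oplus>\<^bsub>V\<^esub> (r \<oplus> s) \<odot>\<^bsub>V\<^esub> v"
        using rh sh v Hc by (simp add: smult_l_distr M.a_ac)
      then show "f (x \<oplus>\<^bsub>V\<^esub> y) = f x \<oplus> f y"
        using f[of "x \<oplus>\<^bsub>V\<^esub> y"] f[OF sh(3,2,1)] fx rh sh HE(5) by auto
    }
    {
      fix s assume s: "s \<in> carrier k"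
      have "s \<odot>\<^bsub>V\<^esub> x = (s \<odot>\<^bsub>V\<^esub> h) \<oplus>\<^bsub>V\<^esub> (s \<otimes> r) \<odot>\<^bsub>V\<^esub> v"
        using rh s v Hc by (simp add: smult_r_distr smult_assoc1)
      then show "f (s \<odot>\<^bsub>V\<^esub> x) = s \<otimes> f x"
        using f[of "s \<odot>\<^bsub>V\<^esub> x"] fx rh s HE(4) by auto
    }
  qed
  moreover have "f x = \<zero>" if "x \<in> X" for x
    using f[of x x \<zero>] that H(2) Hc v by (auto simp: subsetD)
  moreover have "f v = \<one>"
    using f[of v "\<zero>\<^bsub>V\<^esub>" \<one>] v submodule_zero_mem[OF H(1)] by auto
  ultimately show thesis using that by (auto simp: annihilator_def)
qed

text \<open>A vector outside X would be sent to 1 by some functional that kills X. In this form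
  membership in a subspace is read off from vanishing pairings in
  \<open>filtered_tensor\<close>.\<close>

lemma double_annihilator:
  assumes "submodule X k V" "v \<in> carrier V" "\<And>f. f \<in> annihilator k V X \<Longrightarrow> f v = \<zero>"
  shows "v \<in> X"
proof (rule ccontr)
  assume "v \<notin> X"
  then obtain f where "f \<in> annihilator k V X" "f v = \<one>"
    by (rule separating_functional[OF assms(1,2)])
  then show False using assms(3)[of f] by simp
qed

text \<open>On Y, a nonzero g is determined by its kernel H and one vector v of value 1. A
  functional on V that separates v from H agrees with g on Y up to nothing, since y - g(y) v lies in
  H. The set X is carried along because it is contained in H; an empty X gives plain
  extension.\<close>

lemma extend_functional:
  assumes Y: "submodule Y k V" and XY: "X \<subseteq> Y"
    and g: "g \<in> dual k (V\<lparr>carrier := Y\<rparr>)" "\<And>x. x \<in> X \<Longrightarrow> g x = \<zero>"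
  obtains f where "f \<in> annihilator k V X" "\<And>y. y \<in> Y \<Longrightarrow> f y = g y"
proof (cases "\<forall>y\<in>Y. g y = \<zero>")
  case True
  have "(\<lambda>_. \<zero>) \<in> annihilator k V X" using zero_in_dual by (simp add: annihilator_def)
  then show thesis using that True by metis
next
  case False
  note YE = submoduleE[OF Y]
  have Yc: "y \<in> Y \<Longrightarrow> y \<in> carrier V" for y using YE(1) by auto
  interpret S: linear_space k "V\<lparr>carrier := Y\<rparr>"
    by (intro linear_space.intro submodule.submodule_is_module[OF Y]) unfold_locales
  have gc [simp]: "y \<in> Y \<Longrightarrow> g y \<in> carrier k" for y using S.dual_closed[OF g(1)] by simp
  have ga [simp]: "x \<in> Y \<Longrightarrow> y \<in> Y \<Longrightarrow> g (x \<oplus>\<^bsub>V\<^esub> y) = g x \<oplus> g y" for x y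
    using S.dual_add[OF g(1)] by simp
  have gs [simp]: "r \<in> carrier k \<Longrightarrow> y \<in> Y \<Longrightarrow> g (r \<odot>\<^bsub>V\<^esub> y) = r \<otimes> g y" for r y
    using S.dual_smult[OF g(1)] by simp
  have gz [simp]: "g \<zero>\<^bsub>V\<^esub> = \<zero>" using S.dual_zero[OF g(1)] by simp
  have gm [simp]: "g (\<ominus>\<^bsub>V\<^esub> y) = \<ominus> g y" if "y \<in> Y" for y
    using ga[OF YE(3)[OF that] that] that Yc[OF that] YE(3)[OF that]
      R.minus_equality[of "g (\<ominus>\<^bsub>V\<^esub> y)" "g y"]
    by (simp add: M.l_neg)
  define H where "H = {y \<in> Y. g y = \<zero>}"
  have H: "submodule H k V"
    by (rule submoduleI) (use Yc YE submodule_zero_mem[OF Y] in \<open>auto simp: H_def\<close>)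
  obtain w where w: "w \<in> Y" "g w \<noteq> \<zero>" using False by auto
  then have u: "g w \<in> Units k" by (simp add: field_Units)
  \<comment> \<open>Rescaled to value 1, so that y - g(y) v lies in the kernel for every y in
    Y.\<close>
  define v where "v = inv (g w) \<odot>\<^bsub>V\<^esub> w"
  have v: "v \<in> Y" "g v = \<one>" using w u YE(4) by (auto simp: v_def)
  have "v \<notin> H" using v by (simp add: H_def)
  with separating_functional[OF H Yc[OF v(1)]] obtain f
    where f: "f \<in> annihilator k V H" "f v = \<one>" by blast
  have "f y = g y" if y: "y \<in> Y" for y
  proof -
    have m: "y \<oplus>\<^bsub>V\<^esub> \<ominus>\<^bsub>V\<^esub> (g y \<odot>\<^bsub>V\<^esub> v) \<in> H"
      unfolding H_def using y v YE(3-5) by (auto simp: R.r_neg)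
    have "\<zero> = f (y \<oplus>\<^bsub>V\<^esub> \<ominus>\<^bsub>V\<^esub> (g y \<odot>\<^bsub>V\<^esub> v))" using annihilatorD(2)[OF f(1) m] by simp
    also have "\<dots> = f y \<oplus> \<ominus> g y"
      using y v f annihilatorD(1)[OF f(1)] Yc by simp
    finally have "f y \<ominus> g y = \<zero>" by (simp add: a_minus_def)
    then show ?thesis
      using y dual_closed[OF annihilatorD(1)[OF f(1)] Yc[OF y]] gc[OF y] R.r_right_minus_eq by blast
  qed
  moreover have "f x = \<zero>" if "x \<in> X" for x
    using annihilatorD(2)[OF f(1), of x] that XY g(2) by (auto simp: H_def)
  ultimately show thesis using that[of f] annihilatorD(1)[OF f(1)] by (auto simp: annihilator_def)
qed

end

section \<open>Tensor products over a field\<close>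

text \<open>This is the fold in the body of \<open>tensor_lift\<close>, separated from the choice of
  a class so that it can be computed on one list.\<close>

definition lsum :: "('w, 'x) ring_scheme \<Rightarrow> ('a \<Rightarrow> 'b \<Rightarrow> 'w) \<Rightarrow> ('a \<times> 'b) list \<Rightarrow> 'w"
  where "lsum W \<beta> xs = foldr (\<lambda>(a, b) v. \<beta> a b \<oplus>\<^bsub>W\<^esub> v) xs \<zero>\<^bsub>W\<^esub>"

lemma lsum_Nil [simp]: "lsum W \<beta> [] = \<zero>\<^bsub>W\<^esub>"
  and lsum_Cons [simp]: "lsum W \<beta> ((a, b) # xs) = \<beta> a b \<oplus>\<^bsub>W\<^esub> lsum W \<beta> xs"
  by (simp_all add: lsum_def)

lemma lsum_cong: "(\<And>a b. (a, b) \<in> set xs \<Longrightarrow> \<beta> a b = \<gamma> a b) \<Longrightarrow> lsum W \<beta> xs = lsum W \<gamma> xs"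
  by (induction xs) auto

lemma lsum_map:
  "lsum W \<beta> (map (\<lambda>(a, b). (p a b, q a b)) xs) = lsum W (\<lambda>a b. \<beta> (p a b) (q a b)) xs"
  by (induction xs) auto

lemma lsum_hom:
  assumes "abelian_monoid W"
    and "\<And>a b. (a, b) \<in> set xs \<Longrightarrow> \<beta> a b \<in> carrier W"
    and "h \<zero>\<^bsub>W\<^esub> = \<zero>\<^bsub>W'\<^esub>"
    and "\<And>x y. x \<in> carrier W \<Longrightarrow> y \<in> carrier W \<Longrightarrow> h (x \<oplus>\<^bsub>W\<^esub> y) = h x \<oplus>\<^bsub>W'\<^esub> h y"
  shows "h (lsum W \<beta> xs) = lsum W' (\<lambda>a b. h (\<beta> a b)) xs"
proof -
  interpret abelian_monoid W by fact
  have "lsum W \<beta> xs \<in> carrier W \<and> h (lsum W \<beta> xs) = lsum W' (\<lambda>a b. h (\<beta> a b)) xs"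
    using assms(2) by (induction xs) (auto simp: assms(3,4))
  then show ?thesis by simp
qed

context abelian_monoid
begin

lemma lsum_closed [intro]:
  "(\<And>a b. (a, b) \<in> set xs \<Longrightarrow> \<beta> a b \<in> carrier G) \<Longrightarrow> lsum G \<beta> xs \<in> carrier G"
  by (induction xs) auto

lemma lsum_append:
  assumes "\<And>a b. (a, b) \<in> set xs \<union> set ys \<Longrightarrow> \<beta> a b \<in> carrier G"
  shows "lsum G \<beta> (xs @ ys) = lsum G \<beta> xs \<oplus> lsum G \<beta> ys"
proof -
  have "lsum G \<beta> ys \<in> carrier G" using assms by auto
  then show ?thesis
    using assms
  proof (induction xs)
    case (Cons x xs)
    obtain a b where x: "x = (a, b)" by force
    have "\<beta> a b \<in> carrier G" "lsum G \<beta> xs \<in> carrier G" using Cons.prems x by auto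
    then show ?case using Cons x by (auto simp: a_assoc)
  qed auto
qed

lemma lsum_add:
  assumes "\<And>a b. (a, b) \<in> set xs \<Longrightarrow> \<beta> a b \<in> carrier G" "\<And>a b. (a, b) \<in> set xs \<Longrightarrow> \<gamma> a b \<in> carrier G"
  shows "lsum G (\<lambda>a b. \<beta> a b \<oplus> \<gamma> a b) xs = lsum G \<beta> xs \<oplus> lsum G \<gamma> xs"
  using assms
proof (induction xs)
  case (Cons x xs)
  obtain a b where x: "x = (a, b)" by force
  have "\<beta> a b \<in> carrier G" "lsum G \<beta> xs \<in> carrier G" "\<gamma> a b \<in> carrier G" "lsum G \<gamma> xs \<in> carrier G"
    using Cons.prems x by auto
  then show ?case using Cons x by (auto simp: a_ac)
qed auto

lemma lsum_zero: "(\<And>a b. (a, b) \<in> set xs \<Longrightarrow> \<beta> a b = \<zero>) \<Longrightarrow> lsum G \<beta> xs = \<zero>"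
  by (induction xs) auto

text \<open>Sorting labelled terms into two groups changes the list, but by commutativity not its
  sum. This is how a tensor is split into one summand from each of two subspaces in
  \<open>filt_Suc_iff\<close>.\<close>

lemma lsum_partition:
  assumes "\<And>a b. (a, b) \<in> snd ` set ws \<Longrightarrow> \<beta> a b \<in> carrier G"
  shows "lsum G \<beta> (map snd (filter p ws) @ map snd (filter (\<lambda>w. \<not> p w) ws)) = lsum G \<beta> (map snd ws)"
  using assms
proof (induction ws)
  case (Cons w ws)
  obtain i a b where w: "w = (i, a, b)" by (cases w)
  have 1: "\<beta> a b \<in> carrier G" using Cons.prems w by force
  have 0: "\<beta> x y \<in> carrier G" if "(x, y) \<in> set (map snd (filter q ws))" for x y q
    using that Cons.prems[of x y] by force
  have 2: "lsum G \<beta> (map snd (filter q ws)) \<in> carrier G" for q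
    by (rule lsum_closed) (rule 0)
  have 3: "lsum G \<beta> (map snd (filter q ws) @ map snd (filter q' ws)) =
      lsum G \<beta> (map snd (filter q ws)) \<oplus> lsum G \<beta> (map snd (filter q' ws))" for q q'
    by (rule lsum_append) (use 0 in blast)
  have 4: "lsum G \<beta> (map snd (filter q ws) @ (a, b) # map snd (filter q' ws)) =
      lsum G \<beta> (map snd (filter q ws)) \<oplus> (\<beta> a b \<oplus> lsum G \<beta> (map snd (filter q' ws)))" for q q'
  proof -
    have "lsum G \<beta> (map snd (filter q ws) @ (a, b) # map snd (filter q' ws)) =
      lsum G \<beta> (map snd (filter q ws)) \<oplus> lsum G \<beta> ((a, b) # map snd (filter q' ws))"
      by (rule lsum_append) (use 0 1 in auto)
    then show ?thesis by simp
  qed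
  have "lsum G \<beta> (map snd (filter p ws) @ map snd (filter (\<lambda>w. \<not> p w) ws)) = lsum G \<beta> (map snd ws)"
    using Cons by auto
  then show ?case using w 1 2 3 4 by (auto simp: a_ac)
qed auto

end

text \<open>One clause for each of the rules \<open>zero\<close>, \<open>add_left\<close>,
  \<open>add_right\<close> and \<open>balanced\<close>. The target has no scalar action, which is
  why linearity over k appears as balancedness; in this way k itself can be a target.\<close>

definition bilinear_map ::
    "('k, 'r) ring_scheme \<Rightarrow> ('k, 'a, 'm) module_scheme \<Rightarrow> ('k, 'b, 'n) module_scheme
      \<Rightarrow> ('w, 'x) ring_scheme \<Rightarrow> ('a \<Rightarrow> 'b \<Rightarrow> 'w) \<Rightarrow> bool"
  where "bilinear_map k M N W \<beta> \<longleftrightarrow>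
    (\<forall>a\<in>carrier M. \<forall>b\<in>carrier N. \<beta> a b \<in> carrier W) \<and>
    (\<forall>b\<in>carrier N. \<beta> \<zero>\<^bsub>M\<^esub> b = \<zero>\<^bsub>W\<^esub>) \<and>
    (\<forall>a\<in>carrier M. \<forall>a'\<in>carrier M. \<forall>b\<in>carrier N. \<beta> (a \<oplus>\<^bsub>M\<^esub> a') b = \<beta> a b \<oplus>\<^bsub>W\<^esub> \<beta> a' b) \<and>
    (\<forall>a\<in>carrier M. \<forall>b\<in>carrier N. \<forall>b'\<in>carrier N. \<beta> a (b \<oplus>\<^bsub>N\<^esub> b') = \<beta> a b \<oplus>\<^bsub>W\<^esub> \<beta> a b') \<and>
    (\<forall>r\<in>carrier k. \<forall>a\<in>carrier M. \<forall>b\<in>carrier N. \<beta> (r \<odot>\<^bsub>M\<^esub> a) b = \<beta> a (r \<odot>\<^bsub>N\<^esub> b))"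

lemma bilinear_mapI:
  assumes "\<And>a b. \<lbrakk>a \<in> carrier M; b \<in> carrier N\<rbrakk> \<Longrightarrow> \<beta> a b \<in> carrier W"
    and "\<And>b. b \<in> carrier N \<Longrightarrow> \<beta> \<zero>\<^bsub>M\<^esub> b = \<zero>\<^bsub>W\<^esub>"
    and "\<And>a a' b. \<lbrakk>a \<in> carrier M; a' \<in> carrier M; b \<in> carrier N\<rbrakk>
      \<Longrightarrow> \<beta> (a \<oplus>\<^bsub>M\<^esub> a') b = \<beta> a b \<oplus>\<^bsub>W\<^esub> \<beta> a' b"
    and "\<And>a b b'. \<lbrakk>a \<in> carrier M; b \<in> carrier N; b' \<in> carrier N\<rbrakk>
      \<Longrightarrow> \<beta> a (b \<oplus>\<^bsub>N\<^esub> b') = \<beta> a b \<oplus>\<^bsub>W\<^esub> \<beta> a b'"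
    and "\<And>r a b. \<lbrakk>r \<in> carrier k; a \<in> carrier M; b \<in> carrier N\<rbrakk>
      \<Longrightarrow> \<beta> (r \<odot>\<^bsub>M\<^esub> a) b = \<beta> a (r \<odot>\<^bsub>N\<^esub> b)"
  shows "bilinear_map k M N W \<beta>"
  using assms unfolding bilinear_map_def by blast

lemma bilinear_mapD:
  assumes "bilinear_map k M N W \<beta>"
  shows "\<And>a b. \<lbrakk>a \<in> carrier M; b \<in> carrier N\<rbrakk> \<Longrightarrow> \<beta> a b \<in> carrier W"
    and "\<And>b. b \<in> carrier N \<Longrightarrow> \<beta> \<zero>\<^bsub>M\<^esub> b = \<zero>\<^bsub>W\<^esub>"
    and "\<And>a a' b. \<lbrakk>a \<in> carrier M; a' \<in> carrier M; b \<in> carrier N\<rbrakk>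
      \<Longrightarrow> \<beta> (a \<oplus>\<^bsub>M\<^esub> a') b = \<beta> a b \<oplus>\<^bsub>W\<^esub> \<beta> a' b"
    and "\<And>a b b'. \<lbrakk>a \<in> carrier M; b \<in> carrier N; b' \<in> carrier N\<rbrakk>
      \<Longrightarrow> \<beta> a (b \<oplus>\<^bsub>N\<^esub> b') = \<beta> a b \<oplus>\<^bsub>W\<^esub> \<beta> a b'"
    and "\<And>r a b. \<lbrakk>r \<in> carrier k; a \<in> carrier M; b \<in> carrier N\<rbrakk>
      \<Longrightarrow> \<beta> (r \<odot>\<^bsub>M\<^esub> a) b = \<beta> a (r \<odot>\<^bsub>N\<^esub> b)"
  using assms unfolding bilinear_map_def by blast+

section \<open>Functionals on lists of pairs separate tensors\<close>

definition pairing :: "('k, 'r) ring_scheme \<Rightarrow> ('a \<Rightarrow> 'k) \<Rightarrow> ('b \<Rightarrow> 'k) \<Rightarrow> ('a \<times> 'b) list \<Rightarrow> 'k"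
  where "pairing k f g = lsum k (\<lambda>a b. f a \<otimes>\<^bsub>k\<^esub> g b)"

definition tensor_pairing ::
    "('k, 'r) ring_scheme \<Rightarrow> ('a \<Rightarrow> 'k) \<Rightarrow> ('b \<Rightarrow> 'k) \<Rightarrow> ('a \<times> 'b) list set \<Rightarrow> 'k"
  where "tensor_pairing k f g = tensor_lift k (\<lambda>a b. f a \<otimes>\<^bsub>k\<^esub> g b)"

locale linear_space_pair = M: linear_space k M + N: linear_space k N
  for k :: "('k, 'r) ring_scheme" (structure)
    and M :: "('k, 'a, 'm) module_scheme" and N :: "('k, 'b, 'n) module_scheme"
begin

abbreviation "pairs \<equiv> carrier M \<times> carrier N"
abbreviation "teq \<equiv> tensor_eq k M N"
abbreviation "T \<equiv> tensor_space k M N"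

lemma tensor_eq_pairs:
  assumes "teq xs ys"
  shows "set xs \<subseteq> pairs" "set ys \<subseteq> pairs"
proof -
  have "set xs \<subseteq> pairs \<and> set ys \<subseteq> pairs"
    using assms by induction auto
  then show "set xs \<subseteq> pairs" "set ys \<subseteq> pairs" by auto
qed

text \<open>The universal property on the level of lists: each rule generating the congruence is
  respected, \<open>commute\<close> because addition in W is commutative.\<close>

lemma tensor_eq_lsum:
  assumes W: "abelian_monoid W" and \<beta>: "bilinear_map k M N W \<beta>" and "teq xs ys"
  shows "lsum W \<beta> xs = lsum W \<beta> ys"
proof -
  interpret W: abelian_monoid W by fact
  note [simp] = bilinear_mapD[OF \<beta>]
  have app: "lsum W \<beta> (xs @ ys) = lsum W \<beta> xs \<oplus>\<^bsub>W\<^esub> lsum W \<beta> ys"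
    if "set xs \<subseteq> pairs" "set ys \<subseteq> pairs" for xs ys
    by (rule W.lsum_append) (use that in auto)
  have cl: "lsum W \<beta> xs \<in> carrier W" if "set xs \<subseteq> pairs" for xs
    by (rule W.lsum_closed) (use that in auto)
  show ?thesis
    using assms(3)
  proof induction
    case (append xs xs' ys ys')
    then show ?case using app tensor_eq_pairs by metis
  next
    case (commute xs ys)
    then show ?case using app cl W.a_comm by metis
  qed simp_all
qed

lemma bilinear_pairing:
  assumes "f \<in> dual k M" "g \<in> dual k N"
  shows "bilinear_map k M N k (\<lambda>a b. f a \<otimes> g b)"
  by (rule bilinear_mapI) (use assms in \<open>auto simp: M.R.l_distr M.R.r_distr M.R.m_ac\<close>)

lemma pairing_Nil [simp]: "pairing k f g [] = \<zero>"
  and pairing_Cons [simp]: "pairing k f g ((a, b) # xs) = f a \<otimes> g b \<oplus> pairing k f g xs"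
  by (simp_all add: pairing_def)

lemma pairing_closed [simp]:
  "f \<in> dual k M \<Longrightarrow> g \<in> dual k N \<Longrightarrow> set xs \<subseteq> pairs \<Longrightarrow> pairing k f g xs \<in> carrier k"
  unfolding pairing_def by (rule M.R.lsum_closed) auto

lemma pairing_append [simp]:
  "f \<in> dual k M \<Longrightarrow> g \<in> dual k N \<Longrightarrow> set xs \<subseteq> pairs \<Longrightarrow> set ys \<subseteq> pairs
    \<Longrightarrow> pairing k f g (xs @ ys) = pairing k f g xs \<oplus> pairing k f g ys"
  unfolding pairing_def by (rule M.R.lsum_append) auto

lemma tensor_eq_pairing:
  "teq xs ys \<Longrightarrow> f \<in> dual k M \<Longrightarrow> g \<in> dual k N \<Longrightarrow> pairing k f g xs = pairing k f g ys"
  unfolding pairing_def by (rule tensor_eq_lsum[OF M.R.abelian_monoid_axioms bilinear_pairing])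

lemma tensor_eq_Cons: "x \<in> pairs \<Longrightarrow> teq xs ys \<Longrightarrow> teq (x # xs) (x # ys)"
  using tensor_eq.append[OF tensor_eq.refl[of "[x]"]] by fastforce

lemma tensor_eq_swap:
  "x \<in> pairs \<Longrightarrow> y \<in> pairs \<Longrightarrow> set xs \<subseteq> pairs \<Longrightarrow> teq (x # y # xs) (y # x # xs)"
  using tensor_eq.append[OF tensor_eq.commute[of "[x]" M N "[y]" k] tensor_eq.refl[of xs]]
  by simp

text \<open>An elementary column operation: the multiple r b crosses the tensor sign and is absorbed
  by the coefficient of b, so the number of pairs stays the same.\<close>

lemma tensor_eq_split_right:
  assumes "a \<in> carrier M" "c \<in> carrier M" "v \<in> carrier N" "b \<in> carrier N" "r \<in> carrier k"
    "set xs \<subseteq> pairs"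
  shows "teq ((a, v \<oplus>\<^bsub>N\<^esub> r \<odot>\<^bsub>N\<^esub> b) # (c, b) # xs) ((a, v) # (r \<odot>\<^bsub>M\<^esub> a \<oplus>\<^bsub>M\<^esub> c, b) # xs)"
proof -
  have "teq ([(a, v \<oplus>\<^bsub>N\<^esub> r \<odot>\<^bsub>N\<^esub> b)] @ (c, b) # xs) ([(a, v), (a, r \<odot>\<^bsub>N\<^esub> b)] @ (c, b) # xs)"
    using assms by (intro tensor_eq.append tensor_eq.add_right tensor_eq.refl) auto
  moreover have "teq ((a, v) # [(a, r \<odot>\<^bsub>N\<^esub> b)] @ (c, b) # xs) ((a, v) # [(r \<odot>\<^bsub>M\<^esub> a, b)] @ (c, b) # xs)"
    using assms
    by (intro tensor_eq_Cons tensor_eq.append tensor_eq.sym[OF tensor_eq.balanced] tensor_eq.refl) auto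
  moreover have "teq ((a, v) # [(r \<odot>\<^bsub>M\<^esub> a, b), (c, b)] @ xs) ((a, v) # [(r \<odot>\<^bsub>M\<^esub> a \<oplus>\<^bsub>M\<^esub> c, b)] @ xs)"
    using assms
    by (intro tensor_eq_Cons tensor_eq.append tensor_eq.sym[OF tensor_eq.add_left] tensor_eq.refl) auto
  ultimately show ?thesis using tensor_eq.trans by (metis append_Cons append_Nil)
qed

abbreviation "add_span Q bs \<equiv> foldr (\<lambda>b H. add_line k N H b) bs Q"

lemma submodule_add_span:
  "submodule Q k N \<Longrightarrow> set bs \<subseteq> carrier N \<Longrightarrow> submodule (add_span Q bs) k N"
  by (induction bs) (auto intro: N.submodule_add_line)

lemma add_span_subset:
  assumes "submodule Q k N" "set bs \<subseteq> carrier N"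
  shows "Q \<subseteq> add_span Q bs" "set bs \<subseteq> add_span Q bs"
proof -
  have "Q \<subseteq> add_span Q bs \<and> set bs \<subseteq> add_span Q bs"
    using assms(2)
  proof (induction bs)
    case (Cons b bs)
    then show ?case
      using N.add_line_subset[OF submodule_add_span[OF assms(1)], of bs b]
        N.add_line_mem[OF submodule_add_span[OF assms(1)], of bs b] by auto
  qed auto
  then show "Q \<subseteq> add_span Q bs" "set bs \<subseteq> add_span Q bs" by auto
qed

text \<open>Gaussian elimination along the list: the components of v along the other second entries
  are removed one at a time by \<open>tensor_eq_split_right\<close>. That the length is kept is what
  the induction in \<open>filtered_tensor\<close> relies on.\<close>

lemma tensor_eq_reduce:
  assumes "submodule Q k N" "a \<in> carrier M" "set xs \<subseteq> pairs" "v \<in> add_span Q (map snd xs)"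
  shows "\<exists>y\<in>Q. \<exists>ys. length ys = length xs \<and> set ys \<subseteq> pairs \<and> teq ((a, v) # xs) ((a, y) # ys)"
  using assms(3,4)
proof (induction xs arbitrary: v)
  case Nil
  then show ?case
    using assms(2) N.submoduleE(1)[OF assms(1)]
    by (intro bexI[of _ v] exI[of _ "[]"]) (auto intro!: tensor_eq.refl)
next
  case (Cons x xs)
  obtain c b where x: "x = (c, b)" by force
  have cb: "c \<in> carrier M" "b \<in> carrier N" "set xs \<subseteq> pairs" using Cons.prems x by auto
  obtain w r where v: "v = w \<oplus>\<^bsub>N\<^esub> r \<odot>\<^bsub>N\<^esub> b" "w \<in> add_span Q (map snd xs)" "r \<in> carrier k"
    using Cons.prems(2) x by (auto simp: add_line_def)
  have "set (map snd xs) \<subseteq> carrier N" using cb(3) by auto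
  then have w: "w \<in> carrier N"
    using N.submoduleE(1)[OF submodule_add_span[OF assms(1)]] v(2) by blast
  obtain y ys where ys: "y \<in> Q" "length ys = length xs" "set ys \<subseteq> pairs" "teq ((a, w) # xs) ((a, y) # ys)"
    using Cons.IH[OF cb(3) v(2)] by blast
  have y: "y \<in> carrier N" using N.submoduleE(1)[OF assms(1)] ys(1) by blast
  let ?d = "r \<odot>\<^bsub>M\<^esub> a \<oplus>\<^bsub>M\<^esub> c"
  have d: "?d \<in> carrier M" using assms(2) cb v by simp
  have "teq ((a, v) # x # xs) ((a, w) # (?d, b) # xs)"
    unfolding v(1) x by (rule tensor_eq_split_right) (use assms(2) cb v w in auto)
  also have "teq \<dots> ((?d, b) # (a, w) # xs)"
    by (rule tensor_eq_swap) (use assms(2) cb d w in auto)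
  also (tensor_eq.trans) have "teq \<dots> ((?d, b) # (a, y) # ys)"
    by (rule tensor_eq_Cons[OF _ ys(4)]) (use cb d in auto)
  also (tensor_eq.trans) have "teq \<dots> ((a, y) # (?d, b) # ys)"
    by (rule tensor_eq_swap) (use assms(2) cb d y ys in auto)
  finally (tensor_eq.trans) show ?case
    using ys cb d by (intro bexI[of _ y] exI[of _ "(?d, b) # ys"]) auto
qed

text \<open>Induction on the length of the list. Let \<open>q\<close> be least such that the second entry of the
  first pair \<open>(a, b)\<close> lies in \<open>Q q\<close> plus the span of the other second entries. Then the pair can
  be replaced by one with second entry in \<open>Q q\<close>, and a functional separating \<open>b\<close> from \<open>Q (q - 1)\<close>
  and the other second entries shows that \<open>a\<close> lies in \<open>P q\<close>.\<close>

lemma filtered_tensor: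
  assumes P: "\<And>i. i \<le> Suc m \<Longrightarrow> submodule (P i) k M" and Q: "\<And>i. i \<le> Suc m \<Longrightarrow> submodule (Q i) k N"
    and P_anti: "\<And>i j. i \<le> j \<Longrightarrow> j \<le> Suc m \<Longrightarrow> P j \<subseteq> P i"
    and Q_mono: "\<And>i j. i \<le> j \<Longrightarrow> j \<le> Suc m \<Longrightarrow> Q i \<subseteq> Q j"
    and P0: "P 0 = carrier M" and Qm: "Q (Suc m) = carrier N"
    and xs: "set xs \<subseteq> pairs"
    and ann: "\<And>i f g. i \<le> m \<Longrightarrow> f \<in> annihilator k M (P (Suc i)) \<Longrightarrow> g \<in> annihilator k N (Q i)
      \<Longrightarrow> pairing k f g xs = \<zero>"
  shows "\<exists>ws. (\<forall>(i, a, b)\<in>set ws. i \<le> Suc m \<and> a \<in> P i \<and> b \<in> Q i) \<and> teq xs (map snd ws)"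
  using xs ann
proof (induction "length xs" arbitrary: xs)
  case 0
  then show ?case by (intro exI[of _ "[]"]) (auto intro: tensor_eq.refl)
next
  case (Suc n)
  then obtain a b xs' where xs': "xs = (a, b) # xs'" by (metis length_Suc_conv surj_pair)
  have c: "a \<in> carrier M" "b \<in> carrier N" "set xs' \<subseteq> pairs" using Suc.prems xs' by auto
  then have c': "set (map snd xs') \<subseteq> carrier N" by auto
  define q where "q = (LEAST q. b \<in> add_span (Q q) (map snd xs'))"
  have bm: "b \<in> add_span (Q (Suc m)) (map snd xs')"
    using add_span_subset(1)[OF Q[of "Suc m"] c'] c(2) Qm by auto
  then have bq: "b \<in> add_span (Q q) (map snd xs')" unfolding q_def by (rule LeastI)
  have qm: "q \<le> Suc m" unfolding q_def using bm by (rule Least_le)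
  have aq: "a \<in> P q"
  proof (cases q)
    case 0
    then show ?thesis using c(1) P0 by simp
  next
    case (Suc p)
    let ?H = "add_span (Q p) (map snd xs')"
    have H: "submodule ?H k N" using Q[of p] qm Suc submodule_add_span[OF _ c'] by auto
    have "b \<notin> ?H"
      using not_less_Least[of p "\<lambda>q. b \<in> add_span (Q q) (map snd xs')"] Suc unfolding q_def by auto
    then obtain g where g: "g \<in> annihilator k N ?H" "g b = \<one>"
      using N.separating_functional[OF H c(2)] by blast
    have gd: "g \<in> dual k N" using g by (simp add: annihilator_def)
    show ?thesis
    proof (rule M.double_annihilator[OF P[OF qm] c(1)])
      fix f assume f: "f \<in> annihilator k M (P q)"
      have fd: "f \<in> dual k M" using f by (simp add: annihilator_def)
      have "g \<in> annihilator k N (Q p)"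
        using annihilator_antimono[OF add_span_subset(1)[OF Q[of p] c']] g(1) qm Suc by auto
      then have "pairing k f g xs = \<zero>" using Suc.prems(2)[of p f g] f qm Suc by auto
      moreover have "pairing k f g xs' = \<zero>"
        unfolding pairing_def
      proof (rule M.R.lsum_zero)
        fix x y assume xy: "(x, y) \<in> set xs'"
        then have "y \<in> ?H" using add_span_subset(2)[OF Q[of p] c'] qm Suc by force
        then have "g y = \<zero>" using g(1) by (simp add: annihilator_def)
        then show "f x \<otimes> g y = \<zero>" using fd xy c(3) by auto
      qed
      ultimately show "f a = \<zero>" using xs' g(2) fd c by simp
    qed
  qed
  obtain y ys where ys: "y \<in> Q q" "length ys = length xs'" "set ys \<subseteq> pairs" "teq xs ((a, y) # ys)"
    using tensor_eq_reduce[OF Q[OF qm] c(1,3) bq] xs' by blast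
  have y: "y \<in> carrier N" using N.submoduleE(1)[OF Q[OF qm]] ys(1) by auto
  \<comment> \<open>The first pair now lies in \<open>P q\<close> and \<open>Q q\<close>, so every
    admissible pair of functionals kills it: g kills y if q \<le> i, and f kills a if q > i. Hence
    the shorter list inherits the hypothesis on pairings.\<close>
  have "\<exists>ws. (\<forall>(i, a, b)\<in>set ws. i \<le> Suc m \<and> a \<in> P i \<and> b \<in> Q i) \<and> teq ys (map snd ws)"
  proof (rule Suc.hyps(1))
    show "n = length ys" using Suc.hyps(2) xs' ys(2) by simp
    show "set ys \<subseteq> pairs" by fact
    fix i f g assume i: "i \<le> m" and f: "f \<in> annihilator k M (P (Suc i))"
      and g: "g \<in> annihilator k N (Q i)"
    have fd: "f \<in> dual k M" "g \<in> dual k N" using f g by (simp_all add: annihilator_def)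
    have "f a \<otimes> g y = \<zero>"
    proof (cases "q \<le> i")
      case True
      then have "g y = \<zero>" using Q_mono[of q i] i ys(1) g by (auto simp: annihilator_def)
      then show ?thesis using fd c by simp
    next
      case False
      then have "f a = \<zero>" using P_anti[of "Suc i" q] qm aq f by (auto simp: annihilator_def)
      then show ?thesis using fd y by simp
    qed
    then show "pairing k f g ys = \<zero>"
      using Suc.prems(2)[OF i f g] tensor_eq_pairing[OF ys(4) fd] fd ys(3) by simp
  qed
  then obtain ws where ws: "\<forall>(i, a, b)\<in>set ws. i \<le> Suc m \<and> a \<in> P i \<and> b \<in> Q i" "teq ys (map snd ws)"
    by blast
  have "teq xs ((a, y) # map snd ws)"
    using tensor_eq.trans[OF ys(4)] tensor_eq_Cons[OF _ ws(2)] c y by auto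
  then show ?case using ws(1) qm aq ys(1) by (intro exI[of _ "(q, a, y) # ws"]) auto
qed

text \<open>For the two-step filtrations M, 0 and 0, N the annihilators in
  \<open>filtered_tensor\<close> are the full duals, and each term that it returns has a zero
  entry.\<close>

lemma tensor_eq_Nil:
  assumes "set xs \<subseteq> pairs" "\<And>f g. f \<in> dual k M \<Longrightarrow> g \<in> dual k N \<Longrightarrow> pairing k f g xs = \<zero>"
  shows "teq xs []"
proof -
  define P where "P i = (if i = 0 then carrier M else {\<zero>\<^bsub>M\<^esub>})" for i :: nat
  define Q where "Q i = (if i = 0 then {\<zero>\<^bsub>N\<^esub>} else carrier N)" for i :: nat
  have "\<exists>ws. (\<forall>(i, a, b)\<in>set ws. i \<le> Suc 0 \<and> a \<in> P i \<and> b \<in> Q i) \<and> teq xs (map snd ws)"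
    by (rule filtered_tensor)
      (use assms in \<open>auto simp: P_def Q_def M.submodule_zero N.submodule_zero M.submodule_carrier
        N.submodule_carrier annihilator_def\<close>)
  then obtain ws where ws: "\<forall>(i, a, b)\<in>set ws. i \<le> Suc 0 \<and> a \<in> P i \<and> b \<in> Q i" "teq xs (map snd ws)"
    by blast
  have "teq (map snd ws) []"
    using ws(1)
  proof (induction ws)
    case Nil
    show ?case by (auto intro: tensor_eq.refl)
  next
    case (Cons w ws)
    obtain i a b where w: "w = (i, a, b)" by (cases w)
    have c: "a \<in> carrier M" "b \<in> carrier N" "a = \<zero>\<^bsub>M\<^esub> \<or> b = \<zero>\<^bsub>N\<^esub>"
      using Cons.prems w by (auto simp: P_def Q_def split: if_splits)
    have "teq [(a, b)] []"
    proof (cases "a = \<zero>\<^bsub>M\<^esub>")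
      \<comment> \<open>The rule \<open>zero\<close> speaks of a zero on the left. A zero on the
        right is carried over as the scalar 0 by \<open>balanced\<close>.\<close>
      case False
      then have "teq [(a, b)] [(\<zero>\<^bsub>M\<^esub>, \<zero>\<^bsub>N\<^esub>)]"
        using tensor_eq.sym[OF tensor_eq.balanced[of \<zero> k a M "\<zero>\<^bsub>N\<^esub>" N]] c by auto
      then show ?thesis using tensor_eq.trans tensor_eq.zero N.zero_closed by metis
    qed (use c tensor_eq.zero in auto)
    then show ?case using tensor_eq.append[of k M N "[(a, b)]" "[]" "map snd ws" "[]"] Cons w by auto
  qed
  then show ?thesis using ws(2) tensor_eq.trans by blast
qed

text \<open>The congruence on lists has no cancellation rule. The list \<open>ns\<close> of
  negatives takes its place: xs is equivalent to \<open>xs @ ns @ ys\<close>, and this to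
  ys.\<close>

lemma tensor_eqI:
  assumes xs: "set xs \<subseteq> pairs" and ys: "set ys \<subseteq> pairs"
    and eq: "\<And>f g. f \<in> dual k M \<Longrightarrow> g \<in> dual k N \<Longrightarrow> pairing k f g xs = pairing k f g ys"
  shows "teq xs ys"
proof -
  define ns where "ns = map (\<lambda>(a, b). (\<ominus>\<^bsub>M\<^esub> a, b)) ys"
  have ns: "set ns \<subseteq> pairs" using ys by (auto simp: ns_def)
  have neg: "pairing k f g ns = \<ominus> pairing k f g ys" if "f \<in> dual k M" "g \<in> dual k N" for f g
    unfolding ns_def using ys
  proof (induction ys)
    case (Cons y ys)
    then show ?case using that by (cases y) (auto simp: M.R.minus_add M.R.l_minus)
  qed auto
  have 1: "teq (xs @ ns) []"
    by (rule tensor_eq_Nil) (use xs ys ns eq neg in \<open>auto simp: M.R.r_neg\<close>)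
  have 2: "teq (ns @ ys) []"
    by (rule tensor_eq_Nil) (use xs ys ns eq neg in \<open>auto simp: M.R.l_neg\<close>)
  have "teq (xs @ []) (xs @ ns @ ys)"
    using xs tensor_eq.append[OF tensor_eq.refl tensor_eq.sym[OF 2]] by blast
  moreover have "teq ((xs @ ns) @ ys) ([] @ ys)"
    using ys tensor_eq.append[OF 1 tensor_eq.refl] by blast
  ultimately show ?thesis using tensor_eq.trans by (metis append_Nil append_Nil2 append_assoc)
qed

end

definition linear_map ::
    "('k, 'r) ring_scheme \<Rightarrow> ('k, 'a, 'm) module_scheme \<Rightarrow> ('k, 'b, 'n) module_scheme \<Rightarrow> ('a \<Rightarrow> 'b) \<Rightarrow> bool"
  where "linear_map k M N p \<longleftrightarrow>
    (\<forall>x\<in>carrier M. p x \<in> carrier N) \<and>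
    (\<forall>x\<in>carrier M. \<forall>y\<in>carrier M. p (x \<oplus>\<^bsub>M\<^esub> y) = p x \<oplus>\<^bsub>N\<^esub> p y) \<and>
    (\<forall>r\<in>carrier k. \<forall>x\<in>carrier M. p (r \<odot>\<^bsub>M\<^esub> x) = r \<odot>\<^bsub>N\<^esub> p x)"

lemma linear_mapI:
  assumes "\<And>x. x \<in> carrier M \<Longrightarrow> p x \<in> carrier N"
    and "\<And>x y. \<lbrakk>x \<in> carrier M; y \<in> carrier M\<rbrakk> \<Longrightarrow> p (x \<oplus>\<^bsub>M\<^esub> y) = p x \<oplus>\<^bsub>N\<^esub> p y"
    and "\<And>r x. \<lbrakk>r \<in> carrier k; x \<in> carrier M\<rbrakk> \<Longrightarrow> p (r \<odot>\<^bsub>M\<^esub> x) = r \<odot>\<^bsub>N\<^esub> p x"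
  shows "linear_map k M N p"
  using assms by (auto simp: linear_map_def)

lemma linear_mapD:
  assumes "linear_map k M N p"
  shows "\<And>x. x \<in> carrier M \<Longrightarrow> p x \<in> carrier N"
    and "\<And>x y. \<lbrakk>x \<in> carrier M; y \<in> carrier M\<rbrakk> \<Longrightarrow> p (x \<oplus>\<^bsub>M\<^esub> y) = p x \<oplus>\<^bsub>N\<^esub> p y"
    and "\<And>r x. \<lbrakk>r \<in> carrier k; x \<in> carrier M\<rbrakk> \<Longrightarrow> p (r \<odot>\<^bsub>M\<^esub> x) = r \<odot>\<^bsub>N\<^esub> p x"
  using assms unfolding linear_map_def by blast+

lemma dual_comp:
  assumes "linear_map k M N p" "f \<in> dual k N"
  shows "(\<lambda>x. f (p x)) \<in> dual k M"
  using assms by (auto simp: linear_map_def dual_def)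

section \<open>The vector space of tensors\<close>

context linear_space_pair
begin

abbreviation "TS \<equiv> tensor_sum k M N"

lemma tensor_sum_eq: "teq xs ys \<Longrightarrow> TS xs = TS ys"
  unfolding tensor_sum_def using tensor_eq.sym tensor_eq.trans by blast

lemma tensor_sum_eqD: "set xs \<subseteq> pairs \<Longrightarrow> TS xs = TS ys \<Longrightarrow> teq xs ys"
  using tensor_eq.refl tensor_eq.sym unfolding tensor_sum_def by blast

lemma tensor_sum_eqI:
  assumes "set xs \<subseteq> pairs" "set ys \<subseteq> pairs"
    "\<And>f g. f \<in> dual k M \<Longrightarrow> g \<in> dual k N \<Longrightarrow> pairing k f g xs = pairing k f g ys"
  shows "TS xs = TS ys"
  using tensor_sum_eq tensor_eqI assms by blast

text \<open>The class contains xs, which leaves a single candidate for the definite description, and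
  bilinearity makes all other members agree with it.\<close>

lemma tensor_lift_eq:
  assumes "abelian_monoid W" "bilinear_map k M N W \<beta>" "set xs \<subseteq> pairs"
  shows "tensor_lift W \<beta> (TS xs) = lsum W \<beta> xs"
  unfolding tensor_lift_def
proof (rule the_equality)
  have eq: "lsum W \<beta> xs = lsum W \<beta> ys" if "teq xs ys" for ys
    by (rule tensor_eq_lsum[OF assms(1,2) that])
  show "\<forall>ys\<in>TS xs. lsum W \<beta> xs = foldr (\<lambda>(a, b) v. \<beta> a b \<oplus>\<^bsub>W\<^esub> v) ys \<zero>\<^bsub>W\<^esub>"
    using eq by (auto simp: tensor_sum_def lsum_def)
  show "w = lsum W \<beta> xs" if "\<forall>ys\<in>TS xs. w = foldr (\<lambda>(a, b) v. \<beta> a b \<oplus>\<^bsub>W\<^esub> v) ys \<zero>\<^bsub>W\<^esub>" for w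
    using that tensor_eq.refl[OF assms(3)] by (auto simp: tensor_sum_def lsum_def)
qed

lemma tensor_pairing_sum [simp]:
  "f \<in> dual k M \<Longrightarrow> g \<in> dual k N \<Longrightarrow> set xs \<subseteq> pairs
    \<Longrightarrow> tensor_pairing k f g (TS xs) = pairing k f g xs"
  unfolding tensor_pairing_def pairing_def
  by (rule tensor_lift_eq[OF M.R.abelian_monoid_axioms bilinear_pairing])

lemma tensor_sum_closed [simp]: "set xs \<subseteq> pairs \<Longrightarrow> TS xs \<in> carrier T"
  by (auto simp: tensor_space_def tensor_subspace_def)

lemma tensorE:
  assumes "s \<in> carrier T"
  obtains xs where "set xs \<subseteq> pairs" "s = TS xs"
  using assms by (auto simp: tensor_space_def tensor_subspace_def)

lemma tensor_zero: "\<zero>\<^bsub>T\<^esub> = TS []"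
  by (simp add: tensor_space_def)

text \<open>The union over representatives collapses: all classes in it are equal, and there is at
  least one because a class contains its own list.\<close>

lemma tensor_add:
  assumes "set xs \<subseteq> pairs" "set ys \<subseteq> pairs"
  shows "TS xs \<oplus>\<^bsub>T\<^esub> TS ys = TS (xs @ ys)"
proof -
  have "TS (xs' @ ys') = TS (xs @ ys)" if "xs' \<in> TS xs" "ys' \<in> TS ys" for xs' ys'
    using that by (intro tensor_sum_eq tensor_eq.sym[OF tensor_eq.append]) (auto simp: tensor_sum_def)
  then have "(\<Union>xs'\<in>TS xs. \<Union>ys'\<in>TS ys. TS (xs' @ ys')) = (\<Union>xs'\<in>TS xs. \<Union>ys'\<in>TS ys. TS (xs @ ys))"
    by (simp cong: SUP_cong)
  moreover have "xs \<in> TS xs" "ys \<in> TS ys"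
    using assms tensor_eq.refl by (auto simp: tensor_sum_def)
  ultimately show ?thesis by (simp add: tensor_space_def) blast
qed

lemma pairing_smult:
  assumes "f \<in> dual k M" "g \<in> dual k N" "r \<in> carrier k" "set xs \<subseteq> pairs"
  shows "pairing k f g (map (\<lambda>(a, b). (r \<odot>\<^bsub>M\<^esub> a, b)) xs) = r \<otimes> pairing k f g xs"
  using assms(4)
proof (induction xs)
  case (Cons x xs)
  then show ?case using assms(1-3) by (cases x) (auto simp: M.R.r_distr M.R.m_assoc)
qed (use assms in auto)

lemma tensor_smult:
  assumes "set xs \<subseteq> pairs" "r \<in> carrier k"
  shows "r \<odot>\<^bsub>T\<^esub> TS xs = TS (map (\<lambda>(a, b). (r \<odot>\<^bsub>M\<^esub> a, b)) xs)"
proof -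
  have "TS (map (\<lambda>(a, b). (r \<odot>\<^bsub>M\<^esub> a, b)) xs') = TS (map (\<lambda>(a, b). (r \<odot>\<^bsub>M\<^esub> a, b)) xs)"
    if "xs' \<in> TS xs" for xs'
  proof (rule tensor_sum_eqI)
    have t: "teq xs xs'" using that by (simp add: tensor_sum_def)
    note c = tensor_eq_pairs[OF t]
    show "set (map (\<lambda>(a, b). (r \<odot>\<^bsub>M\<^esub> a, b)) xs') \<subseteq> pairs" "set (map (\<lambda>(a, b). (r \<odot>\<^bsub>M\<^esub> a, b)) xs) \<subseteq> pairs"
      using c assms(2) by auto
    show "pairing k f g (map (\<lambda>(a, b). (r \<odot>\<^bsub>M\<^esub> a, b)) xs') = pairing k f g (map (\<lambda>(a, b). (r \<odot>\<^bsub>M\<^esub> a, b)) xs)"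
      if "f \<in> dual k M" "g \<in> dual k N" for f g
      using tensor_eq_pairing[OF t that] pairing_smult that c assms(2) by simp
  qed
  then have "(\<Union>xs'\<in>TS xs. TS (map (\<lambda>(a, b). (r \<odot>\<^bsub>M\<^esub> a, b)) xs')) =
      (\<Union>xs'\<in>TS xs. TS (map (\<lambda>(a, b). (r \<odot>\<^bsub>M\<^esub> a, b)) xs))"
    by (simp cong: SUP_cong)
  moreover have "xs \<in> TS xs" using assms tensor_eq.refl by (auto simp: tensor_sum_def)
  ultimately show ?thesis by (simp add: tensor_space_def) blast
qed

lemma smult_pairs: "r \<in> carrier k \<Longrightarrow> set xs \<subseteq> pairs \<Longrightarrow> set (map (\<lambda>(a, b). (r \<odot>\<^bsub>M\<^esub> a, b)) xs) \<subseteq> pairs"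
  by auto

text \<open>Axioms that merely concatenate follow from identities of lists. Commutativity and the
  axioms in which scalars change the entries are checked on pairings. The negative of a class
  multiplies the left entries by -1.\<close>

lemma tensor_module: "module k T"
proof (rule moduleI)
  show "cring k" by (rule M.R.is_cring)
  show "abelian_group T"
  proof (rule abelian_groupI)
    fix x assume "x \<in> carrier T"
    then obtain xs where xs: "set xs \<subseteq> pairs" "x = TS xs" by (rule tensorE)
    show "\<zero>\<^bsub>T\<^esub> \<oplus>\<^bsub>T\<^esub> x = x" using xs by (simp add: tensor_zero tensor_add)
    have m: "\<ominus> \<one> \<in> carrier k" by simp
    show "\<exists>y\<in>carrier T. y \<oplus>\<^bsub>T\<^esub> x = \<zero>\<^bsub>T\<^esub>"
    proof (rule bexI[of _ "TS (map (\<lambda>(a, b). (\<ominus> \<one> \<odot>\<^bsub>M\<^esub> a, b)) xs)"])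
      show "TS (map (\<lambda>(a, b). (\<ominus> \<one> \<odot>\<^bsub>M\<^esub> a, b)) xs) \<oplus>\<^bsub>T\<^esub> x = \<zero>\<^bsub>T\<^esub>"
        unfolding xs(2) tensor_add[OF smult_pairs[OF m xs(1)] xs(1)] tensor_zero
        using smult_pairs[OF m xs(1)] xs(1) m
        by (intro tensor_sum_eqI) (auto simp: pairing_smult M.R.l_minus M.R.l_neg)
    qed (use smult_pairs[OF m xs(1)] in simp)
    fix y assume "y \<in> carrier T"
    then obtain ys where ys: "set ys \<subseteq> pairs" "y = TS ys" by (rule tensorE)
    show "x \<oplus>\<^bsub>T\<^esub> y \<in> carrier T" using xs ys by (simp add: tensor_add)
    show "x \<oplus>\<^bsub>T\<^esub> y = y \<oplus>\<^bsub>T\<^esub> x"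
      unfolding xs ys using xs(1) ys(1)
      by (simp add: tensor_add) (rule tensor_sum_eqI, auto simp: M.R.a_comm)
    fix z assume "z \<in> carrier T"
    then obtain zs where zs: "set zs \<subseteq> pairs" "z = TS zs" by (rule tensorE)
    show "x \<oplus>\<^bsub>T\<^esub> y \<oplus>\<^bsub>T\<^esub> z = x \<oplus>\<^bsub>T\<^esub> (y \<oplus>\<^bsub>T\<^esub> z)" using xs ys zs by (simp add: tensor_add)
  qed (simp add: tensor_zero)
next
  fix r x assume r: "r \<in> carrier k" and "x \<in> carrier T"
  then obtain xs where xs: "set xs \<subseteq> pairs" "x = TS xs" by (auto elim: tensorE)
  have rx: "set (map (\<lambda>(a, b). (r \<odot>\<^bsub>M\<^esub> a, b)) xs) \<subseteq> pairs" using r xs(1) by (rule smult_pairs)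
  show "r \<odot>\<^bsub>T\<^esub> x \<in> carrier T" using r xs rx by (simp add: tensor_smult)
  {
    fix s assume s: "s \<in> carrier k"
    have sx: "set (map (\<lambda>(a, b). (s \<odot>\<^bsub>M\<^esub> a, b)) xs) \<subseteq> pairs" using s xs(1) by (rule smult_pairs)
    have rs: "r \<oplus> s \<in> carrier k" using r s by simp
    show "(r \<oplus> s) \<odot>\<^bsub>T\<^esub> x = r \<odot>\<^bsub>T\<^esub> x \<oplus>\<^bsub>T\<^esub> s \<odot>\<^bsub>T\<^esub> x"
      unfolding xs(2) tensor_smult[OF xs(1) r] tensor_smult[OF xs(1) s] tensor_smult[OF xs(1) rs]
        tensor_add[OF rx sx]
      using rx sx smult_pairs[OF rs xs(1)] xs(1) r s
      by (intro tensor_sum_eqI) (simp_all add: pairing_smult M.R.l_distr)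
    have rs: "r \<otimes> s \<in> carrier k" using r s by simp
    show "(r \<otimes> s) \<odot>\<^bsub>T\<^esub> x = r \<odot>\<^bsub>T\<^esub> (s \<odot>\<^bsub>T\<^esub> x)"
      unfolding xs(2) tensor_smult[OF xs(1) s] tensor_smult[OF xs(1) rs] tensor_smult[OF sx r]
      using smult_pairs[OF r sx] sx smult_pairs[OF rs xs(1)] xs(1) r s
      by (intro tensor_sum_eqI) (simp_all only: pairing_smult M.R.m_assoc pairing_closed M.R.m_closed)
  }
  fix y assume "y \<in> carrier T"
  then obtain ys where ys: "set ys \<subseteq> pairs" "y = TS ys" by (rule tensorE)
  have ry: "set (map (\<lambda>(a, b). (r \<odot>\<^bsub>M\<^esub> a, b)) ys) \<subseteq> pairs" using r ys(1) by (rule smult_pairs)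
  show "r \<odot>\<^bsub>T\<^esub> (x \<oplus>\<^bsub>T\<^esub> y) = r \<odot>\<^bsub>T\<^esub> x \<oplus>\<^bsub>T\<^esub> r \<odot>\<^bsub>T\<^esub> y"
    unfolding xs(2) ys(2) using xs(1) ys(1) r rx ry by (simp add: tensor_add tensor_smult)
next
  fix x assume "x \<in> carrier T"
  then obtain xs where xs: "set xs \<subseteq> pairs" "x = TS xs" by (rule tensorE)
  show "\<one> \<odot>\<^bsub>T\<^esub> x = x"
    unfolding xs(2) tensor_smult[OF xs(1) M.R.one_closed]
    using xs(1) smult_pairs[OF M.R.one_closed xs(1)] by (intro tensor_sum_eqI) (simp_all add: pairing_smult)
qed

sublocale T: linear_space k T
  by (intro linear_space.intro tensor_module M.field_axioms)

lemma tensor_pairing_dual [simp]: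
  assumes fg: "f \<in> dual k M" "g \<in> dual k N"
  shows "tensor_pairing k f g \<in> dual k T"
proof (rule dualI)
  fix x assume "x \<in> carrier T"
  then obtain xs where xs: "set xs \<subseteq> pairs" "x = TS xs" by (rule tensorE)
  show "tensor_pairing k f g x \<in> carrier k" using xs fg by simp
  show "tensor_pairing k f g (r \<odot>\<^bsub>T\<^esub> x) = r \<otimes> tensor_pairing k f g x" if r: "r \<in> carrier k" for r
    unfolding xs(2) tensor_smult[OF xs(1) r] using fg xs(1) r smult_pairs[OF r xs(1)]
    by (simp only: tensor_pairing_sum pairing_smult)
  fix y assume "y \<in> carrier T"
  then obtain ys where ys: "set ys \<subseteq> pairs" "y = TS ys" by (rule tensorE)
  show "tensor_pairing k f g (x \<oplus>\<^bsub>T\<^esub> y) = tensor_pairing k f g x \<oplus> tensor_pairing k f g y"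
    unfolding xs(2) ys(2) using fg xs(1) ys(1) by (simp add: tensor_add)
qed

lemma tensor_ext:
  assumes "s \<in> carrier T" "t \<in> carrier T"
    and "\<And>f g. f \<in> dual k M \<Longrightarrow> g \<in> dual k N \<Longrightarrow> tensor_pairing k f g s = tensor_pairing k f g t"
  shows "s = t"
proof -
  obtain xs ys where "set xs \<subseteq> pairs" "s = TS xs" "set ys \<subseteq> pairs" "t = TS ys"
    using assms(1,2) by (metis tensorE)
  then show ?thesis using tensor_sum_eqI[of xs ys] assms(3) by simp
qed

lemma pure_closed [simp]: "a \<in> carrier M \<Longrightarrow> b \<in> carrier N \<Longrightarrow> pure_tensor k M N a b \<in> carrier T"
  by (simp add: pure_tensor_def)

lemma tensor_pairing_pure [simp]:
  assumes "f \<in> dual k M" "g \<in> dual k N" "a \<in> carrier M" "b \<in> carrier N"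
  shows "tensor_pairing k f g (pure_tensor k M N a b) = f a \<otimes> g b"
  using assms by (simp add: pure_tensor_def)

lemma pure_tensor_linear_left:
  assumes "b \<in> carrier N"
  shows "linear_map k M T (\<lambda>a. pure_tensor k M N a b)"
  by (rule linear_mapI; (rule tensor_ext)?)
    (use assms in \<open>auto simp: T.dual_add[OF tensor_pairing_dual] T.dual_smult[OF tensor_pairing_dual]
       M.R.l_distr M.R.m_assoc\<close>)

lemma pure_tensor_linear_right:
  assumes "a \<in> carrier M"
  shows "linear_map k N T (pure_tensor k M N a)"
  by (rule linear_mapI; (rule tensor_ext)?)
    (use assms in \<open>auto simp: T.dual_add[OF tensor_pairing_dual] T.dual_smult[OF tensor_pairing_dual]
       M.R.r_distr M.R.m_lcomm\<close>)

lemma bilinear_mapI_linear: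
  assumes W: "linear_space k W"
    and "\<And>b. b \<in> carrier N \<Longrightarrow> linear_map k M W (\<lambda>a. \<beta> a b)"
    and "\<And>a. a \<in> carrier M \<Longrightarrow> linear_map k N W (\<beta> a)"
  shows "bilinear_map k M N W \<beta>"
proof -
  interpret W: linear_space k W by fact
  note l = linear_mapD[OF assms(2)] and r = linear_mapD[OF assms(3)]
  show ?thesis
  proof (rule bilinear_mapI)
    fix b assume b: "b \<in> carrier N"
    have "\<beta> (\<zero> \<odot>\<^bsub>M\<^esub> \<zero>\<^bsub>M\<^esub>) b = \<zero> \<odot>\<^bsub>W\<^esub> \<beta> \<zero>\<^bsub>M\<^esub> b" using b l by blast
    then show "\<beta> \<zero>\<^bsub>M\<^esub> b = \<zero>\<^bsub>W\<^esub>" using b l(1) by simp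
  qed (use l r in auto)
qed

text \<open>The product and the bracket on A \<otimes> A are nested lifts. The inner lift is a
  finite sum of maps bilinear in the outer variables, hence itself bilinear in them, so both lifts
  may be evaluated on lists.\<close>

lemma tensor_lift2:
  assumes W: "abelian_monoid W"
    and r: "\<And>a b. a \<in> carrier M \<Longrightarrow> b \<in> carrier N \<Longrightarrow> bilinear_map k M N W (\<beta> a b)"
    and l: "\<And>c d. c \<in> carrier M \<Longrightarrow> d \<in> carrier N \<Longrightarrow> bilinear_map k M N W (\<lambda>a b. \<beta> a b c d)"
    and xs: "set xs \<subseteq> pairs" and ys: "set ys \<subseteq> pairs"
  shows "tensor_lift W (\<lambda>a b. tensor_lift W (\<beta> a b) (TS ys)) (TS xs) =
    lsum W (\<lambda>a b. lsum W (\<beta> a b) ys) xs"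
proof -
  interpret W: abelian_monoid W by fact
  note [simp] = bilinear_mapD[OF l]
  have eq: "tensor_lift W (\<beta> a b) (TS ys) = lsum W (\<beta> a b) ys"
    if "a \<in> carrier M" "b \<in> carrier N" for a b
    by (rule tensor_lift_eq[OF W r[OF that] ys])
  have "bilinear_map k M N W (\<lambda>a b. tensor_lift W (\<beta> a b) (TS ys))"
    by (rule bilinear_mapI)
      (use ys in \<open>auto simp: eq W.lsum_add[symmetric] subset_iff
        intro!: W.lsum_closed W.lsum_zero lsum_cong\<close>)
  then show ?thesis
    using tensor_lift_eq[OF W _ xs] xs by (auto simp: eq subset_iff intro!: lsum_cong)
qed

end

section \<open>Maps between tensor products and the associator\<close>

lemma (in linear_space) dual_lsum:
  assumes "f \<in> dual k V" "\<And>a b. (a, b) \<in> set xs \<Longrightarrow> \<beta> a b \<in> carrier V"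
  shows "f (lsum V \<beta> xs) = lsum k (\<lambda>a b. f (\<beta> a b)) xs"
  by (rule lsum_hom[OF M.abelian_monoid_axioms]) (use assms in auto)

lemma tensor_map_sum:
  assumes MN: "linear_space_pair k M N" and MN': "linear_space_pair k M' N'"
    and p: "linear_map k M M' p" and q: "linear_map k N N' q"
    and xs: "set xs \<subseteq> carrier M \<times> carrier N"
  shows "tensor_map k M' N' p q (tensor_sum k M N xs) =
    tensor_sum k M' N' (map (\<lambda>(a, b). (p a, q b)) xs)"
proof -
  interpret A: linear_space_pair k M N by fact
  interpret B: linear_space_pair k M' N' by fact
  note [simp] = linear_mapD[OF p] linear_mapD[OF q]
  note [simp] = linear_mapD[OF B.pure_tensor_linear_left] linear_mapD[OF B.pure_tensor_linear_right]
  have "bilinear_map k M N B.T (\<lambda>a b. pure_tensor k M' N' (p a) (q b))"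
    by (rule A.bilinear_mapI_linear[OF B.T.linear_space_axioms]; rule linear_mapI) simp_all
  then have "tensor_map k M' N' p q (tensor_sum k M N xs) =
      lsum B.T (\<lambda>a b. pure_tensor k M' N' (p a) (q b)) xs"
    unfolding tensor_map_def
    by (rule A.tensor_lift_eq[OF B.T.M.abelian_monoid_axioms _ xs])
  also have "\<dots> = tensor_sum k M' N' (map (\<lambda>(a, b). (p a, q b)) xs)"
    using xs
  proof (induction xs)
    case (Cons x xs)
    then have "set (map (\<lambda>(a, b). (p a, q b)) xs) \<subseteq> B.pairs" by auto
    then show ?case using Cons by (cases x) (simp add: pure_tensor_def B.tensor_add)
  qed (simp add: B.tensor_zero)
  finally show ?thesis .
qed

text \<open>Moving f \<otimes> (g \<otimes> h) through the associator gives (f \<otimes> g)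
  \<otimes> h. This is what turns coassociativity into associativity of convolution. The main work
  is the bilinearity of the outer lift, which is again tested on functionals.\<close>

lemma tensor_pairing_assoc:
  assumes LM: "linear_space_pair k L M" and MN: "linear_space_pair k M N"
    and fgh: "f \<in> dual k L" "g \<in> dual k M" "h \<in> dual k N"
    and us: "set us \<subseteq> carrier (tensor_space k L M) \<times> carrier N"
  shows "tensor_pairing k f (tensor_pairing k g h)
      (tensor_assoc k L M N (tensor_sum k (tensor_space k L M) N us)) =
    lsum k (\<lambda>s c. tensor_pairing k f g s \<otimes>\<^bsub>k\<^esub> h c) us"
proof -
  interpret LM: linear_space_pair k L M by fact
  interpret MN: linear_space_pair k M N by fact
  interpret LMN: linear_space_pair k L MN.T ..
  interpret LMN': linear_space_pair k LM.T N ..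
  let ?W = "LMN.T"
  define \<gamma> where "\<gamma> c a b = pure_tensor k L MN.T a (pure_tensor k M N b c)" for c a b
  note [simp] = linear_mapD[OF MN.pure_tensor_linear_left] linear_mapD[OF MN.pure_tensor_linear_right]
    linear_mapD[OF LMN.pure_tensor_linear_left] linear_mapD[OF LMN.pure_tensor_linear_right]
  have bil: "bilinear_map k L M ?W (\<gamma> c)" if "c \<in> carrier N" for c
    unfolding \<gamma>_def by (rule LM.bilinear_mapI_linear[OF LMN.T.linear_space_axioms]; rule linear_mapI)
      (simp_all add: that)
  have lift: "tensor_lift ?W (\<gamma> c) (LM.TS xs) = lsum ?W (\<gamma> c) xs"
    if "c \<in> carrier N" "set xs \<subseteq> LM.pairs" for c xs
    by (rule LM.tensor_lift_eq[OF LMN.T.M.abelian_monoid_axioms bil[OF that(1)] that(2)])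
  have \<gamma>_closed: "\<gamma> c a b \<in> carrier ?W" if "c \<in> carrier N" "a \<in> carrier L" "b \<in> carrier M" for a b c
    using bilinear_mapD(1)[OF bil] that by blast
  have clos: "tensor_lift ?W (\<gamma> c) s \<in> carrier ?W" if c: "c \<in> carrier N" and s: "s \<in> carrier LM.T" for c s
  proof -
    obtain xs where xs: "set xs \<subseteq> LM.pairs" "s = LM.TS xs" using s by (rule LM.tensorE)
    show ?thesis
      unfolding xs(2) lift[OF c xs(1)]
      by (rule LMN.T.M.lsum_closed) (use xs c \<gamma>_closed in auto)
  qed
  \<comment> \<open>Here H is any functional on M \<otimes> N and not just a pairing of two
    functionals, because \<open>tensor_ext\<close> for L \<otimes> (M \<otimes> N) tests against all
    of them.\<close>
  have pair: "tensor_pairing k f' H (tensor_lift ?W (\<gamma> c) s) =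
      tensor_pairing k f' (\<lambda>b. H (pure_tensor k M N b c)) s"
    if f': "f' \<in> dual k L" and H: "H \<in> dual k MN.T" and c: "c \<in> carrier N" and s: "s \<in> carrier LM.T"
    for f' H c s
  proof -
    obtain xs where xs: "set xs \<subseteq> LM.pairs" "s = LM.TS xs" using s by (rule LM.tensorE)
    have "(\<lambda>b. H (pure_tensor k M N b c)) \<in> dual k M"
      by (rule dual_comp[OF MN.pure_tensor_linear_left[OF c] H])
    then have "tensor_pairing k f' (\<lambda>b. H (pure_tensor k M N b c)) s =
        lsum k (\<lambda>a b. f' a \<otimes>\<^bsub>k\<^esub> H (pure_tensor k M N b c)) xs"
      using f' xs by (simp add: pairing_def)
    moreover have "tensor_pairing k f' H (tensor_lift ?W (\<gamma> c) s) =
        lsum k (\<lambda>a b. tensor_pairing k f' H (\<gamma> c a b)) xs"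
      unfolding xs(2) lift[OF c xs(1)]
      by (rule LMN.T.dual_lsum[OF LMN.tensor_pairing_dual[OF f' H]]) (use xs(1) c \<gamma>_closed in auto)
    moreover have "\<dots> = lsum k (\<lambda>a b. f' a \<otimes>\<^bsub>k\<^esub> H (pure_tensor k M N b c)) xs"
      by (rule lsum_cong) (use xs(1) f' H c in \<open>auto simp: \<gamma>_def\<close>)
    ultimately show ?thesis by simp
  qed
  have Hlin: "H (r \<odot>\<^bsub>MN.T\<^esub> x) = r \<otimes>\<^bsub>k\<^esub> H x" "H (x \<oplus>\<^bsub>MN.T\<^esub> y) = H x \<oplus>\<^bsub>k\<^esub> H y"
    if "H \<in> dual k MN.T" "x \<in> carrier MN.T" "y \<in> carrier MN.T" "r \<in> carrier k" for H x y r
    using that by simp_all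
  have bil2: "bilinear_map k LM.T N ?W (\<lambda>s c. tensor_lift ?W (\<gamma> c) s)"
  proof (rule LMN'.bilinear_mapI_linear[OF LMN.T.linear_space_axioms]; rule linear_mapI)
    fix c s assume c: "c \<in> carrier N" and s: "s \<in> carrier LM.T"
    then obtain xs where xs: "set xs \<subseteq> LM.pairs" "s = LM.TS xs" by (auto elim: LM.tensorE)
    show "tensor_lift ?W (\<gamma> c) s \<in> carrier ?W" "tensor_lift ?W (\<gamma> c) s \<in> carrier ?W"
      using clos c s by blast+
    {
      fix t assume t: "t \<in> carrier LM.T"
      show "tensor_lift ?W (\<gamma> c) (s \<oplus>\<^bsub>LM.T\<^esub> t) = tensor_lift ?W (\<gamma> c) s \<oplus>\<^bsub>?W\<^esub> tensor_lift ?W (\<gamma> c) t"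
      proof (rule LMN.tensor_ext)
        fix f' H assume fH: "f' \<in> dual k L" "H \<in> dual k MN.T"
        then have d: "(\<lambda>b. H (pure_tensor k M N b c)) \<in> dual k M"
          by (intro dual_comp[OF MN.pure_tensor_linear_left[OF c]])
        show "tensor_pairing k f' H (tensor_lift ?W (\<gamma> c) (s \<oplus>\<^bsub>LM.T\<^esub> t)) =
            tensor_pairing k f' H (tensor_lift ?W (\<gamma> c) s \<oplus>\<^bsub>?W\<^esub> tensor_lift ?W (\<gamma> c) t)"
          using LMN.T.dual_add[OF LMN.tensor_pairing_dual[OF fH]]
            LM.T.dual_add[OF LM.tensor_pairing_dual[OF fH(1) d]] s t c fH by (simp add: pair clos)
      qed (use clos s t c in auto)
    }
    {
      fix r assume r: "r \<in> carrier k"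
      show "tensor_lift ?W (\<gamma> c) (r \<odot>\<^bsub>LM.T\<^esub> s) = r \<odot>\<^bsub>?W\<^esub> tensor_lift ?W (\<gamma> c) s"
      proof (rule LMN.tensor_ext)
        fix f' H assume fH: "f' \<in> dual k L" "H \<in> dual k MN.T"
        then have d: "(\<lambda>b. H (pure_tensor k M N b c)) \<in> dual k M"
          by (intro dual_comp[OF MN.pure_tensor_linear_left[OF c]])
        show "tensor_pairing k f' H (tensor_lift ?W (\<gamma> c) (r \<odot>\<^bsub>LM.T\<^esub> s)) =
            tensor_pairing k f' H (r \<odot>\<^bsub>?W\<^esub> tensor_lift ?W (\<gamma> c) s)"
          using LMN.T.dual_smult[OF LMN.tensor_pairing_dual[OF fH]]
            LM.T.dual_smult[OF LM.tensor_pairing_dual[OF fH(1) d]] s r c fH by (simp add: pair clos)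
      qed (use clos s r c in auto)
      show "tensor_lift ?W (\<gamma> (r \<odot>\<^bsub>N\<^esub> c)) s = r \<odot>\<^bsub>?W\<^esub> tensor_lift ?W (\<gamma> c) s"
      proof -
        have "r \<odot>\<^bsub>?W\<^esub> lsum ?W (\<gamma> c) xs = lsum ?W (\<lambda>a b. r \<odot>\<^bsub>?W\<^esub> \<gamma> c a b) xs"
          by (rule lsum_hom[OF LMN.T.M.abelian_monoid_axioms])
            (use r c xs(1) \<gamma>_closed in \<open>auto simp: LMN.T.smult_r_distr\<close>)
        also have "\<dots> = lsum ?W (\<gamma> (r \<odot>\<^bsub>N\<^esub> c)) xs"
          by (rule lsum_cong) (use r c xs(1) in \<open>auto simp: \<gamma>_def\<close>)
        finally show ?thesis unfolding xs(2) using r c xs(1) by (simp add: lift)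
      qed
    }
    fix d assume d: "d \<in> carrier N"
    show "tensor_lift ?W (\<gamma> (c \<oplus>\<^bsub>N\<^esub> d)) s = tensor_lift ?W (\<gamma> c) s \<oplus>\<^bsub>?W\<^esub> tensor_lift ?W (\<gamma> d) s"
    proof -
      have "lsum ?W (\<gamma> c) xs \<oplus>\<^bsub>?W\<^esub> lsum ?W (\<gamma> d) xs = lsum ?W (\<lambda>a b. \<gamma> c a b \<oplus>\<^bsub>?W\<^esub> \<gamma> d a b) xs"
        by (rule LMN.T.M.lsum_add[symmetric]) (use c d xs(1) \<gamma>_closed in auto)
      also have "\<dots> = lsum ?W (\<gamma> (c \<oplus>\<^bsub>N\<^esub> d)) xs"
        by (rule lsum_cong) (use d c xs(1) in \<open>auto simp: \<gamma>_def\<close>)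
      finally show ?thesis unfolding xs(2) using d c xs(1) by (simp add: lift)
    qed
  qed
  have "tensor_assoc k L M N (tensor_sum k LM.T N us) = lsum ?W (\<lambda>s c. tensor_lift ?W (\<gamma> c) s) us"
    unfolding tensor_assoc_def Let_def \<gamma>_def[symmetric]
    by (rule LMN'.tensor_lift_eq[OF LMN.T.M.abelian_monoid_axioms bil2 us])
  then have "tensor_pairing k f (tensor_pairing k g h) (tensor_assoc k L M N (tensor_sum k LM.T N us)) =
      lsum k (\<lambda>s c. tensor_pairing k f (tensor_pairing k g h) (tensor_lift ?W (\<gamma> c) s)) us"
    using LMN.T.dual_lsum[of "tensor_pairing k f (tensor_pairing k g h)" us "\<lambda>s c. tensor_lift ?W (\<gamma> c) s"]
      fgh us clos by (auto simp: subset_iff)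
  also have "\<dots> = lsum k (\<lambda>s c. tensor_pairing k f g s \<otimes>\<^bsub>k\<^esub> h c) us"
  proof (rule lsum_cong)
    fix s c assume "(s, c) \<in> set us"
    then have sc: "s \<in> carrier LM.T" "c \<in> carrier N" using us by auto
    then obtain xs where xs: "set xs \<subseteq> LM.pairs" "s = LM.TS xs" by (auto elim: LM.tensorE)
    show "tensor_pairing k f (tensor_pairing k g h) (tensor_lift ?W (\<gamma> c) s) = tensor_pairing k f g s \<otimes>\<^bsub>k\<^esub> h c"
    proof -
      have d: "(\<lambda>b. tensor_pairing k g h (pure_tensor k M N b c)) \<in> dual k M"
        using fgh sc by (intro dual_comp[OF MN.pure_tensor_linear_left]) auto
      have "pairing k f (\<lambda>b. tensor_pairing k g h (pure_tensor k M N b c)) xs =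
          lsum k (\<lambda>a b. f a \<otimes>\<^bsub>k\<^esub> g b \<otimes>\<^bsub>k\<^esub> h c) xs"
        unfolding pairing_def
        by (rule lsum_cong) (use fgh sc xs(1) in \<open>auto simp: LM.M.R.m_assoc\<close>)
      also have "\<dots> = pairing k f g xs \<otimes>\<^bsub>k\<^esub> h c"
        unfolding pairing_def
        by (rule lsum_hom[OF LM.M.R.abelian_monoid_axioms, symmetric])
          (use fgh sc xs(1) in \<open>auto simp: LM.M.R.l_distr\<close>)
      finally show ?thesis using fgh sc xs d by (simp add: pair)
    qed
  qed
  finally show ?thesis .
qed

section \<open>Convolution and the coradical filtration\<close>

definition conv ::
    "('k, 'r) ring_scheme \<Rightarrow> ('k, 'a, 'm) poisson_hopf_scheme \<Rightarrow> ('a \<Rightarrow> 'k) \<Rightarrow> ('a \<Rightarrow> 'k) \<Rightarrow> 'a \<Rightarrow> 'k"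
  where "conv k A f g x = tensor_pairing k f g (comult A x)"

lemma (in linear_space) submodule_kernel:
  assumes "F \<subseteq> dual k V"
  shows "submodule {x \<in> carrier V. \<forall>f\<in>F. f x = \<zero>} k V"
  by (rule submoduleI) (use assms in \<open>auto simp: subset_iff\<close>)

lemma (in linear_space) submodule_linear_span:
  assumes "X \<subseteq> carrier V"
  shows "submodule (linear_span k V X) k V"
proof -
  have S: "carrier V \<in> {H. submodule H k V \<and> X \<subseteq> H}" using assms submodule_carrier by auto
  show ?thesis
    unfolding linear_span_def
  proof (rule submoduleI)
    show "\<Inter> {H. submodule H k V \<and> X \<subseteq> H} \<subseteq> carrier V" using S by (rule Inter_lower)
  qed (use submodule_zero_mem submoduleE(3-5) in auto)
qed

lemma linear_span_subset: "X \<subseteq> linear_span k V X"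
  by (auto simp: linear_span_def)

lemma linear_span_minimal: "submodule H k V \<Longrightarrow> X \<subseteq> H \<Longrightarrow> linear_span k V X \<subseteq> H"
  by (auto simp: linear_span_def)

sublocale coalgebra \<subseteq> linear_space k A
  by unfold_locales

sublocale coalgebra \<subseteq> AA: linear_space_pair k A A
  by unfold_locales

context coalgebra
begin

abbreviation "filt \<equiv> coradical_filt k A"

lemma comult_linear: "linear_map k A AA.T (comult A)"
  by (rule linear_mapI) (simp_all add: comult_closed comult_add comult_smult)

lemma comultE:
  assumes "x \<in> carrier A"
  obtains xs where "set xs \<subseteq> AA.pairs" "comult A x = AA.TS xs"
  using AA.tensorE[OF comult_closed[OF assms]] by blast

lemma conv_sum:
  "f \<in> dual k A \<Longrightarrow> g \<in> dual k A \<Longrightarrow> set xs \<subseteq> AA.pairs \<Longrightarrow> comult A x = AA.TS xs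
    \<Longrightarrow> conv k A f g x = pairing k f g xs"
  by (simp add: conv_def)

lemma conv_dual [simp]: "f \<in> dual k A \<Longrightarrow> g \<in> dual k A \<Longrightarrow> conv k A f g \<in> dual k A"
  using dual_comp[OF comult_linear AA.tensor_pairing_dual] by (simp add: conv_def[abs_def])

text \<open>These are the two sides of coassociativity, paired with f \<otimes> (g \<otimes>
  h).\<close>

lemma conv_assoc:
  assumes fgh: "f \<in> dual k A" "g \<in> dual k A" "h \<in> dual k A" and x: "x \<in> carrier A"
  shows "conv k A (conv k A f g) h x = conv k A f (conv k A g h) x"
proof -
  interpret TA: linear_space_pair k AA.T A ..
  interpret AT: linear_space_pair k A AA.T ..
  have id: "linear_map k A A id" by (simp add: linear_map_def)
  obtain xs where xs: "set xs \<subseteq> AA.pairs" "comult A x = AA.TS xs" using x by (rule comultE)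
  have l: "set (map (\<lambda>(a, b). (comult A a, id b)) xs) \<subseteq> TA.pairs"
    and r: "set (map (\<lambda>(a, b). (id a, comult A b)) xs) \<subseteq> AT.pairs"
    using xs(1) comult_closed by auto
  have "tensor_pairing k f (tensor_pairing k g h)
      (tensor_assoc k A A A (tensor_map k AA.T A (comult A) id (comult A x))) =
    lsum k (\<lambda>a b. tensor_pairing k f g (comult A a) \<otimes>\<^bsub>k\<^esub> h b) xs"
    unfolding xs(2) tensor_map_sum[OF AA.linear_space_pair_axioms TA.linear_space_pair_axioms
        comult_linear id xs(1)]
      tensor_pairing_assoc[OF AA.linear_space_pair_axioms AA.linear_space_pair_axioms fgh l] lsum_map
    by simp
  moreover have "tensor_pairing k f (tensor_pairing k g h)
      (tensor_map k A AA.T id (comult A) (comult A x)) =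
    lsum k (\<lambda>a b. f a \<otimes>\<^bsub>k\<^esub> tensor_pairing k g h (comult A b)) xs"
    unfolding xs(2) tensor_map_sum[OF AA.linear_space_pair_axioms AT.linear_space_pair_axioms
        id comult_linear xs(1)]
      AT.tensor_pairing_sum[OF fgh(1) AA.tensor_pairing_dual[OF fgh(2,3)] r] pairing_def lsum_map
    by simp
  moreover have "conv k A (conv k A f g) h x = lsum k (\<lambda>a b. tensor_pairing k f g (comult A a) \<otimes>\<^bsub>k\<^esub> h b) xs"
    unfolding conv_sum[OF conv_dual[OF fgh(1,2)] fgh(3) xs] by (simp add: pairing_def conv_def)
  moreover have "conv k A f (conv k A g h) x = lsum k (\<lambda>a b. f a \<otimes>\<^bsub>k\<^esub> tensor_pairing k g h (comult A b)) xs"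
    unfolding conv_sum[OF fgh(1) conv_dual[OF fgh(2,3)] xs] by (simp add: pairing_def conv_def)
  ultimately show ?thesis using coassoc[OF x] by simp
qed

text \<open>The vector is (id \<otimes> g)\<Delta>(x). With it a statement about f * g at x for all
  f becomes one about a single vector, to which the criterion for membership in the filtration can
  be applied.\<close>

lemma contract_right:
  assumes g: "g \<in> dual k A" and x: "x \<in> carrier A"
  obtains y where "y \<in> carrier A" "\<And>f. f \<in> dual k A \<Longrightarrow> f y = conv k A f g x"
proof -
  obtain xs where xs: "set xs \<subseteq> AA.pairs" "comult A x = AA.TS xs" using x by (rule comultE)
  have c: "(a, b) \<in> set xs \<Longrightarrow> g b \<odot>\<^bsub>A\<^esub> a \<in> carrier A" for a b using xs(1) g by auto
  have "f (lsum A (\<lambda>a b. g b \<odot>\<^bsub>A\<^esub> a) xs) = conv k A f g x" if f: "f \<in> dual k A" for f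
  proof -
    have "f (lsum A (\<lambda>a b. g b \<odot>\<^bsub>A\<^esub> a) xs) = lsum k (\<lambda>a b. f (g b \<odot>\<^bsub>A\<^esub> a)) xs"
      by (rule dual_lsum[OF f c])
    also have "\<dots> = pairing k f g xs"
      unfolding pairing_def by (rule lsum_cong) (use xs(1) f g in \<open>auto simp: R.m_comm\<close>)
    finally show ?thesis using conv_sum[OF f g xs] by simp
  qed
  moreover have "lsum A (\<lambda>a b. g b \<odot>\<^bsub>A\<^esub> a) xs \<in> carrier A" by (rule M.lsum_closed[OF c])
  ultimately show thesis using that by blast
qed

lemma contract_left:
  assumes f: "f \<in> dual k A" and x: "x \<in> carrier A"
  obtains y where "y \<in> carrier A" "\<And>g. g \<in> dual k A \<Longrightarrow> g y = conv k A f g x"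
proof -
  obtain xs where xs: "set xs \<subseteq> AA.pairs" "comult A x = AA.TS xs" using x by (rule comultE)
  have c: "(a, b) \<in> set xs \<Longrightarrow> f a \<odot>\<^bsub>A\<^esub> b \<in> carrier A" for a b using xs(1) f by auto
  have "g (lsum A (\<lambda>a b. f a \<odot>\<^bsub>A\<^esub> b) xs) = conv k A f g x" if g: "g \<in> dual k A" for g
  proof -
    have "g (lsum A (\<lambda>a b. f a \<odot>\<^bsub>A\<^esub> b) xs) = lsum k (\<lambda>a b. g (f a \<odot>\<^bsub>A\<^esub> b)) xs"
      by (rule dual_lsum[OF g c])
    also have "\<dots> = pairing k f g xs"
      unfolding pairing_def by (rule lsum_cong) (use xs(1) f g in auto)
    finally show ?thesis using conv_sum[OF f g xs] by simp
  qed
  moreover have "lsum A (\<lambda>a b. f a \<odot>\<^bsub>A\<^esub> b) xs \<in> carrier A" by (rule M.lsum_closed[OF c])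
  ultimately show thesis using that by blast
qed

section \<open>The coradical filtration in terms of annihilators\<close>

lemma simple_subcoalgebra_subset: "simple_subcoalgebra k A D \<Longrightarrow> D \<subseteq> coradical k A"
  unfolding coradical_def using linear_span_subset[of "\<Union>{D. simple_subcoalgebra k A D}" k A] by blast

lemma submodule_coradical: "submodule (coradical k A) k A"
  unfolding coradical_def
  by (rule submodule_linear_span) (auto simp: simple_subcoalgebra_def subcoalgebra_def dest!: submoduleE(1))

text \<open>Dual form of \<Delta>(A_0) \<subseteq> A_0 \<otimes> A_0. For x in a simple subcoalgebra
  D both entries of each term of \<Delta>(x) can be taken in D, which lies in the coradical. The
  kernel of a functional is a subspace, so the claim extends to the span.\<close>

lemma coradical_coideal:
  assumes "x \<in> coradical k A" and fg: "f \<in> dual k A" "g \<in> dual k A"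
    and ann: "f \<in> annihilator k A (coradical k A) \<or> g \<in> annihilator k A (coradical k A)"
  shows "conv k A f g x = \<zero>\<^bsub>k\<^esub>"
proof -
  have "coradical k A \<subseteq> {x \<in> carrier A. \<forall>f\<in>{conv k A f g}. f x = \<zero>\<^bsub>k\<^esub>}"
    unfolding coradical_def
  proof (rule linear_span_minimal)
    show "submodule {x \<in> carrier A. \<forall>f\<in>{conv k A f g}. f x = \<zero>\<^bsub>k\<^esub>} k A"
      by (rule submodule_kernel) (use fg in auto)
    show "\<Union>{D. simple_subcoalgebra k A D} \<subseteq> {x \<in> carrier A. \<forall>f\<in>{conv k A f g}. f x = \<zero>\<^bsub>k\<^esub>}"
    proof
      fix x assume "x \<in> \<Union>{D. simple_subcoalgebra k A D}"
      then obtain D where D: "simple_subcoalgebra k A D" "x \<in> D" by auto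
      have Dc: "D \<subseteq> carrier A" "comult A x \<in> tensor_subspace k A A D D"
        using D submoduleE(1) by (auto simp: simple_subcoalgebra_def subcoalgebra_def)
      then obtain xs where xs: "set xs \<subseteq> D \<times> D" "comult A x = AA.TS xs"
        by (auto simp: tensor_subspace_def)
      have xs': "set xs \<subseteq> AA.pairs" using xs(1) Dc(1) by auto
      have "pairing k f g xs = \<zero>\<^bsub>k\<^esub>"
        unfolding pairing_def
      proof (rule R.lsum_zero)
        fix a b assume "(a, b) \<in> set xs"
        then have ab: "a \<in> D" "b \<in> D" using xs(1) by auto
        then have c: "a \<in> carrier A" "b \<in> carrier A" using Dc(1) by auto
        have "f a = \<zero>\<^bsub>k\<^esub> \<or> g b = \<zero>\<^bsub>k\<^esub>"
          using ann simple_subcoalgebra_subset[OF D(1)] ab by (auto simp: annihilator_def)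
        then show "f a \<otimes>\<^bsub>k\<^esub> g b = \<zero>\<^bsub>k\<^esub>" using c fg by auto
      qed
      then show "x \<in> {x \<in> carrier A. \<forall>f\<in>{conv k A f g}. f x = \<zero>\<^bsub>k\<^esub>}"
        using conv_sum[OF fg xs' xs(2)] D(2) Dc(1) by auto
    qed
  qed
  then show ?thesis using assms(1) by auto
qed

text \<open>The wedge of A_0 and A_n is the common kernel of the products f * g of their
  annihilators. One direction evaluates term by term; the other is \<open>filtered_tensor\<close>
  with two-step filtrations. From here on the filtration is only handled through this
  criterion.\<close>

lemma filt_Suc_iff:
  assumes sub: "submodule (filt n) k A"
  shows "x \<in> filt (Suc n) \<longleftrightarrow> x \<in> carrier A \<and>
    (\<forall>f\<in>annihilator k A (filt 0). \<forall>g\<in>annihilator k A (filt n). conv k A f g x = \<zero>\<^bsub>k\<^esub>)"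
    (is "?L \<longleftrightarrow> ?R")
proof
  assume ?L
  then have x: "x \<in> carrier A" and "comult A x \<in>
      tensor_subspace k A A (carrier A) (filt n) <+>\<^bsub>AA.T\<^esub> tensor_subspace k A A (filt 0) (carrier A)"
    by auto
  then obtain xs ys where xs: "set xs \<subseteq> carrier A \<times> filt n" and ys: "set ys \<subseteq> filt 0 \<times> carrier A"
    and eq: "comult A x = AA.TS xs \<oplus>\<^bsub>AA.T\<^esub> AA.TS ys"
    by (auto simp: set_add_def' tensor_subspace_def)
  have p: "set xs \<subseteq> AA.pairs" "set ys \<subseteq> AA.pairs"
    using xs ys submoduleE(1)[OF sub] submoduleE(1)[OF submodule_coradical] by auto
  have "conv k A f g x = \<zero>\<^bsub>k\<^esub>"
    if f: "f \<in> annihilator k A (filt 0)" and g: "g \<in> annihilator k A (filt n)" for f g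
  proof -
    have fg: "f \<in> dual k A" "g \<in> dual k A" using f g by (auto simp: annihilator_def)
    have "pairing k f g (xs @ ys) = \<zero>\<^bsub>k\<^esub>"
      unfolding pairing_def
    proof (rule R.lsum_zero)
      fix a b assume "(a, b) \<in> set (xs @ ys)"
      then have "(a \<in> filt 0 \<or> b \<in> filt n)" and c: "a \<in> carrier A" "b \<in> carrier A"
        using xs ys p by auto
      then have "f a = \<zero>\<^bsub>k\<^esub> \<or> g b = \<zero>\<^bsub>k\<^esub>" using annihilatorD(2)[OF f] annihilatorD(2)[OF g] by blast
      then show "f a \<otimes>\<^bsub>k\<^esub> g b = \<zero>\<^bsub>k\<^esub>" using fg c by auto
    qed
    then show ?thesis
      using conv_sum[OF fg, of "xs @ ys" x] eq p by (simp add: AA.tensor_add)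
  qed
  then show ?R using x by blast
next
  assume R: ?R
  then have x: "x \<in> carrier A" by simp
  then obtain xs where xs: "set xs \<subseteq> AA.pairs" "comult A x = AA.TS xs" by (rule comultE)
  \<comment> \<open>The filtrations A, A_0 on the left and A_n, A on the right. Label 0 then stands
    for a term in A \<otimes> A_n and label 1 for one in A_0 \<otimes> A, the two summands in the
    definition of \<open>coradical_filt\<close>.\<close>
  define P where "P i = (if i = 0 then carrier A else filt 0)" for i :: nat
  define Q where "Q i = (if i = 0 then filt n else carrier A)" for i :: nat
  have sub0: "submodule (filt 0) k A" using submodule_coradical by simp
  have "\<exists>ws. (\<forall>(i, a, b)\<in>set ws. i \<le> Suc 0 \<and> a \<in> P i \<and> b \<in> Q i) \<and> AA.teq xs (map snd ws)"
  proof (rule AA.filtered_tensor)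
    show "submodule (P i) k A" "submodule (Q i) k A" for i
      unfolding P_def Q_def using sub0 sub submodule_carrier by auto
    show "P j \<subseteq> P i" "Q i \<subseteq> Q j" if "i \<le> j" for i j
      using that submoduleE(1)[OF sub0] submoduleE(1)[OF sub] by (auto simp: P_def Q_def)
    show "set xs \<subseteq> AA.pairs" by fact
    fix i f g assume "i \<le> 0" "f \<in> annihilator k A (P (Suc i))" "g \<in> annihilator k A (Q i)"
    then have "f \<in> annihilator k A (filt 0)" "g \<in> annihilator k A (filt n)"
      by (auto simp: P_def Q_def)
    then show "pairing k f g xs = \<zero>\<^bsub>k\<^esub>"
      using R conv_sum[OF annihilatorD(1) annihilatorD(1) xs] by fastforce
  qed (auto simp: P_def Q_def)
  then obtain ws where ws: "\<forall>(i, a, b)\<in>set ws. i \<le> Suc 0 \<and> a \<in> P i \<and> b \<in> Q i"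
    and eq: "AA.teq xs (map snd ws)" by blast
  let ?p = "\<lambda>w :: nat \<times> _. fst w = 0"
  let ?ys = "map snd (filter ?p ws)" and ?zs = "map snd (filter (\<lambda>w. \<not> ?p w) ws)"
  have ys: "set ?ys \<subseteq> carrier A \<times> filt n" and zs: "set ?zs \<subseteq> filt 0 \<times> carrier A"
    using ws by (fastforce simp: P_def Q_def)+
  have p: "set ?ys \<subseteq> AA.pairs" "set ?zs \<subseteq> AA.pairs"
    using ys zs submoduleE(1)[OF sub] submoduleE(1)[OF sub0] by fast+
  note mc = AA.tensor_eq_pairs(2)[OF eq]
  have "AA.TS (map snd ws) = AA.TS (?ys @ ?zs)"
  proof (rule AA.tensor_sum_eqI)
    show "pairing k f g (map snd ws) = pairing k f g (?ys @ ?zs)"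
      if "f \<in> dual k A" "g \<in> dual k A" for f g
      unfolding pairing_def
      by (rule R.lsum_partition[symmetric]) (use that mc in auto)
  qed (use mc p in auto)
  then have "comult A x = AA.TS ?ys \<oplus>\<^bsub>AA.T\<^esub> AA.TS ?zs"
    using xs(2) AA.tensor_sum_eq[OF eq] AA.tensor_add[OF p] by simp
  moreover have "AA.TS ?ys \<in> tensor_subspace k A A (carrier A) (filt n)"
    "AA.TS ?zs \<in> tensor_subspace k A A (coradical k A) (carrier A)"
    unfolding tensor_subspace_def using ys zs by fastforce+
  ultimately show ?L using x by (auto simp: set_add_def')
qed

text \<open>The criterion presents A_{n+1} as a common kernel of functionals. It presupposes that
  A_n is a subspace, hence the induction.\<close>

lemma submodule_filt: "submodule (filt n) k A"
proof (induction n)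
  case 0
  show ?case using submodule_coradical by simp
next
  case (Suc n)
  have "filt (Suc n) = {x \<in> carrier A. \<forall>h\<in>{conv k A f g | f g.
      f \<in> annihilator k A (filt 0) \<and> g \<in> annihilator k A (filt n)}. h x = \<zero>\<^bsub>k\<^esub>}"
    using filt_Suc_iff[OF Suc] by auto
  moreover have "submodule \<dots> k A"
    by (rule submodule_kernel) (auto dest!: annihilatorD(1))
  ultimately show ?case by simp
qed

lemmas filt_Suc = filt_Suc_iff[OF submodule_filt]

lemma filt_closed: "x \<in> filt n \<Longrightarrow> x \<in> carrier A"
  using submoduleE(1)[OF submodule_filt] by blast

text \<open>The start is that A_0 is a subcoalgebra. In the step, a larger subspace has a smaller
  annihilator, so the criterion for the next member imposes fewer conditions.\<close>

lemma filt_mono_Suc: "filt n \<subseteq> filt (Suc n)"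
proof (induction n)
  case 0
  show ?case
  proof
    fix x assume x: "x \<in> filt 0"
    then show "x \<in> filt (Suc 0)"
      unfolding filt_Suc
      using coradical_coideal[of x] filt_closed[OF x] annihilatorD(1) by fastforce
  qed
next
  case (Suc n)
  show ?case
  proof
    fix x assume "x \<in> filt (Suc n)"
    then show "x \<in> filt (Suc (Suc n))"
      using annihilator_antimono[OF Suc] unfolding filt_Suc by blast
  qed
qed

lemma filt_mono: "i \<le> j \<Longrightarrow> filt i \<subseteq> filt j"
  by (rule lift_Suc_mono_le[of filt, OF filt_mono_Suc])

text \<open>A_{i+j+1} lies in the wedge of A_i and A_j. In the step y = (id \<otimes> g)\<Delta>(x)
  is tested against h * l with h killing A_0 and l killing A_i. By associativity this is h * (l * g)
  at x, and by induction l * g kills A_{i+j+1}. So y lies in A_{i+1}, where f vanishes.\<close>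

lemma filt_wedge:
  assumes "x \<in> filt (Suc (i + j))" "f \<in> annihilator k A (filt i)" "g \<in> annihilator k A (filt j)"
  shows "conv k A f g x = \<zero>\<^bsub>k\<^esub>"
  using assms
proof (induction i arbitrary: f g x)
  case 0
  then show ?case by (simp add: filt_Suc del: coradical_filt.simps)
next
  case (Suc i)
  have x: "x \<in> carrier A" and fg: "f \<in> dual k A" "g \<in> dual k A"
    using Suc.prems filt_closed by (auto dest: annihilatorD(1))
  obtain y where y: "y \<in> carrier A" "\<And>f. f \<in> dual k A \<Longrightarrow> f y = conv k A f g x"
    using fg(2) x by (rule contract_right) blast
  have "y \<in> filt (Suc i)"
    unfolding filt_Suc
  proof (intro conjI ballI y(1))
    fix h l assume h: "h \<in> annihilator k A (filt 0)" and l: "l \<in> annihilator k A (filt i)"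
    have hl: "h \<in> dual k A" "l \<in> dual k A" using h l by (auto dest: annihilatorD(1))
    have "conv k A l g \<in> annihilator k A (filt (Suc (i + j)))"
      using Suc.IH[OF _ l Suc.prems(3)] hl fg by (auto simp: annihilator_def simp del: coradical_filt.simps)
    then have "conv k A h (conv k A l g) x = \<zero>\<^bsub>k\<^esub>"
      using Suc.prems(1) h filt_Suc[of x "Suc (i + j)"] by (simp del: coradical_filt.simps)
    then show "conv k A h l y = \<zero>\<^bsub>k\<^esub>" using y(2)[OF conv_dual[OF hl]] conv_assoc[OF hl fg(2) x] by simp
  qed
  then show ?case using y(2)[OF fg(1)] annihilatorD(2)[OF Suc.prems(2)] by simp
qed

text \<open>Testing (f \<otimes> id)\<Delta>(x) for membership in A_n means testing x against (f *
  h) * l with h killing A_0. The product f * h still kills A_0, since A_0 is a subcoalgebra.\<close>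

lemma filt_coideal_right:
  assumes "x \<in> filt n" "f \<in> dual k A" "g \<in> annihilator k A (filt n)"
  shows "conv k A f g x = \<zero>\<^bsub>k\<^esub>"
proof (cases n)
  case 0
  then show ?thesis using coradical_coideal[of x f g] assms by (auto dest: annihilatorD(1))
next
  case (Suc m)
  have x: "x \<in> carrier A" using filt_closed assms by blast
  obtain y where y: "y \<in> carrier A" "\<And>g. g \<in> dual k A \<Longrightarrow> g y = conv k A f g x"
    using assms(2) x by (rule contract_left) blast
  have "y \<in> filt (Suc m)"
    unfolding filt_Suc
  proof (intro conjI ballI y(1))
    fix h l assume h: "h \<in> annihilator k A (filt 0)" and l: "l \<in> annihilator k A (filt m)"
    have hl: "h \<in> dual k A" "l \<in> dual k A" using h l by (auto dest: annihilatorD(1))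
    have "conv k A f h \<in> annihilator k A (filt 0)"
      using coradical_coideal[of _ f h] hl assms(2) h by (auto simp: annihilator_def)
    then have "conv k A (conv k A f h) l x = \<zero>\<^bsub>k\<^esub>"
      using assms(1) l filt_Suc[of x m] Suc by (simp del: coradical_filt.simps)
    then show "conv k A h l y = \<zero>\<^bsub>k\<^esub>" using y(2)[OF conv_dual[OF hl]] conv_assoc[OF assms(2) hl x] by simp
  qed
  then show ?thesis using y(2) assms(3) Suc annihilatorD by metis
qed

text \<open>On this side the test is h * (l * g) with l killing A_{n-1}. That l * g kills A_{n-1} as
  well is the claim for n - 1, so this inclusion goes by induction.\<close>

lemma filt_coideal_left:
  assumes "x \<in> filt n" "f \<in> annihilator k A (filt n)" "g \<in> dual k A"
  shows "conv k A f g x = \<zero>\<^bsub>k\<^esub>"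
  using assms
proof (induction n arbitrary: x f g)
  case 0
  then show ?case using coradical_coideal[of x f g] by (auto dest: annihilatorD(1))
next
  case (Suc m)
  have x: "x \<in> carrier A" using filt_closed Suc.prems by blast
  obtain y where y: "y \<in> carrier A" "\<And>f. f \<in> dual k A \<Longrightarrow> f y = conv k A f g x"
    using Suc.prems(3) x by (rule contract_right) blast
  have "y \<in> filt (Suc m)"
    unfolding filt_Suc
  proof (intro conjI ballI y(1))
    fix h l assume h: "h \<in> annihilator k A (filt 0)" and l: "l \<in> annihilator k A (filt m)"
    have hl: "h \<in> dual k A" "l \<in> dual k A" using h l by (auto dest: annihilatorD(1))
    have "conv k A l g \<in> annihilator k A (filt m)"
      using Suc.IH[OF _ l Suc.prems(3)] hl Suc.prems(3) by (auto simp: annihilator_def)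
    then have "conv k A h (conv k A l g) x = \<zero>\<^bsub>k\<^esub>"
      using Suc.prems(1) h filt_Suc[of x m] by (simp del: coradical_filt.simps)
    then show "conv k A h l y = \<zero>\<^bsub>k\<^esub>" using y(2)[OF conv_dual[OF hl]] conv_assoc[OF hl Suc.prems(3) x] by simp
  qed
  then show ?case using y(2) Suc.prems(2) annihilatorD by metis
qed

text \<open>If \<open>x \<in> A\<^sub>n\<close>, then \<open>\<Delta>(x)\<close> is killed by all pairs from the annihilators of \<open>A\<^sub>n\<^sub>-\<^sub>i\<close> and
  \<open>A\<^sub>i\<^sub>-\<^sub>1\<close> with \<open>0 \<le> i \<le> n + 1\<close>, where \<open>A\<^sub>-\<^sub>1 = 0\<close>: this is \<open>filt_wedge\<close> for \<open>1 \<le> i \<le> n\<close> and the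
  coideal property for the two extreme values of \<open>i\<close>.\<close>

lemma comult_filt:
  assumes x: "x \<in> filt n"
  shows "\<exists>ws. (\<forall>(i, a, b)\<in>set ws. i \<le> n \<and> a \<in> filt i \<and> b \<in> filt (n - i)) \<and>
    comult A x = AA.TS (map (\<lambda>(i, a, b). (a, b)) ws)"
proof -
  obtain xs where xs: "set xs \<subseteq> AA.pairs" "comult A x = AA.TS xs"
    using filt_closed[OF x] by (rule comultE)
  \<comment> \<open>The members A and 0 that \<open>filtered_tensor\<close> demands at the ends are
    put at q = 0 and q = n + 2. In between, q stands for the pair A_{n+1-q}, A_{q-1}.\<close>
  define P where "P q = (if q = 0 then carrier A else if q = Suc (Suc n) then {\<zero>\<^bsub>A\<^esub>} else filt (Suc n - q))" for q
  define Q where "Q q = (if q = 0 then {\<zero>\<^bsub>A\<^esub>} else if q = Suc (Suc n) then carrier A else filt (q - 1))" for q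
  have sz: "\<zero>\<^bsub>A\<^esub> \<in> filt i" for i using submodule_zero_mem[OF submodule_filt] .
  have "\<exists>ws. (\<forall>(i, a, b)\<in>set ws. i \<le> Suc (Suc n) \<and> a \<in> P i \<and> b \<in> Q i) \<and> AA.teq xs (map snd ws)"
  proof (rule AA.filtered_tensor)
    show "submodule (P i) k A" "submodule (Q i) k A" for i
      unfolding P_def Q_def using submodule_filt submodule_carrier submodule_zero
      by (auto simp del: coradical_filt.simps)
    show "P j \<subseteq> P i" "Q i \<subseteq> Q j" if "i \<le> j" "j \<le> Suc (Suc n)" for i j
      using that filt_mono[of "Suc n - j" "Suc n - i"] filt_mono[of "i - 1" "j - 1"] sz filt_closed
      by (auto simp: P_def Q_def simp del: coradical_filt.simps)
    show "set xs \<subseteq> AA.pairs" by fact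
    fix i f g assume i: "i \<le> Suc n" and f: "f \<in> annihilator k A (P (Suc i))"
      and g: "g \<in> annihilator k A (Q i)"
    have fg: "f \<in> dual k A" "g \<in> dual k A" using f g by (auto dest: annihilatorD(1))
    have "conv k A f g x = \<zero>\<^bsub>k\<^esub>"
    proof -
      consider "i = 0" | "i = Suc n" | j where "i = Suc j" "j < n" using i by (cases i) fastforce+
      then show ?thesis
      proof cases
        case 1
        then have "f \<in> annihilator k A (filt n)" using f by (simp add: P_def del: coradical_filt.simps)
        then show ?thesis using filt_coideal_left[OF x _ fg(2)] by blast
      next
        case 2
        then have "g \<in> annihilator k A (filt n)" using g by (simp add: Q_def del: coradical_filt.simps)
        then show ?thesis using filt_coideal_right[OF x fg(1)] by blast
      next
        case 3
        then have "f \<in> annihilator k A (filt (n - Suc j))" "g \<in> annihilator k A (filt j)"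
          using f g by (auto simp: P_def Q_def simp del: coradical_filt.simps)
        moreover have "x \<in> filt (Suc ((n - Suc j) + j))" using x 3 by (simp del: coradical_filt.simps)
        ultimately show ?thesis using filt_wedge by blast
      qed
    qed
    then show "pairing k f g xs = \<zero>\<^bsub>k\<^esub>" using conv_sum[OF fg xs] by simp
  qed (auto simp: P_def Q_def)
  then obtain ws where ws: "\<forall>(i, a, b)\<in>set ws. i \<le> Suc (Suc n) \<and> a \<in> P i \<and> b \<in> Q i"
    and eq: "AA.teq xs (map snd ws)" by blast
  note mc = AA.tensor_eq_pairs(2)[OF eq]
  \<comment> \<open>A term with q = 0 has right entry 0 and one with q = n + 2 has left entry 0, so
    these drop out. Any other term lies in A_{n+1-q} \<otimes> A_{q-1}, hence gets the index i = n +
    1 - q, and n - i = q - 1.\<close>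
  define vs where "vs = map (\<lambda>(q, a, b). (Suc n - q, a, b))
    (filter (\<lambda>(q, a, b). q \<noteq> 0 \<and> q \<noteq> Suc (Suc n)) ws)"
  have vs: "\<forall>(i, a, b)\<in>set vs. i \<le> n \<and> a \<in> filt i \<and> b \<in> filt (n - i)"
  proof (clarify, rule conjI[OF _ conjI])
    fix i a b assume "(i, a, b) \<in> set vs"
    then obtain q where q: "(q, a, b) \<in> set ws" "q \<noteq> 0" "q \<noteq> Suc (Suc n)" "i = Suc n - q"
      by (auto simp: vs_def)
    then have "q \<le> Suc (Suc n)" "a \<in> P q" "b \<in> Q q" using ws by auto
    moreover have "n - i = q - 1" using q calculation(1) by auto
    ultimately show "i \<le> n" "a \<in> filt i" "b \<in> filt (n - i)"
      using q by (auto simp: P_def Q_def simp del: coradical_filt.simps)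
  qed
  then have vsc: "set (map (\<lambda>(i, a, b). (a, b)) vs) \<subseteq> AA.pairs" using filt_closed by fastforce
  have "AA.TS (map snd ws) = AA.TS (map (\<lambda>(i, a, b). (a, b)) vs)"
  proof (rule AA.tensor_sum_eqI[OF mc vsc])
    fix f g assume fg: "f \<in> dual k A" "g \<in> dual k A"
    show "pairing k f g (map snd ws) = pairing k f g (map (\<lambda>(i, a, b). (a, b)) vs)"
      unfolding vs_def using ws mc
    proof (induction ws)
      case (Cons w ws)
      obtain q a b where w: "w = (q, a, b)" by (cases w)
      have c: "a \<in> carrier A" "b \<in> carrier A" "set (map snd ws) \<subseteq> AA.pairs" using Cons.prems w by auto
      have "f a \<otimes>\<^bsub>k\<^esub> g b = \<zero>\<^bsub>k\<^esub>" if "q = 0 \<or> q = Suc (Suc n)"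
      proof -
        have "a = \<zero>\<^bsub>A\<^esub> \<or> b = \<zero>\<^bsub>A\<^esub>" using that Cons.prems(1) w by (auto simp: P_def Q_def)
        then show ?thesis using c fg by auto
      qed
      moreover have "pairing k f g (map snd ws) \<in> carrier k" using fg c(3) by simp
      ultimately show ?case using Cons w by auto
    qed simp
  qed
  then show ?thesis using vs xs(2) AA.tensor_sum_eq[OF eq] by auto
qed

end

section \<open>Convolutions evaluated at products and brackets\<close>

lemma linear_map_comp:
  "linear_map k L M p \<Longrightarrow> linear_map k M N q \<Longrightarrow> linear_map k L N (\<lambda>x. q (p x))"
  by (auto simp: linear_map_def)

sublocale poisson_algebra \<subseteq> linear_space k A
  by unfold_locales

sublocale poisson_algebra \<subseteq> AA: linear_space_pair k A A
  by unfold_locales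

context poisson_algebra
begin

lemma smult_mult_right:
  "r \<in> carrier k \<Longrightarrow> x \<in> carrier A \<Longrightarrow> y \<in> carrier A \<Longrightarrow> x \<otimes>\<^bsub>A\<^esub> (r \<odot>\<^bsub>A\<^esub> y) = r \<odot>\<^bsub>A\<^esub> (x \<otimes>\<^bsub>A\<^esub> y)"
  using smult_assoc2[of r y x] by (simp add: m_comm)

lemma mult_linear_right: "a \<in> carrier A \<Longrightarrow> linear_map k A A (\<lambda>x. a \<otimes>\<^bsub>A\<^esub> x)"
  by (rule linear_mapI) (auto simp: r_distr smult_mult_right)

lemma mult_linear_left: "a \<in> carrier A \<Longrightarrow> linear_map k A A (\<lambda>x. x \<otimes>\<^bsub>A\<^esub> a)"
  by (rule linear_mapI) (auto simp: l_distr smult_assoc2)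

lemma bracket_linear_right: "a \<in> carrier A \<Longrightarrow> linear_map k A A (\<lambda>x. bracket A a x)"
  by (rule linear_mapI) (auto simp: bracket_closed bracket_add_right bracket_smult_right)

lemma bracket_linear_left: "a \<in> carrier A \<Longrightarrow> linear_map k A A (\<lambda>x. bracket A x a)"
  by (rule linear_mapI) (auto simp: bracket_closed bracket_add_left bracket_smult_left)

lemmas linear_lmaps = mult_linear_right mult_linear_left bracket_linear_right bracket_linear_left

lemma bilinear_pure_linear:
  assumes "linear_map k A A p" "linear_map k A A q"
  shows "bilinear_map k A A AA.T (\<lambda>c d. pure_tensor k A A (p c) (q d))"
proof (rule AA.bilinear_mapI_linear[OF AA.T.linear_space_axioms])
  show "linear_map k A AA.T (\<lambda>c. pure_tensor k A A (p c) (q d))" if "d \<in> carrier A" for d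
    by (rule linear_map_comp[OF assms(1) AA.pure_tensor_linear_left])
      (rule linear_mapD(1)[OF assms(2) that])
  show "linear_map k A AA.T (\<lambda>d. pure_tensor k A A (p c) (q d))" if "c \<in> carrier A" for c
    by (rule linear_map_comp[OF assms(2) AA.pure_tensor_linear_right])
      (rule linear_mapD(1)[OF assms(1) that])
qed

lemma bilinear_map_sum:
  assumes "bilinear_map k A A AA.T \<beta>" "bilinear_map k A A AA.T \<gamma>"
  shows "bilinear_map k A A AA.T (\<lambda>c d. \<beta> c d \<oplus>\<^bsub>AA.T\<^esub> \<gamma> c d)"
  using bilinear_mapD[OF assms(1)] bilinear_mapD[OF assms(2)]
  by (intro bilinear_mapI) (auto simp: AA.T.M.a_ac)

lemma tensor_pairing_lift2:
  assumes fg: "f \<in> dual k A" "g \<in> dual k A"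
    and r: "\<And>a b. a \<in> carrier A \<Longrightarrow> b \<in> carrier A \<Longrightarrow> bilinear_map k A A AA.T (\<beta> a b)"
    and l: "\<And>c d. c \<in> carrier A \<Longrightarrow> d \<in> carrier A \<Longrightarrow> bilinear_map k A A AA.T (\<lambda>a b. \<beta> a b c d)"
    and xs: "set xs \<subseteq> AA.pairs" and ys: "set ys \<subseteq> AA.pairs"
  shows "tensor_pairing k f g
      (tensor_lift AA.T (\<lambda>a b. tensor_lift AA.T (\<beta> a b) (AA.TS ys)) (AA.TS xs)) =
    lsum k (\<lambda>a b. lsum k (\<lambda>c d. tensor_pairing k f g (\<beta> a b c d)) ys) xs"
proof -
  have cl: "\<beta> a b c d \<in> carrier AA.T" if "(a, b) \<in> set xs" "(c, d) \<in> set ys" for a b c d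
    using bilinear_mapD(1)[OF r] that xs ys by blast
  have cl': "lsum AA.T (\<beta> a b) ys \<in> carrier AA.T" if "(a, b) \<in> set xs" for a b
    by (rule AA.T.M.lsum_closed) (rule cl[OF that])
  have "tensor_pairing k f g (lsum AA.T (\<lambda>a b. lsum AA.T (\<beta> a b) ys) xs) =
      lsum k (\<lambda>a b. tensor_pairing k f g (lsum AA.T (\<beta> a b) ys)) xs"
    by (rule AA.T.dual_lsum[OF AA.tensor_pairing_dual[OF fg] cl'])
  also have "\<dots> = lsum k (\<lambda>a b. lsum k (\<lambda>c d. tensor_pairing k f g (\<beta> a b c d)) ys) xs"
    by (rule lsum_cong, rule AA.T.dual_lsum[OF AA.tensor_pairing_dual[OF fg] cl])
  finally show ?thesis
    using AA.tensor_lift2[OF AA.T.M.abelian_monoid_axioms r l xs ys] by simp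
qed

end

context poisson_hopf_algebra
begin

text \<open>Multiplicativity of \<Delta> in dual form. For a fixed term a \<otimes> b of \<Delta>(x)
  the inner sum pairs \<Delta>(y) with f and g translated by a and b, so what is known about y can
  be applied for each (a, b) separately.\<close>

lemma conv_mult:
  assumes fg: "f \<in> dual k A" "g \<in> dual k A" and x: "x \<in> carrier A" and y: "y \<in> carrier A"
    and xs: "set xs \<subseteq> AA.pairs" "comult A x = AA.TS xs"
    and ys: "set ys \<subseteq> AA.pairs" "comult A y = AA.TS ys"
  shows "conv k A f g (x \<otimes>\<^bsub>A\<^esub> y) =
    lsum k (\<lambda>a b. pairing k (\<lambda>c. f (a \<otimes>\<^bsub>A\<^esub> c)) (\<lambda>d. g (b \<otimes>\<^bsub>A\<^esub> d)) ys) xs"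
proof -
  have "conv k A f g (x \<otimes>\<^bsub>A\<^esub> y) = tensor_pairing k f g
      (tensor_lift AA.T (\<lambda>a b. tensor_lift AA.T (\<lambda>c d. pure_tensor k A A (a \<otimes>\<^bsub>A\<^esub> c) (b \<otimes>\<^bsub>A\<^esub> d))
        (AA.TS ys)) (AA.TS xs))"
    unfolding conv_def comult_mult[OF x y] xs(2) ys(2) by (simp add: tensor_algebra_def)
  also have "\<dots> = lsum k (\<lambda>a b. lsum k (\<lambda>c d.
      tensor_pairing k f g (pure_tensor k A A (a \<otimes>\<^bsub>A\<^esub> c) (b \<otimes>\<^bsub>A\<^esub> d))) ys) xs"
    by (rule tensor_pairing_lift2[OF fg]) (intro bilinear_pure_linear linear_lmaps xs(1) ys(1); assumption)+
  also have "\<dots> = lsum k (\<lambda>a b. pairing k (\<lambda>c. f (a \<otimes>\<^bsub>A\<^esub> c)) (\<lambda>d. g (b \<otimes>\<^bsub>A\<^esub> d)) ys) xs"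
    unfolding pairing_def
    by (intro lsum_cong AA.tensor_pairing_pure fg) (use xs(1) ys(1) in auto)
  finally show ?thesis .
qed

text \<open>The same for the bracket. The two summands are those of the Poisson structure on A
  \<otimes> A, with the bracket on the right factor and on the left factor respectively.\<close>

lemma conv_bracket:
  assumes fg: "f \<in> dual k A" "g \<in> dual k A" and x: "x \<in> carrier A" and y: "y \<in> carrier A"
    and xs: "set xs \<subseteq> AA.pairs" "comult A x = AA.TS xs"
    and ys: "set ys \<subseteq> AA.pairs" "comult A y = AA.TS ys"
  shows "conv k A f g (bracket A x y) =
    lsum k (\<lambda>a b. pairing k (\<lambda>c. f (a \<otimes>\<^bsub>A\<^esub> c)) (\<lambda>d. g (bracket A b d)) ys \<oplus>\<^bsub>k\<^esub>
      pairing k (\<lambda>c. f (bracket A a c)) (\<lambda>d. g (b \<otimes>\<^bsub>A\<^esub> d)) ys) xs"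
proof -
  have "conv k A f g (bracket A x y) = tensor_pairing k f g
      (tensor_lift AA.T (\<lambda>a b. tensor_lift AA.T (\<lambda>c d.
        pure_tensor k A A (a \<otimes>\<^bsub>A\<^esub> c) (bracket A b d) \<oplus>\<^bsub>AA.T\<^esub>
        pure_tensor k A A (bracket A a c) (b \<otimes>\<^bsub>A\<^esub> d)) (AA.TS ys)) (AA.TS xs))"
    unfolding conv_def comult_bracket[OF x y] xs(2) ys(2) by (simp add: tensor_bracket_def)
  also have "\<dots> = lsum k (\<lambda>a b. lsum k (\<lambda>c d. tensor_pairing k f g
      (pure_tensor k A A (a \<otimes>\<^bsub>A\<^esub> c) (bracket A b d) \<oplus>\<^bsub>AA.T\<^esub>
        pure_tensor k A A (bracket A a c) (b \<otimes>\<^bsub>A\<^esub> d))) ys) xs"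
    by (rule tensor_pairing_lift2[OF fg])
      (intro bilinear_map_sum bilinear_pure_linear linear_lmaps xs(1) ys(1); assumption)+
  also have "\<dots> = lsum k (\<lambda>a b. lsum k (\<lambda>c d. f (a \<otimes>\<^bsub>A\<^esub> c) \<otimes>\<^bsub>k\<^esub> g (bracket A b d) \<oplus>\<^bsub>k\<^esub>
      f (bracket A a c) \<otimes>\<^bsub>k\<^esub> g (b \<otimes>\<^bsub>A\<^esub> d)) ys) xs"
  proof (intro lsum_cong)
    fix a b c d assume "(a, b) \<in> set xs" "(c, d) \<in> set ys"
    then have "a \<in> carrier A" "b \<in> carrier A" "c \<in> carrier A" "d \<in> carrier A" using xs ys by auto
    then show "tensor_pairing k f g (pure_tensor k A A (a \<otimes>\<^bsub>A\<^esub> c) (bracket A b d) \<oplus>\<^bsub>AA.T\<^esub>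
        pure_tensor k A A (bracket A a c) (b \<otimes>\<^bsub>A\<^esub> d)) =
      f (a \<otimes>\<^bsub>A\<^esub> c) \<otimes>\<^bsub>k\<^esub> g (bracket A b d) \<oplus>\<^bsub>k\<^esub> f (bracket A a c) \<otimes>\<^bsub>k\<^esub> g (b \<otimes>\<^bsub>A\<^esub> d)"
      using AA.T.dual_add[OF AA.tensor_pairing_dual[OF fg]] fg by (simp add: bracket_closed)
  qed
  also have "\<dots> = lsum k (\<lambda>a b. pairing k (\<lambda>c. f (a \<otimes>\<^bsub>A\<^esub> c)) (\<lambda>d. g (bracket A b d)) ys \<oplus>\<^bsub>k\<^esub>
      pairing k (\<lambda>c. f (bracket A a c)) (\<lambda>d. g (b \<otimes>\<^bsub>A\<^esub> d)) ys) xs"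
    unfolding pairing_def
  proof (rule lsum_cong)
    fix a b assume "(a, b) \<in> set xs"
    then have "a \<in> carrier A" "b \<in> carrier A" using xs by auto
    then show "lsum k (\<lambda>c d. f (a \<otimes>\<^bsub>A\<^esub> c) \<otimes>\<^bsub>k\<^esub> g (bracket A b d) \<oplus>\<^bsub>k\<^esub> f (bracket A a c) \<otimes>\<^bsub>k\<^esub> g (b \<otimes>\<^bsub>A\<^esub> d)) ys =
        lsum k (\<lambda>c d. f (a \<otimes>\<^bsub>A\<^esub> c) \<otimes>\<^bsub>k\<^esub> g (bracket A b d)) ys \<oplus>\<^bsub>k\<^esub>
        lsum k (\<lambda>c d. f (bracket A a c) \<otimes>\<^bsub>k\<^esub> g (b \<otimes>\<^bsub>A\<^esub> d)) ys"
      by (intro R.lsum_add) (use ys(1) fg in \<open>auto simp: bracket_closed\<close>)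
  qed
  finally show ?thesis .
qed

section \<open>Group-like elements and pointedness\<close>

abbreviation "G \<equiv> grouplikes k A"

lemma grouplikeD:
  assumes "g \<in> G"
  shows "g \<in> carrier A" "comult A g = AA.TS [(g, g)]" "counit A g = \<one>\<^bsub>k\<^esub>"
  using assms by (auto simp: grouplikes_def pure_tensor_def)

lemma counit_dual: "counit A \<in> dual k A"
  by (rule dualI) (auto simp: counit_closed counit_add counit_smult)

lemma conv_grouplike:
  "g \<in> G \<Longrightarrow> f \<in> dual k A \<Longrightarrow> f' \<in> dual k A \<Longrightarrow> conv k A f f' g = f g \<otimes>\<^bsub>k\<^esub> f' g"
  using conv_sum[of f f' "[(g, g)]" g] grouplikeD[of g] by simp

lemma one_grouplike: "\<one>\<^bsub>A\<^esub> \<in> G"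
  by (simp add: grouplikes_def comult_one counit_one tensor_algebra_def)

lemma conv_one: "f \<in> dual k A \<Longrightarrow> g \<in> dual k A \<Longrightarrow> conv k A f g \<one>\<^bsub>A\<^esub> = f \<one>\<^bsub>A\<^esub> \<otimes>\<^bsub>k\<^esub> g \<one>\<^bsub>A\<^esub>"
  by (rule conv_grouplike[OF one_grouplike])

text \<open>Take h = S(g), so that hg = 1. Multiplying \<Delta>(h)(g \<otimes> g) = \<Delta>(1) = 1
  \<otimes> 1 by h \<otimes> h gives \<Delta>(h) = h \<otimes> h. In dual form this multiplication
  is the passage from f, f' to the translates p, p'.\<close>

lemma grouplike_inverse:
  assumes g: "g \<in> G"
  obtains h where "h \<in> G" "h \<otimes>\<^bsub>A\<^esub> g = \<one>\<^bsub>A\<^esub>"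
proof -
  note gD = grouplikeD[OF g]
  obtain S where S: "is_antipode k A S" using antipode_exists by blast
  then have Sl: "linear_map k A A S" by (auto simp: is_antipode_def linear_map_def)
  define h where "h = S g"
  have h: "h \<in> carrier A" using linear_mapD(1)[OF Sl gD(1)] by (simp add: h_def)
  have bil: "bilinear_map k A A A (\<lambda>x y. S x \<otimes>\<^bsub>A\<^esub> y)"
    by (rule AA.bilinear_mapI_linear[OF linear_space_axioms])
      (auto intro: linear_map_comp[OF Sl mult_linear_left] mult_linear_right linear_mapD(1)[OF Sl])
  have "tensor_lift A (\<lambda>x y. S x \<otimes>\<^bsub>A\<^esub> y) (comult A g) = h \<otimes>\<^bsub>A\<^esub> g"
    unfolding gD(2) using AA.tensor_lift_eq[OF M.abelian_monoid_axioms bil, of "[(g, g)]"] gD(1) h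
    by (simp add: h_def)
  then have hg: "h \<otimes>\<^bsub>A\<^esub> g = \<one>\<^bsub>A\<^esub>" using S gD(1,3) by (simp add: is_antipode_def)
  obtain xs where xs: "set xs \<subseteq> AA.pairs" "comult A h = AA.TS xs" using h by (rule comultE)
  have "AA.TS xs = AA.TS [(h, h)]"
  proof (rule AA.tensor_sum_eqI[OF xs(1)])
    fix f f' assume f: "f \<in> dual k A" "f' \<in> dual k A"
    define p where "p a = f (a \<otimes>\<^bsub>A\<^esub> h)" for a
    define p' where "p' a = f' (a \<otimes>\<^bsub>A\<^esub> h)" for a
    have p: "p \<in> dual k A" "p' \<in> dual k A"
      unfolding p_def[abs_def] p'_def[abs_def] using f h by (auto intro: dual_comp[OF mult_linear_left])
    have u: "a \<otimes>\<^bsub>A\<^esub> g \<otimes>\<^bsub>A\<^esub> h = a" if "a \<in> carrier A" for a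
      using that gD(1) h hg by (simp add: m_assoc m_comm[of g h])
    have "f h \<otimes>\<^bsub>k\<^esub> f' h = conv k A p p' (h \<otimes>\<^bsub>A\<^esub> g)"
      unfolding hg using conv_one[OF p] h by (simp add: p_def p'_def)
    also have "\<dots> = lsum k (\<lambda>a b. pairing k (\<lambda>c. p (a \<otimes>\<^bsub>A\<^esub> c)) (\<lambda>d. p' (b \<otimes>\<^bsub>A\<^esub> d)) [(g, g)]) xs"
      by (rule conv_mult[OF p h gD(1) xs _ gD(2)]) (use gD(1) in simp)
    also have "\<dots> = pairing k f f' xs"
      unfolding pairing_def
    proof (rule lsum_cong)
      fix a b assume "(a, b) \<in> set xs"
      then have "a \<in> carrier A" "b \<in> carrier A" using xs(1) by auto
      then show "lsum k (\<lambda>c d. p (a \<otimes>\<^bsub>A\<^esub> c) \<otimes>\<^bsub>k\<^esub> p' (b \<otimes>\<^bsub>A\<^esub> d)) [(g, g)] = f a \<otimes>\<^bsub>k\<^esub> f' b"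
        using f u by (simp add: p_def p'_def)
    qed
    finally have "pairing k f f' xs = f h \<otimes>\<^bsub>k\<^esub> f' h" by simp
    then show "pairing k f f' xs = pairing k f f' [(h, h)]" using f h by simp
  qed (use h in simp)
  moreover have "counit A h = \<one>\<^bsub>k\<^esub>"
    using counit_mult[OF h gD(1)] counit_closed[OF h] gD(3) hg counit_one by simp
  ultimately have "h \<in> G" using h xs(2) by (simp add: grouplikes_def pure_tensor_def)
  then show thesis using that hg by blast
qed

text \<open>By pointedness D is a line k d, so \<Delta>(d) = c (d \<otimes> d) for a scalar c, and
  counitality forces c \<epsilon>(d) = 1. Then g = c d satisfies \<Delta>(g) = g \<otimes> g and
  \<epsilon>(g) = 1.\<close>

lemma simple_subcoalgebra_grouplike:
  assumes "pointed k A" and D: "simple_subcoalgebra k A D"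
  obtains g where "g \<in> G" "D \<subseteq> {r \<odot>\<^bsub>A\<^esub> g | r. r \<in> carrier k}"
proof -
  obtain d where d: "d \<in> carrier A" "d \<noteq> \<zero>\<^bsub>A\<^esub>" "D = {r \<odot>\<^bsub>A\<^esub> d | r. r \<in> carrier k}"
    using assms by (auto simp: pointed_def)
  have "d \<in> D" using d by (auto intro!: exI[of _ "\<one>\<^bsub>k\<^esub>"])
  then have "comult A d \<in> tensor_subspace k A A D D"
    using D by (auto simp: simple_subcoalgebra_def subcoalgebra_def)
  then obtain xs where xs: "set xs \<subseteq> D \<times> D" "comult A d = AA.TS xs"
    by (auto simp: tensor_subspace_def)
  have Dc: "D \<subseteq> carrier A" using d by auto
  \<comment> \<open>Each term of \<Delta>(d) has the form r d \<otimes> s d; the scalar c is the sum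
    of the products r s.\<close>
  have "\<exists>c\<in>carrier k. \<forall>f\<in>dual k A. \<forall>g\<in>dual k A. pairing k f g xs = c \<otimes>\<^bsub>k\<^esub> (f d \<otimes>\<^bsub>k\<^esub> g d)"
    using xs(1)
  proof (induction xs)
    case Nil
    then show ?case using d(1) by (intro bexI[of _ "\<zero>\<^bsub>k\<^esub>"]) auto
  next
    case (Cons x xs)
    then obtain c where c: "c \<in> carrier k"
        "\<forall>f\<in>dual k A. \<forall>g\<in>dual k A. pairing k f g xs = c \<otimes>\<^bsub>k\<^esub> (f d \<otimes>\<^bsub>k\<^esub> g d)" by auto
    obtain r s where rs: "x = (r \<odot>\<^bsub>A\<^esub> d, s \<odot>\<^bsub>A\<^esub> d)" "r \<in> carrier k" "s \<in> carrier k"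
      using Cons.prems d(3) by auto
    have "pairing k f g (x # xs) = (r \<otimes>\<^bsub>k\<^esub> s \<oplus>\<^bsub>k\<^esub> c) \<otimes>\<^bsub>k\<^esub> (f d \<otimes>\<^bsub>k\<^esub> g d)"
      if "f \<in> dual k A" "g \<in> dual k A" for f g
      using that c rs d(1) R.l_distr[of "r \<otimes>\<^bsub>k\<^esub> s" c "f d \<otimes>\<^bsub>k\<^esub> g d"] by (simp add: R.m_ac)
    then show ?case using c rs by (intro bexI[of _ "r \<otimes>\<^bsub>k\<^esub> s \<oplus>\<^bsub>k\<^esub> c"]) auto
  qed
  then obtain c where c: "c \<in> carrier k"
    "\<And>f g. f \<in> dual k A \<Longrightarrow> g \<in> dual k A \<Longrightarrow> pairing k f g xs = c \<otimes>\<^bsub>k\<^esub> (f d \<otimes>\<^bsub>k\<^esub> g d)" by blast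
  have xsc: "set xs \<subseteq> AA.pairs" using xs(1) Dc by auto
  have \<Delta>: "comult A d = AA.TS [(c \<odot>\<^bsub>A\<^esub> d, d)]"
    unfolding xs(2) using c d(1) xsc by (intro AA.tensor_sum_eqI) (auto simp: R.m_ac)
  have bil: "bilinear_map k A A A (\<lambda>x y. counit A x \<odot>\<^bsub>A\<^esub> y)"
  proof (rule bilinear_mapI)
    show "counit A \<zero>\<^bsub>A\<^esub> \<odot>\<^bsub>A\<^esub> b = \<zero>\<^bsub>A\<^esub>" if "b \<in> carrier A" for b
      using dual_zero[OF counit_dual] that by simp
  qed (simp_all add: counit_closed counit_add counit_smult smult_l_distr smult_r_distr
      smult_assoc1[symmetric] R.m_comm)
  have e: "counit A d \<in> carrier k" using d(1) by (rule counit_closed)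
  have "(c \<otimes>\<^bsub>k\<^esub> counit A d) \<odot>\<^bsub>A\<^esub> d = d"
    using counit_left[OF d(1)] AA.tensor_lift_eq[OF M.abelian_monoid_axioms bil, of "[(c \<odot>\<^bsub>A\<^esub> d, d)]"]
      d(1) c(1) e by (simp add: \<Delta> counit_smult)
  then have "(c \<otimes>\<^bsub>k\<^esub> counit A d \<ominus>\<^bsub>k\<^esub> \<one>\<^bsub>k\<^esub>) \<odot>\<^bsub>A\<^esub> d = \<zero>\<^bsub>A\<^esub>"
    using c(1) e d(1) by (simp add: a_minus_def smult_l_distr smult_l_minus M.r_neg)
  have ce: "c \<otimes>\<^bsub>k\<^esub> counit A d = \<one>\<^bsub>k\<^esub>"
  proof (rule ccontr)
    let ?u = "c \<otimes>\<^bsub>k\<^esub> counit A d \<ominus>\<^bsub>k\<^esub> \<one>\<^bsub>k\<^esub>"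
    assume "c \<otimes>\<^bsub>k\<^esub> counit A d \<noteq> \<one>\<^bsub>k\<^esub>"
    then have u: "?u \<in> Units k" using c(1) e by (simp add: field_Units)
    then have "d = inv\<^bsub>k\<^esub> ?u \<odot>\<^bsub>A\<^esub> (?u \<odot>\<^bsub>A\<^esub> d)" 
      using d(1) R.Units_closed[OF u] R.Units_inv_closed[OF u] R.Units_l_inv[OF u]
      by (simp add: smult_assoc1[symmetric])
    also have "\<dots> = \<zero>\<^bsub>A\<^esub>" using u \<open>?u \<odot>\<^bsub>A\<^esub> d = \<zero>\<^bsub>A\<^esub>\<close> by simp
    finally show False using d(2) by simp
  qed
  define g where "g = c \<odot>\<^bsub>A\<^esub> d"
  have gc: "g \<in> carrier A" using c d by (simp add: g_def)
  have "comult A g = c \<odot>\<^bsub>AA.T\<^esub> AA.TS [(g, d)]"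
    using comult_smult[OF c(1) d(1)] by (simp add: g_def \<Delta>)
  also have "\<dots> = AA.TS [(g, g)]"
    using AA.tensor_smult[of "[(g, d)]" c] gc c d(1)
    by (simp, intro AA.tensor_sum_eqI) (auto simp: g_def R.m_ac)
  finally have "g \<in> G"
    using gc counit_smult[OF c(1) d(1)] ce by (simp add: grouplikes_def pure_tensor_def g_def)
  moreover have "r \<odot>\<^bsub>A\<^esub> d = (r \<otimes>\<^bsub>k\<^esub> counit A d) \<odot>\<^bsub>A\<^esub> g" if "r \<in> carrier k" for r
  proof -
    have "(r \<otimes>\<^bsub>k\<^esub> counit A d) \<odot>\<^bsub>A\<^esub> g = (r \<otimes>\<^bsub>k\<^esub> (c \<otimes>\<^bsub>k\<^esub> counit A d)) \<odot>\<^bsub>A\<^esub> d"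
      unfolding g_def using that c e d(1) by (simp add: smult_assoc1[symmetric] R.m_ac)
    then show ?thesis using ce that by simp
  qed
  then have "D \<subseteq> {r \<odot>\<^bsub>A\<^esub> g | r. r \<in> carrier k}" using d(3) e by blast
  ultimately show thesis using that by blast
qed

lemma grouplike_simple:
  assumes g: "g \<in> G"
  shows "simple_subcoalgebra k A {r \<odot>\<^bsub>A\<^esub> g | r. r \<in> carrier k}" (is "simple_subcoalgebra k A ?D")
proof -
  note gD = grouplikeD[OF g]
  have "submodule (add_line k A {\<zero>\<^bsub>A\<^esub>} g) k A" by (rule submodule_add_line[OF submodule_zero gD(1)])
  moreover have "add_line k A {\<zero>\<^bsub>A\<^esub>} g = ?D" using gD(1) by (force simp: add_line_def)
  ultimately have D: "submodule ?D k A" by simp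
  have gmem: "g \<in> ?D" using gD(1) by (auto intro!: exI[of _ "\<one>\<^bsub>k\<^esub>"])
  have "comult A (r \<odot>\<^bsub>A\<^esub> g) \<in> tensor_subspace k A A ?D ?D" if r: "r \<in> carrier k" for r
  proof -
    have "comult A (r \<odot>\<^bsub>A\<^esub> g) = AA.TS [(r \<odot>\<^bsub>A\<^esub> g, g)]"
      using comult_smult[OF r gD(1)] AA.tensor_smult[of "[(g, g)]" r] gD r by simp
    then show ?thesis
      unfolding tensor_subspace_def using gmem r by (intro CollectI exI[of _ "[(r \<odot>\<^bsub>A\<^esub> g, g)]"]) auto
  qed
  then have sub: "subcoalgebra k A ?D" using D by (auto simp: subcoalgebra_def)
  have "g \<noteq> \<zero>\<^bsub>A\<^esub>" using gD(3) dual_zero[OF counit_dual] by auto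
  moreover have "E = ?D" if E: "subcoalgebra k A E" "E \<subseteq> ?D" "E \<noteq> {\<zero>\<^bsub>A\<^esub>}" for E
  proof -
    have Es: "submodule E k A" using E by (simp add: subcoalgebra_def)
    obtain x where x: "x \<in> E" "x \<noteq> \<zero>\<^bsub>A\<^esub>" using E(3) submodule_zero_mem[OF Es] by blast
    then obtain r where r: "x = r \<odot>\<^bsub>A\<^esub> g" "r \<in> carrier k" using E(2) by auto
    then have "r \<noteq> \<zero>\<^bsub>k\<^esub>" using x gD(1) by auto
    then have u: "r \<in> Units k" using r by (simp add: field_Units)
    have "inv\<^bsub>k\<^esub> r \<odot>\<^bsub>A\<^esub> x = g" using r u gD(1) by (simp add: smult_assoc1[symmetric])
    then have "g \<in> E" using submoduleE(4)[OF Es _ x(1), of "inv\<^bsub>k\<^esub> r"] u by simp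
    then have "?D \<subseteq> E" using submoduleE(4)[OF Es] by auto
    then show ?thesis using E(2) by auto
  qed
  ultimately show ?thesis
    unfolding simple_subcoalgebra_def using sub gmem by blast
qed

lemma grouplike_coradical: "g \<in> G \<Longrightarrow> g \<in> coradical k A"
  using simple_subcoalgebra_subset[OF grouplike_simple] grouplikeD(1)
  by (fastforce intro!: exI[of _ "\<one>\<^bsub>k\<^esub>"])

text \<open>Pointedness in the form in which it is applied: B_0 is spanned by G, so a linear
  condition on B_0 is checked on group-likes.\<close>

lemma coradical_induct:
  assumes "pointed k A" and X: "submodule X k A" and "G \<subseteq> X"
  shows "coradical k A \<subseteq> X"
  unfolding coradical_def
proof (rule linear_span_minimal[OF X])
  show "\<Union>{D. simple_subcoalgebra k A D} \<subseteq> X"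
  proof
    fix x assume "x \<in> \<Union>{D. simple_subcoalgebra k A D}"
    then obtain D where D: "simple_subcoalgebra k A D" "x \<in> D" by auto
    obtain g where "g \<in> G" "D \<subseteq> {r \<odot>\<^bsub>A\<^esub> g | r. r \<in> carrier k}"
      by (rule simple_subcoalgebra_grouplike[OF assms(1) D(1)])
    then obtain r where r: "g \<in> G" "x = r \<odot>\<^bsub>A\<^esub> g" "r \<in> carrier k" using D(2) by blast
    have "g \<in> X" using r(1) assms(3) by blast
    then show "x \<in> X" unfolding r(2) by (rule submoduleE(4)[OF X r(3)])
  qed
qed

end

section \<open>Products and brackets in the coradical filtration\<close>

locale pointed_poisson_hopf = poisson_hopf_algebra k B
  for k :: "('k, 'r) ring_scheme" and B :: "('k, 'b, 'm) poisson_hopf_scheme" +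
  assumes pointed: "pointed k B"
    and grouplike_bracket: "\<lbrakk>g \<in> grouplikes k B; t \<in> grouplikes k B\<rbrakk> \<Longrightarrow> bracket B g t = \<zero>\<^bsub>B\<^esub>"
begin

lemma filt_comultE:
  assumes "x \<in> filt n"
  obtains ws where "\<And>i a b. (i, a, b) \<in> set ws \<Longrightarrow> i \<le> n \<and> a \<in> filt i \<and> b \<in> filt (n - i)"
    "set (map (\<lambda>(i, a, b). (a, b)) ws) \<subseteq> AA.pairs"
    "comult B x = AA.TS (map (\<lambda>(i, a, b). (a, b)) ws)"
proof -
  obtain ws where "\<forall>(i, a, b)\<in>set ws. i \<le> n \<and> a \<in> filt i \<and> b \<in> filt (n - i)"
    "comult B x = AA.TS (map (\<lambda>(i, a, b). (a, b)) ws)"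
    using comult_filt[OF assms] by blast
  then show thesis using that[of ws] filt_closed by fastforce
qed

lemma filt_zero_mem [simp]: "\<zero>\<^bsub>B\<^esub> \<in> filt n"
  by (rule submodule_zero_mem[OF submodule_filt])

text \<open>A product of group-likes is group-like, and \<open>coradical_induct\<close> extends this
  linearly in the right factor and then in the left one.\<close>

lemma filt_0_mult:
  assumes x: "x \<in> filt 0" and y: "y \<in> filt 0"
  shows "x \<otimes>\<^bsub>B\<^esub> y \<in> filt 0"
proof -
  note S = submodule_filt[of 0]
  have gg: "g \<otimes>\<^bsub>B\<^esub> t \<in> filt 0" if g: "g \<in> G" and t: "t \<in> G" for g t
  proof -
    have c: "g \<in> carrier B" "t \<in> carrier B" using g t grouplikeD(1) by blast+
    have "comult B (g \<otimes>\<^bsub>B\<^esub> t) = AA.TS [(g \<otimes>\<^bsub>B\<^esub> t, g \<otimes>\<^bsub>B\<^esub> t)]"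
    proof (rule AA.tensor_ext)
      fix f f' assume f: "f \<in> dual k B" "f' \<in> dual k B"
      have "conv k B f f' (g \<otimes>\<^bsub>B\<^esub> t) = lsum k (\<lambda>a b. pairing k (\<lambda>c. f (a \<otimes>\<^bsub>B\<^esub> c)) (\<lambda>d. f' (b \<otimes>\<^bsub>B\<^esub> d)) [(t, t)]) [(g, g)]"
        by (rule conv_mult[OF f c _ grouplikeD(2)[OF g] _ grouplikeD(2)[OF t]]) (use c in auto)
      then show "tensor_pairing k f f' (comult B (g \<otimes>\<^bsub>B\<^esub> t)) =
          tensor_pairing k f f' (AA.TS [(g \<otimes>\<^bsub>B\<^esub> t, g \<otimes>\<^bsub>B\<^esub> t)])"
        using f c by (simp add: conv_def)
    qed (use c comult_closed in auto)
    then have "g \<otimes>\<^bsub>B\<^esub> t \<in> G"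
      using c counit_mult[OF c] grouplikeD(3)[OF g] grouplikeD(3)[OF t]
      by (simp add: grouplikes_def pure_tensor_def)
    then show ?thesis using grouplike_coradical by simp
  qed
  have gy: "g \<otimes>\<^bsub>B\<^esub> y \<in> filt 0" if g: "g \<in> G" for g
  proof -
    have c: "g \<in> carrier B" using g grouplikeD(1) by blast
    have "submodule {y \<in> carrier B. g \<otimes>\<^bsub>B\<^esub> y \<in> filt 0} k B"
      by (rule submoduleI)
        (use c submoduleE(3-5)[OF S] in \<open>auto simp: r_distr smult_mult_right r_minus simp del: coradical_filt.simps\<close>)
    then show ?thesis using coradical_induct[OF pointed] gg[OF g] grouplikeD(1) y by fastforce
  qed
  have c: "y \<in> carrier B" using y filt_closed by blast
  have "submodule {x \<in> carrier B. x \<otimes>\<^bsub>B\<^esub> y \<in> filt 0} k B"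
    by (rule submoduleI)
      (use c submoduleE(3-5)[OF S] in \<open>auto simp: l_distr smult_assoc2 l_minus simp del: coradical_filt.simps\<close>)
  then show ?thesis using coradical_induct[OF pointed] gy grouplikeD(1) x by fastforce
qed

lemma bracket_kernel_submodule:
  assumes "X \<subseteq> carrier B"
  shows "submodule {y \<in> carrier B. \<forall>x\<in>X. bracket B x y = \<zero>\<^bsub>B\<^esub>} k B"
proof (rule submoduleI)
  have xz: "bracket B x \<zero>\<^bsub>B\<^esub> = \<zero>\<^bsub>B\<^esub>" if "x \<in> carrier B" for x
    using bracket_smult_right[of "\<zero>\<^bsub>k\<^esub>" x "\<zero>\<^bsub>B\<^esub>"] that bracket_closed by simp
  then show "\<zero>\<^bsub>B\<^esub> \<in> {y \<in> carrier B. \<forall>x\<in>X. bracket B x y = \<zero>\<^bsub>B\<^esub>}" using assms by auto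
  fix a assume a: "a \<in> {y \<in> carrier B. \<forall>x\<in>X. bracket B x y = \<zero>\<^bsub>B\<^esub>}"
  have "bracket B x (\<ominus>\<^bsub>B\<^esub> a) = \<zero>\<^bsub>B\<^esub>" if "x \<in> X" for x
  proof -
    have c: "x \<in> carrier B" "a \<in> carrier B" "bracket B x a = \<zero>\<^bsub>B\<^esub>" using a that assms by auto
    have "bracket B x (a \<oplus>\<^bsub>B\<^esub> \<ominus>\<^bsub>B\<^esub> a) = bracket B x a \<oplus>\<^bsub>B\<^esub> bracket B x (\<ominus>\<^bsub>B\<^esub> a)"
      using c by (intro bracket_add_right) auto
    then show ?thesis using c xz bracket_closed[of x "\<ominus>\<^bsub>B\<^esub> a"] by (simp add: M.r_neg)
  qed
  then show "\<ominus>\<^bsub>B\<^esub> a \<in> {y \<in> carrier B. \<forall>x\<in>X. bracket B x y = \<zero>\<^bsub>B\<^esub>}" using a by auto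
qed (use assms in \<open>auto simp: bracket_add_right bracket_smult_right subset_iff\<close>)

lemma bracket_minus_swap:
  assumes "x \<in> carrier B" "y \<in> carrier B" "bracket B x y = \<zero>\<^bsub>B\<^esub>"
  shows "bracket B y x = \<zero>\<^bsub>B\<^esub>"
proof -
  have "bracket B (x \<oplus>\<^bsub>B\<^esub> y) (x \<oplus>\<^bsub>B\<^esub> y) = bracket B y x"
    using assms bracket_alternating[of x] bracket_alternating[of y]
    by (simp add: bracket_add_left bracket_add_right bracket_closed)
  then show ?thesis using assms bracket_alternating[of "x \<oplus>\<^bsub>B\<^esub> y"] by simp
qed

text \<open>The hypothesis on G, extended bilinearly; antisymmetry exchanges the arguments between
  the two extensions.\<close>

lemma filt_0_bracket:
  assumes x: "x \<in> filt 0" and y: "y \<in> filt 0"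
  shows "bracket B x y = \<zero>\<^bsub>B\<^esub>"
proof -
  have Gc: "G \<subseteq> carrier B" using grouplikeD(1) by blast
  have gy: "bracket B g z = \<zero>\<^bsub>B\<^esub>" if "g \<in> G" "z \<in> filt 0" for g z
    using coradical_induct[OF pointed bracket_kernel_submodule[OF Gc]] grouplike_bracket Gc that by auto
  have "filt 0 \<subseteq> carrier B" using filt_closed by blast
  note sub = bracket_kernel_submodule[OF this]
  have "G \<subseteq> {y \<in> carrier B. \<forall>x\<in>filt 0. bracket B x y = \<zero>\<^bsub>B\<^esub>}"
    using gy Gc bracket_minus_swap filt_closed by blast
  then show ?thesis using coradical_induct[OF pointed sub] x y by auto
qed

text \<open>Product and bracket are treated together because \<Delta>({x, y}) contains products as
  well as brackets of the factors. For i + j = m + 1 the criterion \<open>filt_Suc\<close> asks to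
  test against f killing B_0 and g killing B_m.\<close>

lemma filt_mult_bracket:
  "x \<in> filt i \<Longrightarrow> y \<in> filt j \<Longrightarrow> x \<otimes>\<^bsub>B\<^esub> y \<in> filt (i + j) \<and> bracket B x y \<in> filt (i + j)"
proof (induction "i + j" arbitrary: i j x y rule: less_induct)
  case less
  have xy: "x \<in> carrier B" "y \<in> carrier B" using less.prems filt_closed by blast+
  show ?case
  proof (cases "i + j")
    case 0
    then show ?thesis using less.prems filt_0_mult[of x y] filt_0_bracket[of x y] filt_zero_mem[of 0] by auto
  next
    case (Suc m)
    obtain ws where ws: "\<And>p a b. (p, a, b) \<in> set ws \<Longrightarrow> p \<le> i \<and> a \<in> filt p \<and> b \<in> filt (i - p)"
      "set (map (\<lambda>(i, a, b). (a, b)) ws) \<subseteq> AA.pairs"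
      "comult B x = AA.TS (map (\<lambda>(i, a, b). (a, b)) ws)"
      using less.prems(1) by (rule filt_comultE) blast
    obtain vs where vs: "\<And>p a b. (p, a, b) \<in> set vs \<Longrightarrow> p \<le> j \<and> a \<in> filt p \<and> b \<in> filt (j - p)"
      "set (map (\<lambda>(i, a, b). (a, b)) vs) \<subseteq> AA.pairs"
      "comult B y = AA.TS (map (\<lambda>(i, a, b). (a, b)) vs)"
      using less.prems(2) by (rule filt_comultE) blast
    let ?xs = "map (\<lambda>(i, a, b). (a, b)) ws" and ?ys = "map (\<lambda>(i, a, b). (a, b)) vs"
    \<comment> \<open>Let a, c have degrees p, q; then b, d have degrees i - p, j - q. If p = q = 0,
      then ac lies in B_0 and {a, c} = 0, so f kills both. Otherwise b and d have total degree below
      i + j, and by induction bd and {b, d} lie in B_m, where g vanishes.\<close>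
    have key: "f (a \<otimes>\<^bsub>B\<^esub> c) = \<zero>\<^bsub>k\<^esub> \<and> f (bracket B a c) = \<zero>\<^bsub>k\<^esub> \<and> bracket B a c \<in> carrier B \<or>
        g (b \<otimes>\<^bsub>B\<^esub> d) = \<zero>\<^bsub>k\<^esub> \<and> g (bracket B b d) = \<zero>\<^bsub>k\<^esub>"
      if f: "f \<in> annihilator k B (filt 0)" and g: "g \<in> annihilator k B (filt m)"
        and ab: "(a, b) \<in> set ?xs" and cd: "(c, d) \<in> set ?ys" for f g a b c d
    proof -
      obtain p q where pq: "(p, a, b) \<in> set ws" "(q, c, d) \<in> set vs" using ab cd by auto
      note w = ws(1)[OF pq(1)] vs(1)[OF pq(2)]
      show ?thesis
      proof (cases "p + q = 0")
        case True
        then have "a \<in> filt 0" "c \<in> filt 0" using w by auto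
        then have "a \<otimes>\<^bsub>B\<^esub> c \<in> filt 0" "bracket B a c = \<zero>\<^bsub>B\<^esub>"
          using filt_0_mult filt_0_bracket by blast+
        then show ?thesis using annihilatorD(2)[OF f] dual_zero[OF annihilatorD(1)[OF f]] by simp
      next
        case False
        then have lt: "(i - p) + (j - q) < i + j" using w by auto
        then have "b \<otimes>\<^bsub>B\<^esub> d \<in> filt ((i - p) + (j - q))" "bracket B b d \<in> filt ((i - p) + (j - q))"
          using less.hyps[OF lt] w by blast+
        moreover have "filt ((i - p) + (j - q)) \<subseteq> filt m" using lt Suc by (intro filt_mono) simp
        ultimately show ?thesis using annihilatorD(2)[OF g] by blast
      qed
    qed
    have "conv k B f g (x \<otimes>\<^bsub>B\<^esub> y) = \<zero>\<^bsub>k\<^esub> \<and> conv k B f g (bracket B x y) = \<zero>\<^bsub>k\<^esub>"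
      if f: "f \<in> annihilator k B (filt 0)" and g: "g \<in> annihilator k B (filt m)" for f g
    proof -
      have fg: "f \<in> dual k B" "g \<in> dual k B" using f g by (auto dest: annihilatorD(1))
      have z: "f (a \<otimes>\<^bsub>B\<^esub> c) \<otimes>\<^bsub>k\<^esub> g (b \<otimes>\<^bsub>B\<^esub> d) = \<zero>\<^bsub>k\<^esub>"
        "f (a \<otimes>\<^bsub>B\<^esub> c) \<otimes>\<^bsub>k\<^esub> g (bracket B b d) = \<zero>\<^bsub>k\<^esub>"
        "f (bracket B a c) \<otimes>\<^bsub>k\<^esub> g (b \<otimes>\<^bsub>B\<^esub> d) = \<zero>\<^bsub>k\<^esub>"
        if ab: "(a, b) \<in> set ?xs" and cd: "(c, d) \<in> set ?ys" for a b c d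
      proof -
        have c: "a \<in> carrier B" "b \<in> carrier B" "c \<in> carrier B" "d \<in> carrier B"
          using ab cd ws(2) vs(2) by blast+
        have "f (a \<otimes>\<^bsub>B\<^esub> c) \<in> carrier k" "f (bracket B a c) \<in> carrier k"
          "g (b \<otimes>\<^bsub>B\<^esub> d) \<in> carrier k" "g (bracket B b d) \<in> carrier k"
          using c fg bracket_closed by auto
        then show "f (a \<otimes>\<^bsub>B\<^esub> c) \<otimes>\<^bsub>k\<^esub> g (b \<otimes>\<^bsub>B\<^esub> d) = \<zero>\<^bsub>k\<^esub>"
          "f (a \<otimes>\<^bsub>B\<^esub> c) \<otimes>\<^bsub>k\<^esub> g (bracket B b d) = \<zero>\<^bsub>k\<^esub>"
          "f (bracket B a c) \<otimes>\<^bsub>k\<^esub> g (b \<otimes>\<^bsub>B\<^esub> d) = \<zero>\<^bsub>k\<^esub>"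
          using key[OF f g ab cd] by auto
      qed
      have "lsum k (\<lambda>a b. pairing k (\<lambda>c. f (a \<otimes>\<^bsub>B\<^esub> c)) (\<lambda>d. g (b \<otimes>\<^bsub>B\<^esub> d)) ?ys) ?xs = \<zero>\<^bsub>k\<^esub>"
        unfolding pairing_def by (intro R.lsum_zero z)
      moreover have "lsum k (\<lambda>a b. pairing k (\<lambda>c. f (a \<otimes>\<^bsub>B\<^esub> c)) (\<lambda>d. g (bracket B b d)) ?ys \<oplus>\<^bsub>k\<^esub>
          pairing k (\<lambda>c. f (bracket B a c)) (\<lambda>d. g (b \<otimes>\<^bsub>B\<^esub> d)) ?ys) ?xs = \<zero>\<^bsub>k\<^esub>"
      proof (rule R.lsum_zero)
        fix a b assume ab: "(a, b) \<in> set ?xs"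
        have "pairing k (\<lambda>c. f (a \<otimes>\<^bsub>B\<^esub> c)) (\<lambda>d. g (bracket B b d)) ?ys = \<zero>\<^bsub>k\<^esub>"
          "pairing k (\<lambda>c. f (bracket B a c)) (\<lambda>d. g (b \<otimes>\<^bsub>B\<^esub> d)) ?ys = \<zero>\<^bsub>k\<^esub>"
          unfolding pairing_def by (intro R.lsum_zero z ab; assumption)+
        then show "pairing k (\<lambda>c. f (a \<otimes>\<^bsub>B\<^esub> c)) (\<lambda>d. g (bracket B b d)) ?ys \<oplus>\<^bsub>k\<^esub>
          pairing k (\<lambda>c. f (bracket B a c)) (\<lambda>d. g (b \<otimes>\<^bsub>B\<^esub> d)) ?ys = \<zero>\<^bsub>k\<^esub>" by simp
      qed
      ultimately show ?thesis
        using conv_mult[OF fg xy ws(2,3) vs(2,3)] conv_bracket[OF fg xy ws(2,3) vs(2,3)] by simp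
    qed
    then show ?thesis
      unfolding Suc filt_Suc using xy bracket_closed by simp
  qed
qed

lemma filt_mult: "x \<in> filt i \<Longrightarrow> y \<in> filt j \<Longrightarrow> x \<otimes>\<^bsub>B\<^esub> y \<in> filt (i + j)"
  and filt_bracket: "x \<in> filt i \<Longrightarrow> y \<in> filt j \<Longrightarrow> bracket B x y \<in> filt (i + j)"
  using filt_mult_bracket by blast+

section \<open>The subspaces B_{n-1}, with B_{-1} = 0\<close>

definition lower :: "nat \<Rightarrow> 'b set"
  where "lower n = (case n of 0 \<Rightarrow> {\<zero>\<^bsub>B\<^esub>} | Suc m \<Rightarrow> filt m)"

lemma submodule_lower: "submodule (lower n) k B"
  by (cases n) (simp_all add: lower_def submodule_zero submodule_filt del: coradical_filt.simps)

lemma lower_subset_filt: "lower n \<subseteq> filt n"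
  using filt_mono_Suc filt_zero_mem[of 0] by (cases n) (simp_all add: lower_def)

lemma lower_closed: "x \<in> lower n \<Longrightarrow> x \<in> carrier B"
  using lower_subset_filt filt_closed by blast

lemma filt_subset_lower: "i < j \<Longrightarrow> filt i \<subseteq> lower j"
  using filt_mono[of i "j - 1"] by (cases j) (simp_all add: lower_def del: coradical_filt.simps)

lemma bracket_zero [simp]:
  assumes "x \<in> carrier B"
  shows "bracket B x \<zero>\<^bsub>B\<^esub> = \<zero>\<^bsub>B\<^esub>" "bracket B \<zero>\<^bsub>B\<^esub> x = \<zero>\<^bsub>B\<^esub>"
  using bracket_smult_right[of "\<zero>\<^bsub>k\<^esub>" x "\<zero>\<^bsub>B\<^esub>"] bracket_smult_left[of "\<zero>\<^bsub>k\<^esub>" "\<zero>\<^bsub>B\<^esub>" x] assms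
    bracket_closed by simp_all

text \<open>This and its mirror image are the reason why products and brackets pass to classes. For
  j = 0 the factor y is 0; otherwise it has degree j - 1 and \<open>filt_mult_bracket\<close>
  applies.\<close>

lemma lower_mult_bracket_right:
  assumes x: "x \<in> filt i" and y: "y \<in> lower j"
  shows "x \<otimes>\<^bsub>B\<^esub> y \<in> lower (i + j)" "bracket B x y \<in> lower (i + j)"
proof -
  have "x \<otimes>\<^bsub>B\<^esub> y \<in> lower (i + j) \<and> bracket B x y \<in> lower (i + j)"
  proof (cases j)
    case 0
    then show ?thesis
      using x y filt_closed[OF x] submodule_zero_mem[OF submodule_lower] by (simp add: lower_def)
  next
    case (Suc m)
    then show ?thesis using filt_mult_bracket[of x i y m] x y by (simp add: lower_def)
  qed
  then show "x \<otimes>\<^bsub>B\<^esub> y \<in> lower (i + j)" "bracket B x y \<in> lower (i + j)" by auto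
qed

lemma lower_mult_bracket_left:
  assumes x: "x \<in> lower i" and y: "y \<in> filt j"
  shows "x \<otimes>\<^bsub>B\<^esub> y \<in> lower (i + j)" "bracket B x y \<in> lower (i + j)"
proof -
  have "x \<otimes>\<^bsub>B\<^esub> y \<in> lower (i + j) \<and> bracket B x y \<in> lower (i + j)"
  proof (cases i)
    case 0
    then show ?thesis
      using x y filt_closed[OF y] submodule_zero_mem[OF submodule_lower] by (simp add: lower_def)
  next
    case (Suc m)
    then show ?thesis using filt_mult_bracket[of x m y j] x y by (simp add: lower_def)
  qed
  then show "x \<otimes>\<^bsub>B\<^esub> y \<in> lower (i + j)" "bracket B x y \<in> lower (i + j)" by auto
qed

lemma conv_lower:
  assumes "x \<in> lower n" "f \<in> annihilator k B (lower n)" "g \<in> dual k B"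
  shows "conv k B f g x = \<zero>\<^bsub>k\<^esub>"
proof (cases n)
  case 0
  then show ?thesis using assms by (simp add: lower_def dual_zero[OF conv_dual] annihilatorD(1))
next
  case (Suc m)
  then show ?thesis using assms filt_coideal_left by (simp add: lower_def)
qed

section \<open>Coinvariants modulo lower degree\<close>

text \<open>\<open>coinv h n x\<close> says that \<open>\<Delta>(x) - x \<otimes> h\<close> lies in \<open>B\<^sub>n\<^sub>-\<^sub>1 \<otimes> B\<close>, that is, the class
  \<open>c\<close> of \<open>x\<close> in \<open>C(n)\<close> satisfies \<open>(id \<otimes> \<pi>)\<Delta>(c) = c \<otimes> h\<close>.\<close>

definition coinv :: "'b \<Rightarrow> nat \<Rightarrow> 'b \<Rightarrow> bool"
  where "coinv h n x \<longleftrightarrow> x \<in> filt n \<and>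
    (\<forall>f\<in>annihilator k B (lower n). \<forall>g\<in>dual k B. conv k B f g x = f x \<otimes>\<^bsub>k\<^esub> g h)"

text \<open>Both sides vanish, whatever h is. Together with \<open>submodule_coinv\<close> this
  makes the condition independent of the representative of a class in C(n).\<close>

lemma coinv_lower: "h \<in> carrier B \<Longrightarrow> x \<in> lower n \<Longrightarrow> coinv h n x"
  unfolding coinv_def
proof (intro conjI ballI)
  fix f g assume h: "h \<in> carrier B" and x: "x \<in> lower n"
    and f: "f \<in> annihilator k B (lower n)" and g: "g \<in> dual k B"
  show "conv k B f g x = f x \<otimes>\<^bsub>k\<^esub> g h"
    using conv_lower[OF x f g] annihilatorD(2)[OF f x] g h by simp
qed (use lower_subset_filt in blast)

lemma coinv_grouplike:
  assumes g: "g \<in> G"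
  shows "coinv g 0 g"
  unfolding coinv_def
proof (intro conjI ballI)
  show "g \<in> filt 0" using grouplike_coradical[OF g] by simp
  show "conv k B f f' g = f g \<otimes>\<^bsub>k\<^esub> f' g"
    if "f \<in> annihilator k B (lower 0)" "f' \<in> dual k B" for f f'
    using conv_grouplike[OF g annihilatorD(1)[OF that(1)] that(2)] .
qed

lemma submodule_coinv:
  assumes h: "h \<in> carrier B"
  shows "submodule {x. coinv h n x} k B"
proof (rule submoduleI)
  show "{x. coinv h n x} \<subseteq> carrier B" using filt_closed by (auto simp: coinv_def)
  show "\<zero>\<^bsub>B\<^esub> \<in> {x. coinv h n x}" using coinv_lower[OF h submodule_zero_mem[OF submodule_lower]] by simp
  fix x assume "x \<in> {x. coinv h n x}"
  then have x: "x \<in> filt n" "x \<in> carrier B"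
    "\<And>f g. f \<in> annihilator k B (lower n) \<Longrightarrow> g \<in> dual k B \<Longrightarrow> conv k B f g x = f x \<otimes>\<^bsub>k\<^esub> g h"
    using filt_closed by (auto simp: coinv_def)
  show "\<ominus>\<^bsub>B\<^esub> x \<in> {x. coinv h n x}"
    using x submoduleE(3)[OF submodule_filt x(1)] h
    by (auto simp: coinv_def dual_minus[OF conv_dual] annihilatorD(1) R.l_minus simp del: coradical_filt.simps)
  show "r \<odot>\<^bsub>B\<^esub> x \<in> {x. coinv h n x}" if r: "r \<in> carrier k" for r
    using x submoduleE(4)[OF submodule_filt r x(1)] h r
    by (auto simp: coinv_def dual_smult[OF conv_dual] annihilatorD(1) R.m_assoc simp del: coradical_filt.simps)
  fix y assume "y \<in> {x. coinv h n x}"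
  then have y: "y \<in> filt n" "y \<in> carrier B"
    "\<And>f g. f \<in> annihilator k B (lower n) \<Longrightarrow> g \<in> dual k B \<Longrightarrow> conv k B f g y = f y \<otimes>\<^bsub>k\<^esub> g h"
    using filt_closed by (auto simp: coinv_def)
  show "x \<oplus>\<^bsub>B\<^esub> y \<in> {x. coinv h n x}"
    using x y submoduleE(5)[OF submodule_filt x(1) y(1)] h
    by (auto simp: coinv_def dual_add[OF conv_dual] annihilatorD(1) R.l_distr simp del: coradical_filt.simps)
qed

lemma annihilator_comp:
  assumes "f \<in> annihilator k B Y" "linear_map k B B p" "\<And>x. x \<in> X \<Longrightarrow> p x \<in> Y"
  shows "(\<lambda>x. f (p x)) \<in> annihilator k B X"
  using dual_comp[OF assms(2) annihilatorD(1)[OF assms(1)]] assms(1,3) by (simp add: annihilator_def)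

text \<open>For the coinvariants it is the degree of the left entries that counts: if a lies in
  \<open>filt n\<close>, then translating an annihilator of \<open>lower (n + m)\<close> by a gives
  an annihilator of \<open>lower m\<close>.\<close>

lemma filt_comult_leftE:
  assumes "x \<in> filt n"
  obtains xs where "set xs \<subseteq> filt n \<times> carrier B" "comult B x = AA.TS xs"
proof -
  obtain ws where ws: "\<And>i a b. (i, a, b) \<in> set ws \<Longrightarrow> i \<le> n \<and> a \<in> filt i \<and> b \<in> filt (n - i)"
    "set (map (\<lambda>(i, a, b). (a, b)) ws) \<subseteq> AA.pairs"
    "comult B x = AA.TS (map (\<lambda>(i, a, b). (a, b)) ws)"
    using assms by (rule filt_comultE) blast
  have "set (map (\<lambda>(i, a, b). (a, b)) ws) \<subseteq> filt n \<times> carrier B"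
  proof clarify
    fix a b assume "(a, b) \<in> set (map (\<lambda>(i, a, b). (a, b)) ws)"
    then obtain i where "(i, a, b) \<in> set ws" by auto
    from ws(1)[OF this] have "a \<in> filt i" "i \<le> n" "b \<in> filt (n - i)" by auto
    then show "a \<in> filt n \<and> b \<in> carrier B" using filt_mono filt_closed by blast
  qed
  then show thesis using that ws(3) by blast
qed

text \<open>Coinvariance is applied twice: that of y to the inner sum for each term a \<otimes> b of
  \<Delta>(x), replacing c \<otimes> d by y \<otimes> l, and then that of x to what remains. The
  translated functionals on the left stay in the required annihilators because lower terms multiply
  into lower terms.\<close>

lemma coinv_mult:
  assumes h: "h \<in> carrier B" and l: "l \<in> carrier B" and x: "coinv h n x" and y: "coinv l m y"
  shows "coinv (h \<otimes>\<^bsub>B\<^esub> l) (n + m) (x \<otimes>\<^bsub>B\<^esub> y)"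
  unfolding coinv_def
proof (intro conjI ballI)
  have xf: "x \<in> filt n" and yf: "y \<in> filt m" using x y by (auto simp: coinv_def)
  then show "x \<otimes>\<^bsub>B\<^esub> y \<in> filt (n + m)" by (rule filt_mult)
  have xc: "x \<in> carrier B" and yc: "y \<in> carrier B" using xf yf filt_closed by blast+
  fix f g assume f: "f \<in> annihilator k B (lower (n + m))" and g: "g \<in> dual k B"
  obtain xs where xs: "set xs \<subseteq> filt n \<times> carrier B" "comult B x = AA.TS xs"
    using xf by (rule filt_comult_leftE)
  have xs': "set xs \<subseteq> AA.pairs" using xs(1) filt_closed by blast
  obtain ys where ys: "set ys \<subseteq> AA.pairs" "comult B y = AA.TS ys" using yc by (rule comultE)
  have "conv k B f g (x \<otimes>\<^bsub>B\<^esub> y) = lsum k (\<lambda>a b. pairing k (\<lambda>c. f (a \<otimes>\<^bsub>B\<^esub> c)) (\<lambda>d. g (b \<otimes>\<^bsub>B\<^esub> d)) ys) xs"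
    by (rule conv_mult[OF annihilatorD(1)[OF f] g xc yc xs' xs(2) ys])
  also have "\<dots> = lsum k (\<lambda>a b. f (a \<otimes>\<^bsub>B\<^esub> y) \<otimes>\<^bsub>k\<^esub> g (b \<otimes>\<^bsub>B\<^esub> l)) xs"
  proof (rule lsum_cong)
    fix a b assume "(a, b) \<in> set xs"
    then have ab: "a \<in> filt n" "a \<in> carrier B" "b \<in> carrier B" using xs(1) xs' by auto
    have "(\<lambda>c. f (a \<otimes>\<^bsub>B\<^esub> c)) \<in> annihilator k B (lower m)" "(\<lambda>d. g (b \<otimes>\<^bsub>B\<^esub> d)) \<in> dual k B"
      using annihilator_comp[OF f mult_linear_right[OF ab(2)] lower_mult_bracket_right(1)[OF ab(1)]]
        dual_comp[OF mult_linear_right[OF ab(3)] g] by blast+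
    then show "pairing k (\<lambda>c. f (a \<otimes>\<^bsub>B\<^esub> c)) (\<lambda>d. g (b \<otimes>\<^bsub>B\<^esub> d)) ys = f (a \<otimes>\<^bsub>B\<^esub> y) \<otimes>\<^bsub>k\<^esub> g (b \<otimes>\<^bsub>B\<^esub> l)"
      using y conv_sum[OF annihilatorD(1) _ ys] unfolding coinv_def by metis
  qed
  also have "\<dots> = pairing k (\<lambda>a. f (a \<otimes>\<^bsub>B\<^esub> y)) (\<lambda>b. g (b \<otimes>\<^bsub>B\<^esub> l)) xs"
    by (simp add: pairing_def)
  also have "\<dots> = f (x \<otimes>\<^bsub>B\<^esub> y) \<otimes>\<^bsub>k\<^esub> g (h \<otimes>\<^bsub>B\<^esub> l)"
  proof -
    have "(\<lambda>a. f (a \<otimes>\<^bsub>B\<^esub> y)) \<in> annihilator k B (lower n)" "(\<lambda>b. g (b \<otimes>\<^bsub>B\<^esub> l)) \<in> dual k B"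
      using annihilator_comp[OF f mult_linear_left[OF yc] lower_mult_bracket_left(1)[OF _ yf]]
        dual_comp[OF mult_linear_left[OF l] g] by blast+
    then show ?thesis using x conv_sum[OF annihilatorD(1) _ xs' xs(2)] unfolding coinv_def by metis
  qed
  finally show "conv k B f g (x \<otimes>\<^bsub>B\<^esub> y) = f (x \<otimes>\<^bsub>B\<^esub> y) \<otimes>\<^bsub>k\<^esub> g (h \<otimes>\<^bsub>B\<^esub> l)" .
qed

text \<open>The argument for products, applied to both summands of \<open>conv_bracket\<close>,
  leaves f(xy) g({h, l}) + f({x, y}) g(hl). Since xy is merely in B_{n+m}, f has no reason to kill
  it, and the first summand disappears through {h, l} = 0.\<close>

lemma coinv_bracket:
  assumes h: "h \<in> carrier B" and l: "l \<in> carrier B" and hl: "bracket B h l = \<zero>\<^bsub>B\<^esub>"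
    and x: "coinv h n x" and y: "coinv l m y"
  shows "coinv (h \<otimes>\<^bsub>B\<^esub> l) (n + m) (bracket B x y)"
  unfolding coinv_def
proof (intro conjI ballI)
  have xf: "x \<in> filt n" and yf: "y \<in> filt m" using x y by (auto simp: coinv_def)
  then show "bracket B x y \<in> filt (n + m)" by (rule filt_bracket)
  have xc: "x \<in> carrier B" and yc: "y \<in> carrier B" using xf yf filt_closed by blast+
  fix f g assume f: "f \<in> annihilator k B (lower (n + m))" and g: "g \<in> dual k B"
  obtain xs where xs: "set xs \<subseteq> filt n \<times> carrier B" "comult B x = AA.TS xs"
    using xf by (rule filt_comult_leftE)
  have xs': "set xs \<subseteq> AA.pairs" using xs(1) filt_closed by blast
  obtain ys where ys: "set ys \<subseteq> AA.pairs" "comult B y = AA.TS ys" using yc by (rule comultE)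
  have coinvD: "pairing k f' g' zs = f' z \<otimes>\<^bsub>k\<^esub> g' t"
    if "coinv t i z" "f' \<in> annihilator k B (lower i)" "g' \<in> dual k B" "set zs \<subseteq> AA.pairs"
      "comult B z = AA.TS zs" for t i z f' g' zs
    using that conv_sum[OF annihilatorD(1)] unfolding coinv_def by metis
  have "conv k B f g (bracket B x y) =
      lsum k (\<lambda>a b. pairing k (\<lambda>c. f (a \<otimes>\<^bsub>B\<^esub> c)) (\<lambda>d. g (bracket B b d)) ys \<oplus>\<^bsub>k\<^esub>
        pairing k (\<lambda>c. f (bracket B a c)) (\<lambda>d. g (b \<otimes>\<^bsub>B\<^esub> d)) ys) xs"
    by (rule conv_bracket[OF annihilatorD(1)[OF f] g xc yc xs' xs(2) ys])
  also have "\<dots> = lsum k (\<lambda>a b. f (a \<otimes>\<^bsub>B\<^esub> y) \<otimes>\<^bsub>k\<^esub> g (bracket B b l) \<oplus>\<^bsub>k\<^esub>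
      f (bracket B a y) \<otimes>\<^bsub>k\<^esub> g (b \<otimes>\<^bsub>B\<^esub> l)) xs"
  proof (rule lsum_cong)
    fix a b assume "(a, b) \<in> set xs"
    then have ab: "a \<in> filt n" "a \<in> carrier B" "b \<in> carrier B" using xs(1) xs' by auto
    note am = lower_mult_bracket_right[OF ab(1)]
    have "pairing k (\<lambda>c. f (a \<otimes>\<^bsub>B\<^esub> c)) (\<lambda>d. g (bracket B b d)) ys = f (a \<otimes>\<^bsub>B\<^esub> y) \<otimes>\<^bsub>k\<^esub> g (bracket B b l)"
      by (rule coinvD[OF y annihilator_comp[OF f mult_linear_right[OF ab(2)] am(1)]
            dual_comp[OF bracket_linear_right[OF ab(3)] g] ys])
    moreover have "pairing k (\<lambda>c. f (bracket B a c)) (\<lambda>d. g (b \<otimes>\<^bsub>B\<^esub> d)) ys = f (bracket B a y) \<otimes>\<^bsub>k\<^esub> g (b \<otimes>\<^bsub>B\<^esub> l)"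
      by (rule coinvD[OF y annihilator_comp[OF f bracket_linear_right[OF ab(2)] am(2)]
            dual_comp[OF mult_linear_right[OF ab(3)] g] ys])
    ultimately show "pairing k (\<lambda>c. f (a \<otimes>\<^bsub>B\<^esub> c)) (\<lambda>d. g (bracket B b d)) ys \<oplus>\<^bsub>k\<^esub>
        pairing k (\<lambda>c. f (bracket B a c)) (\<lambda>d. g (b \<otimes>\<^bsub>B\<^esub> d)) ys =
      f (a \<otimes>\<^bsub>B\<^esub> y) \<otimes>\<^bsub>k\<^esub> g (bracket B b l) \<oplus>\<^bsub>k\<^esub> f (bracket B a y) \<otimes>\<^bsub>k\<^esub> g (b \<otimes>\<^bsub>B\<^esub> l)" by simp
  qed
  also have "\<dots> = pairing k (\<lambda>a. f (a \<otimes>\<^bsub>B\<^esub> y)) (\<lambda>b. g (bracket B b l)) xs \<oplus>\<^bsub>k\<^esub>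
      pairing k (\<lambda>a. f (bracket B a y)) (\<lambda>b. g (b \<otimes>\<^bsub>B\<^esub> l)) xs"
  proof -
    have "f (a \<otimes>\<^bsub>B\<^esub> y) \<in> carrier k" "f (bracket B a y) \<in> carrier k" "g (bracket B b l) \<in> carrier k"
      "g (b \<otimes>\<^bsub>B\<^esub> l) \<in> carrier k" if "(a, b) \<in> set xs" for a b
      using that xs' yc l annihilatorD(1)[OF f] g bracket_closed by auto
    then show ?thesis unfolding pairing_def by (intro R.lsum_add) auto
  qed
  also have "\<dots> = f (x \<otimes>\<^bsub>B\<^esub> y) \<otimes>\<^bsub>k\<^esub> g (bracket B h l) \<oplus>\<^bsub>k\<^esub> f (bracket B x y) \<otimes>\<^bsub>k\<^esub> g (h \<otimes>\<^bsub>B\<^esub> l)"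
  proof -
    note am = lower_mult_bracket_left[OF _ yf]
    have "pairing k (\<lambda>a. f (a \<otimes>\<^bsub>B\<^esub> y)) (\<lambda>b. g (bracket B b l)) xs = f (x \<otimes>\<^bsub>B\<^esub> y) \<otimes>\<^bsub>k\<^esub> g (bracket B h l)"
      by (rule coinvD[OF x annihilator_comp[OF f mult_linear_left[OF yc] am(1)]
            dual_comp[OF bracket_linear_left[OF l] g] xs' xs(2)])
    moreover have "pairing k (\<lambda>a. f (bracket B a y)) (\<lambda>b. g (b \<otimes>\<^bsub>B\<^esub> l)) xs = f (bracket B x y) \<otimes>\<^bsub>k\<^esub> g (h \<otimes>\<^bsub>B\<^esub> l)"
      by (rule coinvD[OF x annihilator_comp[OF f bracket_linear_left[OF yc] am(2)]
            dual_comp[OF mult_linear_left[OF l] g] xs' xs(2)])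
    ultimately show ?thesis by simp
  qed
  also have "\<dots> = f (bracket B x y) \<otimes>\<^bsub>k\<^esub> g (h \<otimes>\<^bsub>B\<^esub> l)"
    using hl xc yc h l annihilatorD(1)[OF f] g bracket_closed by simp
  finally show "conv k B f g (bracket B x y) = f (bracket B x y) \<otimes>\<^bsub>k\<^esub> g (h \<otimes>\<^bsub>B\<^esub> l)" .
qed

end

section \<open>The associated graded algebra\<close>

text \<open>The graded Hopf algebra and its Poisson part share their linear structure but are
  records of different types; this transports the module axioms between them.\<close>

lemma module_cong:
  fixes k :: "('k, 'r) ring_scheme" and X :: "('k, 'a, 'm) module_scheme"
    and Y :: "('k, 'a, 'n) module_scheme"
  assumes Y: "module k Y" and eq: "carrier X = carrier Y" "add X = add Y" "zero X = zero Y" "smult X = smult Y"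
  shows "module k X"
proof -
  interpret Y: module k Y by fact
  have "abelian_group X"
    by (rule abelian_groupI)
      (auto simp: eq Y.M.a_ac intro!: bexI[of _ "\<ominus>\<^bsub>Y\<^esub> _"] Y.M.l_neg)
  then show ?thesis
    by (rule moduleI[OF Y.R.is_cring])
      (simp_all add: eq Y.smult_l_distr Y.smult_r_distr Y.smult_assoc1)
qed

lemma (in linear_space) dual_finsum:
  assumes f: "f \<in> dual k V" and "finite A" and "p \<in> A \<rightarrow> carrier V"
  shows "f (finsum V p A) = finsum k (\<lambda>i. f (p i)) A"
  using assms(2,3)
proof (induction A rule: finite_induct)
  case (insert a A)
  then have p: "p \<in> A \<rightarrow> carrier V" "p a \<in> carrier V" by auto
  then have "(\<lambda>i. f (p i)) \<in> A \<rightarrow> carrier k" "f (p a) \<in> carrier k" using dual_closed[OF f] by auto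
  then show ?case using insert f p by simp
qed (simp add: f)

lemma (in module) submodule_finsum:
  assumes H: "submodule H R M" and "finite A" and "\<And>i. i \<in> A \<Longrightarrow> p i \<in> H"
  shows "finsum M p A \<in> H"
  using assms(2,3)
proof (induction A rule: finite_induct)
  case empty
  then show ?case using submodule.axioms(1)[OF H] subgroup.one_closed by fastforce
next
  case (insert a A)
  then have "p \<in> A \<rightarrow> carrier M" "p a \<in> carrier M" using submoduleE(1)[OF H] by auto
  then show ?case using insert submoduleE(5)[OF H] by simp
qed

context pointed_poisson_hopf
begin

abbreviation "cls \<equiv> gr_class k B"

section \<open>Cosets and their representatives\<close>

lemma cls_eq: "cls n x = {h \<oplus>\<^bsub>B\<^esub> x | h. h \<in> lower n}"
  by (auto simp: gr_class_def lower_def a_r_coset_def')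

lemma lower_zero [simp]: "\<zero>\<^bsub>B\<^esub> \<in> lower n"
  by (rule submodule_zero_mem[OF submodule_lower])

lemma lower_add [simp]: "x \<in> lower n \<Longrightarrow> y \<in> lower n \<Longrightarrow> x \<oplus>\<^bsub>B\<^esub> y \<in> lower n"
  by (rule submoduleE(5)[OF submodule_lower])

lemma lower_minus [simp]: "x \<in> lower n \<Longrightarrow> \<ominus>\<^bsub>B\<^esub> x \<in> lower n"
  by (rule submoduleE(3)[OF submodule_lower])

lemma lower_smult [simp]: "r \<in> carrier k \<Longrightarrow> x \<in> lower n \<Longrightarrow> r \<odot>\<^bsub>B\<^esub> x \<in> lower n"
  by (rule submoduleE(4)[OF submodule_lower])

lemma lower_0 [simp]: "lower 0 = {\<zero>\<^bsub>B\<^esub>}"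
  by (simp add: lower_def)

lemma filt_add [simp]: "x \<in> filt n \<Longrightarrow> y \<in> filt n \<Longrightarrow> x \<oplus>\<^bsub>B\<^esub> y \<in> filt n"
  by (rule submoduleE(5)[OF submodule_filt])

lemma filt_smult [simp]: "r \<in> carrier k \<Longrightarrow> x \<in> filt n \<Longrightarrow> r \<odot>\<^bsub>B\<^esub> x \<in> filt n"
  by (rule submoduleE(4)[OF submodule_filt])

lemma cls_cong_iff:
  assumes "x \<in> carrier B" "y \<in> carrier B"
  shows "cls n x = cls n y \<longleftrightarrow> (\<exists>h\<in>lower n. x = h \<oplus>\<^bsub>B\<^esub> y)"
proof
  assume "cls n x = cls n y"
  moreover have "x \<in> cls n x" unfolding cls_eq using assms by (auto intro!: exI[of _ "\<zero>\<^bsub>B\<^esub>"])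
  ultimately show "\<exists>h\<in>lower n. x = h \<oplus>\<^bsub>B\<^esub> y" unfolding cls_eq by blast
next
  assume "\<exists>h\<in>lower n. x = h \<oplus>\<^bsub>B\<^esub> y"
  then obtain h where h: "h \<in> lower n" "x = h \<oplus>\<^bsub>B\<^esub> y" by blast
  have hc: "h \<in> carrier B" using h lower_closed by blast
  have "h' \<oplus>\<^bsub>B\<^esub> x = (h' \<oplus>\<^bsub>B\<^esub> h) \<oplus>\<^bsub>B\<^esub> y" if "h' \<in> lower n" for h'
    using that h hc assms lower_closed by (simp add: M.a_assoc)
  moreover have "h' \<oplus>\<^bsub>B\<^esub> y = (h' \<oplus>\<^bsub>B\<^esub> \<ominus>\<^bsub>B\<^esub> h) \<oplus>\<^bsub>B\<^esub> x" if "h' \<in> lower n" for h'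
    using that h hc assms lower_closed by (simp add: M.a_assoc M.r_neg1)
  ultimately show "cls n x = cls n y"
    unfolding cls_eq using h(1) lower_add lower_minus by blast
qed

lemma cls_congI: "h \<in> lower n \<Longrightarrow> x = h \<oplus>\<^bsub>B\<^esub> y \<Longrightarrow> y \<in> carrier B \<Longrightarrow> cls n x = cls n y"
  using cls_cong_iff[of x y n] lower_closed by blast

lemma cls_lower:
  assumes "x \<in> carrier B"
  shows "cls n x = cls n \<zero>\<^bsub>B\<^esub> \<longleftrightarrow> x \<in> lower n"
  using cls_cong_iff[OF assms M.zero_closed] lower_closed by auto

lemma representative_cls:
  assumes "x \<in> carrier B"
  obtains h where "h \<in> lower n" "representative (cls n x) = h \<oplus>\<^bsub>B\<^esub> x"
proof -
  have "\<zero>\<^bsub>B\<^esub> \<oplus>\<^bsub>B\<^esub> x \<in> cls n x" unfolding cls_eq using lower_zero by blast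
  then have "representative (cls n x) \<in> cls n x" unfolding representative_def by (rule someI)
  then show thesis using that unfolding cls_eq by blast
qed

lemma representative_closed [simp]: "x \<in> carrier B \<Longrightarrow> representative (cls n x) \<in> carrier B"
  using representative_cls lower_closed M.a_closed by metis

lemma representative_filt: "x \<in> filt n \<Longrightarrow> representative (cls n x) \<in> filt n"
proof -
  assume x: "x \<in> filt n"
  obtain h where h: "h \<in> lower n" "representative (cls n x) = h \<oplus>\<^bsub>B\<^esub> x"
    using filt_closed[OF x] by (rule representative_cls)
  have "h \<in> filt n" using h(1) lower_subset_filt by blast
  then show ?thesis unfolding h(2) using x by (rule filt_add)
qed

lemma cls_representative [simp]: "x \<in> carrier B \<Longrightarrow> cls n (representative (cls n x)) = cls n x"
  using representative_cls cls_cong_iff representative_closed by metis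

lemma cls_add_cong:
  assumes "cls n x = cls n x'" "cls n y = cls n y'"
    and c: "x \<in> carrier B" "x' \<in> carrier B" "y \<in> carrier B" "y' \<in> carrier B"
  shows "cls n (x \<oplus>\<^bsub>B\<^esub> y) = cls n (x' \<oplus>\<^bsub>B\<^esub> y')"
proof -
  obtain h h' where h: "h \<in> lower n" "x = h \<oplus>\<^bsub>B\<^esub> x'" "h' \<in> lower n" "y = h' \<oplus>\<^bsub>B\<^esub> y'"
    using assms cls_cong_iff by metis
  then have "x \<oplus>\<^bsub>B\<^esub> y = (h \<oplus>\<^bsub>B\<^esub> h') \<oplus>\<^bsub>B\<^esub> (x' \<oplus>\<^bsub>B\<^esub> y')"
    using c lower_closed by (simp add: M.a_ac)
  moreover have "h \<oplus>\<^bsub>B\<^esub> h' \<in> lower n" using h by simp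
  ultimately show ?thesis using c cls_congI by blast
qed

lemma cls_smult_cong:
  assumes "cls n x = cls n x'" and c: "x \<in> carrier B" "x' \<in> carrier B" "r \<in> carrier k"
  shows "cls n (r \<odot>\<^bsub>B\<^esub> x) = cls n (r \<odot>\<^bsub>B\<^esub> x')"
proof -
  obtain h where h: "h \<in> lower n" "x = h \<oplus>\<^bsub>B\<^esub> x'" using assms cls_cong_iff by metis
  then have "r \<odot>\<^bsub>B\<^esub> x = r \<odot>\<^bsub>B\<^esub> h \<oplus>\<^bsub>B\<^esub> r \<odot>\<^bsub>B\<^esub> x'" using c lower_closed by (simp add: smult_r_distr)
  moreover have "r \<odot>\<^bsub>B\<^esub> h \<in> lower n" using h c by simp
  ultimately show ?thesis using c cls_congI smult_closed by blast
qed

lemma cls_finsum_cong: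
  assumes "finite A" "\<And>i. i \<in> A \<Longrightarrow> cls n (p i) = cls n (q i)"
    "\<And>i. i \<in> A \<Longrightarrow> p i \<in> carrier B" "\<And>i. i \<in> A \<Longrightarrow> q i \<in> carrier B"
  shows "cls n (finsum B p A) = cls n (finsum B q A)"
  using assms
proof (induction A rule: finite_induct)
  case (insert a A)
  then have c: "p \<in> A \<rightarrow> carrier B" "q \<in> A \<rightarrow> carrier B" "p a \<in> carrier B" "q a \<in> carrier B" by auto
  have "cls n (p a \<oplus>\<^bsub>B\<^esub> finsum B p A) = cls n (q a \<oplus>\<^bsub>B\<^esub> finsum B q A)"
    using c insert by (intro cls_add_cong) auto
  then show ?case using c insert.hyps by simp
qed simp

section \<open>Elements of the graded algebra as sequences of representatives\<close>

definition grf :: "(nat \<Rightarrow> 'b) \<Rightarrow> nat \<Rightarrow> 'b set"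
  where "grf x = (\<lambda>n. cls n (x n))"

text \<open>Finiteness is asked modulo \<open>lower n\<close>: the representative picked for a zero
  class may be any element of \<open>lower n\<close>, so the sequence itself can be nonzero
  infinitely often.\<close>

definition components :: "(nat \<Rightarrow> 'b) set"
  where "components = {x. (\<forall>n. x n \<in> filt n) \<and> finite {n. x n \<notin> lower n}}"

lemma componentsD:
  assumes "x \<in> components"
  shows "x n \<in> filt n" "x n \<in> carrier B" "finite {n. x n \<notin> lower n}"
  using assms filt_closed by (auto simp: components_def)

abbreviation "C \<equiv> gr k B"
abbreviation "CP \<equiv> gr_poisson k B"

lemma gr_simps [simp]:
  "carrier C = carrier CP" "add C = add CP" "zero C = zero CP" "smult C = smult CP"
  "mult C = mult CP" "one C = one CP" "bracket C = bracket CP"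
  by (simp_all add: gr_def poisson.defs)

lemma carrier_gr: "carrier CP = grf ` components"
proof
  show "grf ` components \<subseteq> carrier CP"
  proof
    fix u assume "u \<in> grf ` components"
    then obtain x where x: "x \<in> components" "u = grf x" by auto
    note xD = componentsD[OF x(1)]
    have "finite {n. cls n (x n) \<noteq> cls n \<zero>\<^bsub>B\<^esub>}" using xD(3) by (simp add: cls_lower[OF xD(2)])
    then show "u \<in> carrier CP" using xD(1) by (simp add: x(2) gr_poisson_def grf_def)
  qed
  show "carrier CP \<subseteq> grf ` components"
  proof
    fix u assume u: "u \<in> carrier CP"
    then have "\<forall>n. \<exists>x. x \<in> filt n \<and> u n = cls n x" by (auto simp: gr_poisson_def)
    then obtain x where x: "\<And>n. x n \<in> filt n" "\<And>n. u n = cls n (x n)" by metis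
    have "finite {n. u n \<noteq> cls n \<zero>\<^bsub>B\<^esub>}" using u by (simp add: gr_poisson_def)
    then have "x \<in> components" using x cls_lower[OF filt_closed[OF x(1)]] by (simp add: components_def)
    moreover have "u = grf x" using x by (auto simp: grf_def)
    ultimately show "u \<in> grf ` components" by blast
  qed
qed

lemma grE:
  assumes "u \<in> carrier CP"
  obtains x where "x \<in> components" "u = grf x"
  using assms carrier_gr by auto

lemma grf_closed [simp]: "x \<in> components \<Longrightarrow> grf x \<in> carrier CP"
  by (simp add: carrier_gr)

lemma gr_representative:
  assumes "u \<in> carrier CP"
  shows "(\<lambda>n. representative (u n)) \<in> components" "grf (\<lambda>n. representative (u n)) = u"
proof -
  obtain x where x: "x \<in> components" "u = grf x" using assms by (rule grE)
  note xD = componentsD[OF x(1)]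
  have eq: "cls n (representative (u n)) = cls n (x n)" for n using xD by (simp add: x(2) grf_def)
  then show "grf (\<lambda>n. representative (u n)) = u" by (simp add: x(2) grf_def)
  have f: "representative (u n) \<in> filt n" for n
    using xD representative_filt by (simp add: x(2) grf_def)
  moreover have "representative (u n) \<in> lower n \<longleftrightarrow> x n \<in> lower n" for n
    by (simp only: cls_lower[OF filt_closed[OF f], symmetric] cls_lower[OF xD(2), symmetric] eq)
  ultimately show "(\<lambda>n. representative (u n)) \<in> components"
    using xD(3) by (simp add: components_def)
qed

lemma gr_zero: "\<zero>\<^bsub>CP\<^esub> = grf (\<lambda>_. \<zero>\<^bsub>B\<^esub>)"
  by (simp add: gr_poisson_def grf_def)

lemma gr_one: "\<one>\<^bsub>CP\<^esub> = gr_elem k B 0 \<one>\<^bsub>B\<^esub>"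
  by (simp add: gr_poisson_def)

lemma gr_elem_eq: "gr_elem k B n x = grf (\<lambda>m. if m = n then x else \<zero>\<^bsub>B\<^esub>)"
  by (auto simp: gr_elem_def grf_def)

lemma gr_add:
  assumes "\<And>n. x n \<in> carrier B" "\<And>n. y n \<in> carrier B"
  shows "grf x \<oplus>\<^bsub>CP\<^esub> grf y = grf (\<lambda>n. x n \<oplus>\<^bsub>B\<^esub> y n)"
proof -
  have "cls n (representative (cls n (x n)) \<oplus>\<^bsub>B\<^esub> representative (cls n (y n))) = cls n (x n \<oplus>\<^bsub>B\<^esub> y n)" for n
    by (rule cls_add_cong) (simp_all add: assms)
  then show ?thesis by (simp add: gr_poisson_def grf_def)
qed

lemma gr_smult:
  assumes "r \<in> carrier k" "\<And>n. x n \<in> carrier B"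
  shows "r \<odot>\<^bsub>CP\<^esub> grf x = grf (\<lambda>n. r \<odot>\<^bsub>B\<^esub> x n)"
proof -
  have "cls n (r \<odot>\<^bsub>B\<^esub> representative (cls n (x n))) = cls n (r \<odot>\<^bsub>B\<^esub> x n)" for n
    by (rule cls_smult_cong) (simp_all add: assms)
  then show ?thesis by (simp add: gr_poisson_def grf_def)
qed

lemma components_zero: "(\<lambda>_. \<zero>\<^bsub>B\<^esub>) \<in> components"
  by (simp add: components_def)

lemma components_elem: "x \<in> filt n \<Longrightarrow> (\<lambda>m. if m = n then x else \<zero>\<^bsub>B\<^esub>) \<in> components"
proof -
  assume x: "x \<in> filt n"
  have "finite {m. (if m = n then x else \<zero>\<^bsub>B\<^esub>) \<notin> lower m}"
    by (rule finite_subset[of _ "{n}"]) auto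
  then show ?thesis using x by (simp add: components_def)
qed

lemma components_add: "x \<in> components \<Longrightarrow> y \<in> components \<Longrightarrow> (\<lambda>n. x n \<oplus>\<^bsub>B\<^esub> y n) \<in> components"
proof -
  assume x: "x \<in> components" and y: "y \<in> components"
  have "finite {n. x n \<oplus>\<^bsub>B\<^esub> y n \<notin> lower n}"
    by (rule finite_subset[OF _ finite_UnI[OF componentsD(3)[OF x] componentsD(3)[OF y]]]) auto
  then show ?thesis using componentsD[OF x] componentsD[OF y] by (simp add: components_def)
qed

lemma components_smult: "r \<in> carrier k \<Longrightarrow> x \<in> components \<Longrightarrow> (\<lambda>n. r \<odot>\<^bsub>B\<^esub> x n) \<in> components"
proof -
  assume r: "r \<in> carrier k" and x: "x \<in> components"
  have "finite {n. r \<odot>\<^bsub>B\<^esub> x n \<notin> lower n}"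
    by (rule finite_subset[OF _ componentsD(3)[OF x]]) (use r in auto)
  then show ?thesis using componentsD[OF x] r by (simp add: components_def)
qed

lemma gr_module: "module k CP"
proof (rule moduleI)
  show "cring k" by (rule R.is_cring)
  show "abelian_group CP"
  proof (rule abelian_groupI)
    show "\<zero>\<^bsub>CP\<^esub> \<in> carrier CP" by (simp add: gr_zero components_zero)
    fix u assume "u \<in> carrier CP"
    then obtain x where x: "x \<in> components" "u = grf x" by (rule grE)
    note xD = componentsD(2)[OF x(1)]
    show "\<zero>\<^bsub>CP\<^esub> \<oplus>\<^bsub>CP\<^esub> u = u" using xD by (simp add: x gr_zero gr_add)
    show "\<exists>v\<in>carrier CP. v \<oplus>\<^bsub>CP\<^esub> u = \<zero>\<^bsub>CP\<^esub>"
    proof (rule bexI[of _ "grf (\<lambda>n. \<ominus>\<^bsub>k\<^esub> \<one>\<^bsub>k\<^esub> \<odot>\<^bsub>B\<^esub> x n)"])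
      show "grf (\<lambda>n. \<ominus>\<^bsub>k\<^esub> \<one>\<^bsub>k\<^esub> \<odot>\<^bsub>B\<^esub> x n) \<oplus>\<^bsub>CP\<^esub> u = \<zero>\<^bsub>CP\<^esub>"
        using xD by (simp add: x gr_zero gr_add smult_l_minus M.l_neg)
    qed (use components_smult[OF _ x(1)] in simp)
    fix v assume "v \<in> carrier CP"
    then obtain y where y: "y \<in> components" "v = grf y" by (rule grE)
    note yD = componentsD(2)[OF y(1)]
    show "u \<oplus>\<^bsub>CP\<^esub> v \<in> carrier CP"
      using xD yD components_add[OF x(1) y(1)] by (simp add: x y gr_add)
    show "u \<oplus>\<^bsub>CP\<^esub> v = v \<oplus>\<^bsub>CP\<^esub> u" using xD yD by (simp add: x y gr_add M.a_comm)
    fix w assume "w \<in> carrier CP"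
    then obtain z where z: "z \<in> components" "w = grf z" by (rule grE)
    note zD = componentsD(2)[OF z(1)]
    show "u \<oplus>\<^bsub>CP\<^esub> v \<oplus>\<^bsub>CP\<^esub> w = u \<oplus>\<^bsub>CP\<^esub> (v \<oplus>\<^bsub>CP\<^esub> w)" using xD yD zD by (simp add: x y z gr_add M.a_assoc)
  qed
next
  fix r u assume r: "r \<in> carrier k" and "u \<in> carrier CP"
  then obtain x where x: "x \<in> components" "u = grf x" by (auto elim: grE)
  note xD = componentsD(2)[OF x(1)]
  show "r \<odot>\<^bsub>CP\<^esub> u \<in> carrier CP" using r xD components_smult[OF r x(1)] by (simp add: x gr_smult)
  {
    fix s assume s: "s \<in> carrier k"
    show "(r \<oplus>\<^bsub>k\<^esub> s) \<odot>\<^bsub>CP\<^esub> u = r \<odot>\<^bsub>CP\<^esub> u \<oplus>\<^bsub>CP\<^esub> s \<odot>\<^bsub>CP\<^esub> u"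
      using r s xD by (simp add: x gr_smult gr_add smult_l_distr)
    show "(r \<otimes>\<^bsub>k\<^esub> s) \<odot>\<^bsub>CP\<^esub> u = r \<odot>\<^bsub>CP\<^esub> (s \<odot>\<^bsub>CP\<^esub> u)"
      using r s xD by (simp add: x gr_smult smult_assoc1)
  }
  fix v assume "v \<in> carrier CP"
  then obtain y where y: "y \<in> components" "v = grf y" by (rule grE)
  note yD = componentsD(2)[OF y(1)]
  show "r \<odot>\<^bsub>CP\<^esub> (u \<oplus>\<^bsub>CP\<^esub> v) = r \<odot>\<^bsub>CP\<^esub> u \<oplus>\<^bsub>CP\<^esub> r \<odot>\<^bsub>CP\<^esub> v"
    using r xD yD by (simp add: x y gr_smult gr_add smult_r_distr)
next
  fix u assume "u \<in> carrier CP"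
  then obtain x where x: "x \<in> components" "u = grf x" by (auto elim: grE)
  show "\<one>\<^bsub>k\<^esub> \<odot>\<^bsub>CP\<^esub> u = u" using componentsD(2)[OF x(1)] by (simp add: x gr_smult)
qed

text \<open>One argument for product and bracket, with m standing for either. If the classes of x
  vanish from N on and those of y from N' on, then for n \<ge> N + N' every i has i \<ge> N or n - i
  \<ge> N', so each summand has a factor in its \<open>lower\<close> part.\<close>

lemma convolution_components:
  assumes x: "x \<in> components" and y: "y \<in> components"
    and filt: "\<And>i j a b. a \<in> filt i \<Longrightarrow> b \<in> filt j \<Longrightarrow> m a b \<in> filt (i + j)"
    and left: "\<And>i j a b. a \<in> lower i \<Longrightarrow> b \<in> filt j \<Longrightarrow> m a b \<in> lower (i + j)"
    and right: "\<And>i j a b. a \<in> filt i \<Longrightarrow> b \<in> lower j \<Longrightarrow> m a b \<in> lower (i + j)"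
  shows "(\<lambda>n. \<Oplus>\<^bsub>B\<^esub>i\<in>{..n}. m (x i) (y (n - i))) \<in> components"
proof -
  note xD = componentsD[OF x] and yD = componentsD[OF y]
  have f: "m (x i) (y (n - i)) \<in> filt n" if "i \<le> n" for i n
    using filt[OF xD(1)[of i] yD(1)[of "n - i"]] that by simp
  obtain N where N: "\<And>n. n \<ge> N \<Longrightarrow> x n \<in> lower n"
    using xD(3) by (metis (mono_tags, lifting) finite_nat_set_iff_bounded mem_Collect_eq not_less)
  obtain N' where N': "\<And>n. n \<ge> N' \<Longrightarrow> y n \<in> lower n"
    using yD(3) by (metis (mono_tags, lifting) finite_nat_set_iff_bounded mem_Collect_eq not_less)
  have "(\<Oplus>\<^bsub>B\<^esub>i\<in>{..n}. m (x i) (y (n - i))) \<in> lower n" if n: "n \<ge> N + N'" for n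
  proof (rule submodule_finsum[OF submodule_lower])
    fix i assume i: "i \<in> {..n}"
    show "m (x i) (y (n - i)) \<in> lower n"
    proof (cases "i \<ge> N")
      case True
      then show ?thesis using left[OF N[OF True] yD(1)[of "n - i"]] i by simp
    next
      case False
      then have "n - i \<ge> N'" using n by simp
      then show ?thesis using right[OF xD(1)[of i] N'[of "n - i"]] i by simp
    qed
  qed simp
  then have "finite {n. (\<Oplus>\<^bsub>B\<^esub>i\<in>{..n}. m (x i) (y (n - i))) \<notin> lower n}"
    by (intro finite_subset[OF _ finite_lessThan[of "N + N'"]]) (auto simp: not_le[symmetric])
  moreover have "(\<Oplus>\<^bsub>B\<^esub>i\<in>{..n}. m (x i) (y (n - i))) \<in> filt n" for n
    by (rule submodule_finsum[OF submodule_filt]) (use f in auto)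
  ultimately show ?thesis by (simp add: components_def)
qed

lemmas mult_components =
  convolution_components[OF _ _ filt_mult lower_mult_bracket_left(1) lower_mult_bracket_right(1)]

lemmas bracket_components =
  convolution_components[OF _ _ filt_bracket lower_mult_bracket_left(2) lower_mult_bracket_right(2)]

lemma gr_mult_eq:
  "u \<otimes>\<^bsub>CP\<^esub> v = grf (\<lambda>n. \<Oplus>\<^bsub>B\<^esub>i\<in>{..n}. representative (u i) \<otimes>\<^bsub>B\<^esub> representative (v (n - i)))"
  by (simp add: gr_poisson_def grf_def)

lemma gr_bracket_eq:
  "bracket CP u v = grf (\<lambda>n. \<Oplus>\<^bsub>B\<^esub>i\<in>{..n}. bracket B (representative (u i)) (representative (v (n - i))))"
  by (simp add: gr_poisson_def grf_def)

section \<open>Graded coinvariants with a label\<close>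

definition gr_coinv :: "'b \<Rightarrow> (nat \<Rightarrow> 'b set) set"
  where "gr_coinv h = {u \<in> carrier CP. \<forall>n. coinv h n (representative (u n))}"

text \<open>\<open>gr_coinv\<close> refers to the representatives that happen to be chosen, x to
  arbitrary ones. They differ by elements of \<open>lower n\<close>, which are coinvariant for every
  label.\<close>

lemma grf_coinv:
  assumes h: "h \<in> carrier B" and x: "x \<in> components" "\<And>n. coinv h n (x n)"
  shows "grf x \<in> gr_coinv h"
proof -
  have "coinv h n (representative (cls n (x n)))" for n
  proof -
    obtain l where l: "l \<in> lower n" "representative (cls n (x n)) = l \<oplus>\<^bsub>B\<^esub> x n"
      using representative_cls[OF componentsD(2)[OF x(1)]] by blast
    then show ?thesis
      using submoduleE(5)[OF submodule_coinv[OF h, of n], of l "x n"] coinv_lower[OF h l(1)] x(2) by simp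
  qed
  then show ?thesis using x by (simp add: gr_coinv_def grf_def[symmetric] flip: grf_def) (simp add: grf_def)
qed

lemma gr_coinvD:
  assumes "u \<in> gr_coinv h"
  shows "u \<in> carrier CP" "coinv h n (representative (u n))"
    "(\<lambda>n. representative (u n)) \<in> components" "grf (\<lambda>n. representative (u n)) = u"
  using assms gr_representative by (auto simp: gr_coinv_def)

lemma coinv_finsum:
  assumes "h \<in> carrier B" "\<And>i. i \<le> n \<Longrightarrow> coinv h n (p i)"
  shows "coinv h n (\<Oplus>\<^bsub>B\<^esub>i\<in>{..n}. p i)"
  using submodule_finsum[OF submodule_coinv[OF assms(1)], of "{..n}" p] assms(2) by simp

lemma gr_coinv_mult:
  assumes "h \<in> carrier B" "l \<in> carrier B" and u: "u \<in> gr_coinv h" and v: "v \<in> gr_coinv l"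
  shows "u \<otimes>\<^bsub>CP\<^esub> v \<in> gr_coinv (h \<otimes>\<^bsub>B\<^esub> l)"
  unfolding gr_mult_eq
proof (rule grf_coinv)
  show "coinv (h \<otimes>\<^bsub>B\<^esub> l) n (\<Oplus>\<^bsub>B\<^esub>i\<in>{..n}. representative (u i) \<otimes>\<^bsub>B\<^esub> representative (v (n - i)))" for n
  proof (rule coinv_finsum)
    show "coinv (h \<otimes>\<^bsub>B\<^esub> l) n (representative (u i) \<otimes>\<^bsub>B\<^esub> representative (v (n - i)))" if "i \<le> n" for i
      using coinv_mult[OF assms(1,2) gr_coinvD(2)[OF u, of i] gr_coinvD(2)[OF v, of "n - i"]] that by simp
  qed (use assms in simp)
qed (use assms mult_components[OF gr_coinvD(3)[OF u] gr_coinvD(3)[OF v]] in simp_all)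

lemma gr_coinv_bracket:
  assumes "h \<in> carrier B" "l \<in> carrier B" "bracket B h l = \<zero>\<^bsub>B\<^esub>"
    and u: "u \<in> gr_coinv h" and v: "v \<in> gr_coinv l"
  shows "bracket CP u v \<in> gr_coinv (h \<otimes>\<^bsub>B\<^esub> l)"
  unfolding gr_bracket_eq
proof (rule grf_coinv)
  show "coinv (h \<otimes>\<^bsub>B\<^esub> l) n (\<Oplus>\<^bsub>B\<^esub>i\<in>{..n}. bracket B (representative (u i)) (representative (v (n - i))))" for n
  proof (rule coinv_finsum)
    show "coinv (h \<otimes>\<^bsub>B\<^esub> l) n (bracket B (representative (u i)) (representative (v (n - i))))" if "i \<le> n" for i
      using coinv_bracket[OF assms(1-3) gr_coinvD(2)[OF u, of i] gr_coinvD(2)[OF v, of "n - i"]] that by simp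
  qed (use assms in simp)
qed (use assms bracket_components[OF gr_coinvD(3)[OF u] gr_coinvD(3)[OF v]] in simp_all)

lemma gr_elem_coinv:
  assumes g: "g \<in> G"
  shows "gr_elem k B 0 g \<in> gr_coinv g"
  unfolding gr_elem_eq
proof (rule grf_coinv)
  have gc: "g \<in> carrier B" using grouplikeD(1)[OF g] .
  show "coinv g n (if n = 0 then g else \<zero>\<^bsub>B\<^esub>)" for n
    using coinv_grouplike[OF g] coinv_lower[OF gc lower_zero] by simp
  show "(\<lambda>m. if m = 0 then g else \<zero>\<^bsub>B\<^esub>) \<in> components"
    using components_elem[of g 0] grouplike_coradical[OF g] by simp
qed (rule grouplikeD(1)[OF g])

text \<open>The representatives of the zero classes of \<open>gr_elem k B 0 g\<close> in positive
  degree i lie in \<open>lower i\<close>, so their contributions vanish in the class of degree n and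
  the summand with i = 0 remains.\<close>

lemma gr_elem_mult:
  assumes g: "g \<in> filt 0" and u: "u \<in> carrier CP"
  shows "(gr_elem k B 0 g \<otimes>\<^bsub>CP\<^esub> u) n = cls n (g \<otimes>\<^bsub>B\<^esub> representative (u n))"
proof -
  have gc: "g \<in> carrier B" using g by (rule filt_closed)
  note uD = componentsD[OF gr_representative(1)[OF u]]
  define r where "r i = representative (cls i (if i = 0 then g else \<zero>\<^bsub>B\<^esub>))" for i
  \<comment> \<open>Classes in degree 0 are singletons, so the chosen representative is g
    itself.\<close>
  have r0: "r 0 = g" using representative_cls[OF gc, of 0] gc by (auto simp: r_def)
  have rl: "r i \<in> lower i" if "i \<noteq> 0" for i
    using representative_cls[OF M.zero_closed, of i] that lower_closed by (auto simp: r_def)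
  have rc: "r i \<in> carrier B" for i using gc by (simp add: r_def)
  have "(gr_elem k B 0 g \<otimes>\<^bsub>CP\<^esub> u) n = cls n (\<Oplus>\<^bsub>B\<^esub>i\<in>{..n}. r i \<otimes>\<^bsub>B\<^esub> representative (u (n - i)))"
    by (simp add: gr_mult_eq grf_def gr_elem_def r_def)
  also have "\<dots> = cls n (\<Oplus>\<^bsub>B\<^esub>i\<in>{..n}. if 0 = i then g \<otimes>\<^bsub>B\<^esub> representative (u (n - i)) else \<zero>\<^bsub>B\<^esub>)"
  proof (rule cls_finsum_cong)
    fix i assume i: "i \<in> {..n}"
    have "r i \<otimes>\<^bsub>B\<^esub> representative (u (n - i)) \<in> lower n" if "i \<noteq> 0"
      using lower_mult_bracket_left(1)[OF rl[OF that] uD(1)[of "n - i"]] i by simp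
    then show "cls n (r i \<otimes>\<^bsub>B\<^esub> representative (u (n - i))) =
        cls n (if 0 = i then g \<otimes>\<^bsub>B\<^esub> representative (u (n - i)) else \<zero>\<^bsub>B\<^esub>)"
      using r0 cls_lower[of "r i \<otimes>\<^bsub>B\<^esub> representative (u (n - i))" n] rc uD(2) by auto
  qed (use rc uD(2) gc in auto)
  also have "(\<Oplus>\<^bsub>B\<^esub>i\<in>{..n}. if 0 = i then g \<otimes>\<^bsub>B\<^esub> representative (u (n - i)) else \<zero>\<^bsub>B\<^esub>) =
      g \<otimes>\<^bsub>B\<^esub> representative (u (n - 0))"
    by (rule M.finsum_singleton) (use gc uD(2) in auto)
  finally show ?thesis by simp
qed

text \<open>The inverse is a definite description, so uniqueness has to be shown as well. In each
  degree a representative r of a solution u satisfies r = h (g r), and g r is known modulo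
  \<open>lower n\<close>.\<close>

lemma gr_elem_inverse:
  assumes g: "g \<in> G" and h: "h \<in> G" and hg: "h \<otimes>\<^bsub>B\<^esub> g = \<one>\<^bsub>B\<^esub>"
  shows "inv\<^bsub>CP\<^esub> (gr_elem k B 0 g) = gr_elem k B 0 h"
proof -
  have mem: "t \<in> filt 0 \<and> t \<in> carrier B \<and> gr_elem k B 0 t \<in> carrier CP" if "t \<in> G" for t
    using that grouplike_coradical[OF that] grouplikeD(1)[OF that] gr_coinvD(1)[OF gr_elem_coinv[OF that]]
    by simp
  have mult: "gr_elem k B 0 s \<otimes>\<^bsub>CP\<^esub> gr_elem k B 0 t = \<one>\<^bsub>CP\<^esub>"
    if s: "s \<in> G" and t: "t \<in> G" and st: "s \<otimes>\<^bsub>B\<^esub> t = \<one>\<^bsub>B\<^esub>" for s t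
  proof
    fix n :: nat
    note c = mem[OF s] mem[OF t]
    have "(if n = 0 then t else \<zero>\<^bsub>B\<^esub>) \<in> carrier B" using c by simp
    then obtain l where l: "l \<in> lower n" "representative (gr_elem k B 0 t n) = l \<oplus>\<^bsub>B\<^esub> (if n = 0 then t else \<zero>\<^bsub>B\<^esub>)"
      unfolding gr_elem_def by (rule representative_cls)
    have "s \<otimes>\<^bsub>B\<^esub> l \<in> lower n" using lower_mult_bracket_right(1)[of s 0 l n] c l by simp
    moreover have "s \<otimes>\<^bsub>B\<^esub> (l \<oplus>\<^bsub>B\<^esub> (if n = 0 then t else \<zero>\<^bsub>B\<^esub>)) = s \<otimes>\<^bsub>B\<^esub> l \<oplus>\<^bsub>B\<^esub> (if n = 0 then \<one>\<^bsub>B\<^esub> else \<zero>\<^bsub>B\<^esub>)"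
      using c l lower_closed[OF l(1)] st by (simp add: r_distr)
    ultimately have "cls n (s \<otimes>\<^bsub>B\<^esub> representative (gr_elem k B 0 t n)) = cls n (if n = 0 then \<one>\<^bsub>B\<^esub> else \<zero>\<^bsub>B\<^esub>)"
      using c lower_closed l by (subst cls_cong_iff) auto
    then show "(gr_elem k B 0 s \<otimes>\<^bsub>CP\<^esub> gr_elem k B 0 t) n = \<one>\<^bsub>CP\<^esub> n"
      using gr_elem_mult[of s "gr_elem k B 0 t" n] c by (simp add: gr_one gr_elem_def)
  qed
  note c = mem[OF g] mem[OF h]
  have gh: "g \<otimes>\<^bsub>B\<^esub> h = \<one>\<^bsub>B\<^esub>" using hg c by (simp add: m_comm)
  show ?thesis
    unfolding m_inv_def
  proof (rule the_equality)
    show "gr_elem k B 0 h \<in> carrier CP \<and> gr_elem k B 0 g \<otimes>\<^bsub>CP\<^esub> gr_elem k B 0 h = \<one>\<^bsub>CP\<^esub> \<and>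
        gr_elem k B 0 h \<otimes>\<^bsub>CP\<^esub> gr_elem k B 0 g = \<one>\<^bsub>CP\<^esub>"
      using mult[OF g h gh] mult[OF h g hg] c by simp
    fix u assume "u \<in> carrier CP \<and> gr_elem k B 0 g \<otimes>\<^bsub>CP\<^esub> u = \<one>\<^bsub>CP\<^esub> \<and> u \<otimes>\<^bsub>CP\<^esub> gr_elem k B 0 g = \<one>\<^bsub>CP\<^esub>"
    then have u: "u \<in> carrier CP" "gr_elem k B 0 g \<otimes>\<^bsub>CP\<^esub> u = \<one>\<^bsub>CP\<^esub>" by auto
    note uD = gr_representative[OF u(1)]
    show "u = gr_elem k B 0 h"
    proof
      fix n
      let ?e = "if n = 0 then \<one>\<^bsub>B\<^esub> else \<zero>\<^bsub>B\<^esub>" and ?r = "representative (u n)"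
      have rc: "?r \<in> carrier B" using componentsD(2)[OF uD(1)] .
      have "cls n (g \<otimes>\<^bsub>B\<^esub> ?r) = cls n ?e"
        using gr_elem_mult[of g u n] c u by (simp add: gr_one gr_elem_def)
      then obtain l where l: "l \<in> lower n" "g \<otimes>\<^bsub>B\<^esub> ?r = l \<oplus>\<^bsub>B\<^esub> ?e"
        using cls_cong_iff[of "g \<otimes>\<^bsub>B\<^esub> ?r" ?e n] rc c by auto
      have "?r = h \<otimes>\<^bsub>B\<^esub> (g \<otimes>\<^bsub>B\<^esub> ?r)" using rc c hg by (simp add: m_assoc[symmetric])
      also have "\<dots> = h \<otimes>\<^bsub>B\<^esub> l \<oplus>\<^bsub>B\<^esub> (if n = 0 then h else \<zero>\<^bsub>B\<^esub>)"
        unfolding l(2) using c lower_closed[OF l(1)] by (simp add: r_distr)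
      finally have "cls n ?r = cls n (if n = 0 then h else \<zero>\<^bsub>B\<^esub>)"
        using rc c lower_mult_bracket_right(1)[of h 0 l n] l(1) by (subst cls_cong_iff) auto
      then show "u n = gr_elem k B 0 h n"
        using fun_cong[OF uD(2), of n] by (simp add: grf_def gr_elem_def)
    qed
  qed
qed

end

context pointed_poisson_hopf
begin

section \<open>The coproduct of the associated graded algebra\<close>

interpretation CP: linear_space k CP
  by (intro linear_space.intro gr_module field_axioms)

interpretation PP: linear_space_pair k CP CP
  by unfold_locales

interpretation C: linear_space k C
  by (intro linear_space.intro module_cong[OF gr_module] field_axioms) simp_all

abbreviation "C0 \<equiv> gr_zero k B"

lemma gr_zero_carrier:
  "carrier C0 = {u \<in> carrier CP. \<forall>n>0. u n = cls n \<zero>\<^bsub>B\<^esub>}"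
  by (simp add: gr_zero_def)

lemma gr_zero_simps [simp]:
  "add C0 = add CP" "zero C0 = zero CP" "smult C0 = smult CP" "one C0 = one CP"
  by (simp_all add: gr_zero_def)

lemma gr_zeroE:
  assumes "u \<in> carrier C0"
  obtains x where "x \<in> filt 0" "u = gr_elem k B 0 x"
proof -
  have u: "u \<in> carrier CP" "\<And>n. n > 0 \<Longrightarrow> u n = cls n \<zero>\<^bsub>B\<^esub>" using assms gr_zero_carrier by auto
  note uD = gr_representative[OF u(1)]
  have "u n = gr_elem k B 0 (representative (u 0)) n" for n
    using fun_cong[OF uD(2), of 0] u(2)[of n] by (simp add: gr_elem_def grf_def)
  then show thesis using that componentsD(1)[OF uD(1), of 0] by blast
qed

lemma gr_elem_closed [simp]: "x \<in> filt n \<Longrightarrow> gr_elem k B n x \<in> carrier CP"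
  unfolding gr_elem_eq by (rule grf_closed[OF components_elem])

lemma gr_elem_zero_closed: "x \<in> filt 0 \<Longrightarrow> gr_elem k B 0 x \<in> carrier C0"
  using gr_elem_closed[of x 0] by (simp add: gr_zero_carrier gr_elem_def del: coradical_filt.simps)

lemma gr_elem_add:
  assumes "x \<in> filt n" "y \<in> filt n"
  shows "gr_elem k B n (x \<oplus>\<^bsub>B\<^esub> y) = gr_elem k B n x \<oplus>\<^bsub>CP\<^esub> gr_elem k B n y"
  using assms filt_closed by (subst gr_elem_eq)+ (auto simp: gr_add intro!: arg_cong[of _ _ grf])

lemma gr_elem_smult:
  assumes "r \<in> carrier k" "x \<in> filt n"
  shows "gr_elem k B n (r \<odot>\<^bsub>B\<^esub> x) = r \<odot>\<^bsub>CP\<^esub> gr_elem k B n x"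
  using assms filt_closed by (subst gr_elem_eq)+ (auto simp: gr_smult intro!: arg_cong[of _ _ grf])

lemma gr_elem_lower: "x \<in> lower n \<Longrightarrow> gr_elem k B n x = \<zero>\<^bsub>CP\<^esub>"
  using cls_lower[of x n] lower_closed[of x n] by (auto simp: gr_elem_def gr_zero grf_def fun_eq_iff)

lemma gr_elem_linear: "linear_map k (B\<lparr>carrier := filt n\<rparr>) CP (gr_elem k B n)"
  by (rule linear_mapI) (simp_all add: gr_elem_add gr_elem_smult)

lemma gr_zero_space: "linear_space k C0"
proof (rule linear_space.intro[OF _ field_axioms])
  let ?H = "{u \<in> carrier CP. \<forall>n>0. u n = cls n \<zero>\<^bsub>B\<^esub>}"
  have H: "u \<in> ?H \<longleftrightarrow> (\<exists>x\<in>filt 0. u = gr_elem k B 0 x)" for u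
  proof
    assume "u \<in> ?H"
    then have "u \<in> carrier C0" by (simp add: gr_zero_carrier)
    then show "\<exists>x\<in>filt 0. u = gr_elem k B 0 x" using gr_zeroE by metis
  next
    assume "\<exists>x\<in>filt 0. u = gr_elem k B 0 x"
    then show "u \<in> ?H" using gr_elem_zero_closed unfolding gr_zero_carrier by auto
  qed
  have "submodule ?H k C"
  proof (rule C.submoduleI)
    show "\<zero>\<^bsub>C\<^esub> \<in> ?H"
      using H[of "\<zero>\<^bsub>CP\<^esub>"] gr_elem_lower[OF lower_zero, of 0] filt_zero_mem[of 0] by fastforce
    fix u assume u: "u \<in> ?H"
    then obtain x where x: "x \<in> filt 0" "u = gr_elem k B 0 x" using H by blast
    show s: "r \<odot>\<^bsub>C\<^esub> u \<in> ?H" if "r \<in> carrier k" for r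
      unfolding H using x gr_elem_smult[OF that x(1)] filt_smult[OF that x(1)]
      by (intro bexI[of _ "r \<odot>\<^bsub>B\<^esub> x"]) simp_all
    have "\<ominus>\<^bsub>C\<^esub> u = (\<ominus>\<^bsub>k\<^esub> \<one>\<^bsub>k\<^esub>) \<odot>\<^bsub>C\<^esub> u" using u C.smult_l_minus[of "\<one>\<^bsub>k\<^esub>" u] C.smult_one[of u] by simp
    then show "\<ominus>\<^bsub>C\<^esub> u \<in> ?H" using s[of "\<ominus>\<^bsub>k\<^esub> \<one>\<^bsub>k\<^esub>"] by simp
    fix v assume "v \<in> ?H"
    then obtain y where y: "y \<in> filt 0" "v = gr_elem k B 0 y" using H by blast
    show "u \<oplus>\<^bsub>C\<^esub> v \<in> ?H"
      unfolding H using x y gr_elem_add[OF x(1) y(1)] filt_add[OF x(1) y(1)]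
      by (intro bexI[of _ "x \<oplus>\<^bsub>B\<^esub> y"]) simp_all
  qed auto
  from submodule.submodule_is_module[OF this C.module_axioms]
  show "module k C0" by (simp add: gr_zero_def)
qed

interpretation C0: linear_space k C0
  by (rule gr_zero_space)

interpretation PC: linear_space_pair k C C0
  by unfold_locales

section \<open>Functionals on the graded algebra and the graded coproduct\<close>

lemma dual_gr: "dual k C = dual k CP"
  by (simp only: dual_def gr_simps)

text \<open>On B_n the functional sends x to the value of f at its class; it kills B_{n-1} and is
  extended to B by \<open>extend_functional\<close>. In this way pairings on C become convolutions
  on B.\<close>

lemma gr_functionals:
  assumes f: "f \<in> dual k CP"
  obtains F where "\<And>n. F n \<in> annihilator k B (lower n)"
    "\<And>n x. x \<in> filt n \<Longrightarrow> F n x = f (gr_elem k B n x)"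
proof -
  have "\<exists>F. F \<in> annihilator k B (lower n) \<and> (\<forall>x\<in>filt n. F x = f (gr_elem k B n x))" for n
  proof -
    have g: "(\<lambda>x. f (gr_elem k B n x)) \<in> dual k (B\<lparr>carrier := filt n\<rparr>)"
      by (rule dual_comp[OF gr_elem_linear f])
    have z: "f (gr_elem k B n x) = \<zero>\<^bsub>k\<^esub>" if "x \<in> lower n" for x
      using that f by (simp add: gr_elem_lower)
    obtain F where "F \<in> annihilator k B (lower n)" "\<And>y. y \<in> filt n \<Longrightarrow> F y = f (gr_elem k B n y)"
      using extend_functional[OF submodule_filt lower_subset_filt g z] by blast
    then show ?thesis by blast
  qed
  then show thesis using that by metis
qed

lemma terms_snd: "(\<lambda>(i, a, b). (a, b)) = snd"
  by auto

text \<open>For a term \<open>a \<otimes> b\<close> with \<open>a \<in> B\<^sub>i\<close> and \<open>b \<in> B\<^sub>n\<^sub>-\<^sub>i\<close>, the extended functionals of degrees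
  \<open>j\<close> and \<open>n - j\<close> kill \<open>a\<close> if \<open>j > i\<close> and \<open>b\<close> if \<open>j < i\<close>. Hence the right-hand side, which depends
  only on \<open>\<Delta>(x)\<close>, computes the pairing of the class of any such representation of \<open>\<Delta>(x)\<close>.\<close>

lemma pairing_gr_terms:
  assumes F: "\<And>n. F n \<in> annihilator k B (lower n)"
      "\<And>n x. x \<in> filt n \<Longrightarrow> F n x = f (gr_elem k B n x)"
    and H: "\<And>n. H n \<in> annihilator k B (lower n)"
      "\<And>n x. x \<in> filt n \<Longrightarrow> H n x = h (gr_elem k B n x)"
    and ws: "\<forall>(i, a, b)\<in>set ws. i \<le> n \<and> a \<in> filt i \<and> b \<in> filt (n - i)"
  shows "pairing k f h (map (\<lambda>(i, a, b). (gr_elem k B i a, gr_elem k B (n - i) b)) ws) =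
    (\<Oplus>\<^bsub>k\<^esub>j\<in>{..n}. pairing k (F j) (H (n - j)) (map snd ws))"
  using ws
proof (induction ws)
  case Nil
  show ?case by (simp add: pairing_def)
next
  case (Cons w ws)
  obtain i a b where w: "w = (i, a, b)" by (cases w)
  have iab: "i \<le> n" "a \<in> filt i" "b \<in> filt (n - i)" using Cons.prems w by auto
  note Fd = annihilatorD(1)[OF F(1)] and Hd = annihilatorD(1)[OF H(1)]
  have c: "a \<in> carrier B" "b \<in> carrier B" using iab filt_closed by blast+
  have p: "set (map snd ws) \<subseteq> AA.pairs" using Cons.prems filt_closed by (force simp del: coradical_filt.simps)
  have z: "F j a \<otimes>\<^bsub>k\<^esub> H (n - j) b = (if i = j then F j a \<otimes>\<^bsub>k\<^esub> H (n - j) b else \<zero>\<^bsub>k\<^esub>)" if "j \<le> n" for j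
  proof -
    consider "i = j" | "i < j" | "j < i" by linarith
    then show ?thesis
    proof cases
      case 2
      then have "F j a = \<zero>\<^bsub>k\<^esub>" using filt_subset_lower iab(2) annihilatorD(2)[OF F(1)] by blast
      then show ?thesis using 2 dual_closed[OF Hd c(2)] by simp
    next
      case 3
      then have "n - i < n - j" using iab by simp
      then have "H (n - j) b = \<zero>\<^bsub>k\<^esub>" using filt_subset_lower iab(3) annihilatorD(2)[OF H(1)] by blast
      then show ?thesis using 3 dual_closed[OF Fd c(1)] by simp
    qed simp
  qed
  have "f (gr_elem k B i a) \<otimes>\<^bsub>k\<^esub> h (gr_elem k B (n - i) b) = F i a \<otimes>\<^bsub>k\<^esub> H (n - i) b"
    using F(2)[OF iab(2)] H(2)[OF iab(3)] by simp
  also have "\<dots> = (\<Oplus>\<^bsub>k\<^esub>j\<in>{..n}. if i = j then F j a \<otimes>\<^bsub>k\<^esub> H (n - j) b else \<zero>\<^bsub>k\<^esub>)"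
    by (rule R.finsum_singleton[symmetric])
      (use iab(1) dual_closed[OF Fd c(1)] dual_closed[OF Hd c(2)] in auto)
  also have "\<dots> = (\<Oplus>\<^bsub>k\<^esub>j\<in>{..n}. F j a \<otimes>\<^bsub>k\<^esub> H (n - j) b)"
    by (rule R.finsum_cong'[symmetric])
      (use z dual_closed[OF Fd c(1)] dual_closed[OF Hd c(2)] in auto)
  finally have 1: "f (gr_elem k B i a) \<otimes>\<^bsub>k\<^esub> h (gr_elem k B (n - i) b) = \<dots>" .
  have 2: "pairing k f h (map (\<lambda>(i, a, b). (gr_elem k B i a, gr_elem k B (n - i) b)) ws) =
    (\<Oplus>\<^bsub>k\<^esub>j\<in>{..n}. pairing k (F j) (H (n - j)) (map snd ws))"
    by (rule Cons.IH) (use Cons.prems in auto)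
  have "(\<Oplus>\<^bsub>k\<^esub>j\<in>{..n}. F j a \<otimes>\<^bsub>k\<^esub> H (n - j) b \<oplus>\<^bsub>k\<^esub>
      pairing k (F j) (H (n - j)) (map snd ws)) =
    (\<Oplus>\<^bsub>k\<^esub>j\<in>{..n}. F j a \<otimes>\<^bsub>k\<^esub> H (n - j) b) \<oplus>\<^bsub>k\<^esub>
    (\<Oplus>\<^bsub>k\<^esub>j\<in>{..n}. pairing k (F j) (H (n - j)) (map snd ws))"
    by (rule R.finsum_addf)
      (use dual_closed[OF Fd c(1)] dual_closed[OF Hd c(2)] AA.pairing_closed[OF Fd Hd p] in auto)
  then show ?case using 1 2 by (simp add: w)
qed

text \<open>Any admissible decomposition of \<Delta>(x) may be used: by
  \<open>pairing_gr_terms\<close> the pairings of the resulting tensor depend on \<Delta>(x) alone,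
  so the definite description has one solution.\<close>

lemma gr_comult_hom_eq:
  assumes ws: "\<forall>(i, a, b)\<in>set ws. i \<le> n \<and> a \<in> filt i \<and> b \<in> filt (n - i)"
    and x: "comult B x = AA.TS (map snd ws)"
  shows "gr_comult_hom k B n x =
    PP.TS (map (\<lambda>(i, a, b). (gr_elem k B i a, gr_elem k B (n - i) b)) ws)"
proof -
  let ?g = "\<lambda>ws. map (\<lambda>(i, a, b). (gr_elem k B i a, gr_elem k B (n - i) b)) ws"
  let ?e = "\<lambda>ws :: (nat \<times> 'b \<times> 'b) list. map snd ws"
  have cl: "set (?g ws) \<subseteq> PP.pairs" "set (?e ws) \<subseteq> AA.pairs"
    if "\<forall>(i, a, b)\<in>set ws. i \<le> n \<and> a \<in> filt i \<and> b \<in> filt (n - i)" for ws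
    using that filt_closed by (fastforce simp del: coradical_filt.simps)+
  have uniq: "PP.TS (?g ws') = PP.TS (?g ws)"
    if ws': "\<forall>(i, a, b)\<in>set ws'. i \<le> n \<and> a \<in> filt i \<and> b \<in> filt (n - i)"
      and eq: "AA.TS (?e ws) = AA.TS (?e ws')" for ws'
  proof (rule PP.tensor_sum_eqI[OF cl(1)[OF ws'] cl(1)[OF ws]])
    fix f h assume f: "f \<in> dual k CP" and h: "h \<in> dual k CP"
    obtain F where F: "\<And>n. F n \<in> annihilator k B (lower n)"
      "\<And>n x. x \<in> filt n \<Longrightarrow> F n x = f (gr_elem k B n x)" using gr_functionals[OF f] by blast
    obtain H where H: "\<And>n. H n \<in> annihilator k B (lower n)"
      "\<And>n x. x \<in> filt n \<Longrightarrow> H n x = h (gr_elem k B n x)" using gr_functionals[OF h] by blast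
    have "pairing k (F j) (H (n - j)) (?e ws') = pairing k (F j) (H (n - j)) (?e ws)" for j
      using AA.tensor_eq_pairing[OF AA.tensor_sum_eqD[OF cl(2)[OF ws] eq]
          annihilatorD(1)[OF F(1)] annihilatorD(1)[OF H(1)]] by simp
    then show "pairing k f h (?g ws') = pairing k f h (?g ws)"
      using pairing_gr_terms[OF F H ws'] pairing_gr_terms[OF F H ws] by simp
  qed
  show ?thesis
    unfolding gr_comult_hom_def terms_snd
  proof (rule the_equality)
    show "\<exists>ws'. (\<forall>(i, a, b)\<in>set ws'. i \<le> n \<and> a \<in> filt i \<and> b \<in> filt (n - i)) \<and>
        comult B x = AA.TS (?e ws') \<and> PP.TS (?g ws) = PP.TS (?g ws')"
      using ws x by blast
    show "t = PP.TS (?g ws)" if "\<exists>ws'. (\<forall>(i, a, b)\<in>set ws'. i \<le> n \<and> a \<in> filt i \<and> b \<in> filt (n - i)) \<and>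
        comult B x = AA.TS (?e ws') \<and> t = PP.TS (?g ws')" for t
      using that uniq x by auto
  qed
qed

lemma gr_comult_hom_pairing:
  assumes F: "\<And>n. F n \<in> annihilator k B (lower n)"
      "\<And>n x. x \<in> filt n \<Longrightarrow> F n x = f (gr_elem k B n x)"
    and H: "\<And>n. H n \<in> annihilator k B (lower n)"
      "\<And>n x. x \<in> filt n \<Longrightarrow> H n x = h (gr_elem k B n x)"
    and fh: "f \<in> dual k CP" "h \<in> dual k CP"
    and x: "x \<in> filt n"
  shows "gr_comult_hom k B n x \<in> carrier PP.T"
    and "tensor_pairing k f h (gr_comult_hom k B n x) = (\<Oplus>\<^bsub>k\<^esub>j\<in>{..n}. conv k B (F j) (H (n - j)) x)"
proof -
  obtain ws where ws: "\<forall>(i, a, b)\<in>set ws. i \<le> n \<and> a \<in> filt i \<and> b \<in> filt (n - i)"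
    and \<Delta>: "comult B x = AA.TS (map snd ws)"
    using comult_filt[OF x] unfolding terms_snd by blast
  have cl: "set (map (\<lambda>(i, a, b). (gr_elem k B i a, gr_elem k B (n - i) b)) ws) \<subseteq> PP.pairs"
    and cl': "set (map snd ws) \<subseteq> AA.pairs"
    using ws filt_closed by (fastforce simp del: coradical_filt.simps)+
  note eq = gr_comult_hom_eq[OF ws \<Delta>]
  show "gr_comult_hom k B n x \<in> carrier PP.T" unfolding eq using cl by simp
  show "tensor_pairing k f h (gr_comult_hom k B n x) = (\<Oplus>\<^bsub>k\<^esub>j\<in>{..n}. conv k B (F j) (H (n - j)) x)"
    unfolding eq PP.tensor_pairing_sum[OF fh cl]
      conv_sum[OF annihilatorD(1)[OF F(1)] annihilatorD(1)[OF H(1)] cl' \<Delta>]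
    by (rule pairing_gr_terms[OF F H ws])
qed

abbreviation "supp u \<equiv> {n. u n \<noteq> cls n \<zero>\<^bsub>B\<^esub>}"

lemma finite_supp: "u \<in> carrier CP \<Longrightarrow> finite (supp u)"
  by (simp add: gr_poisson_def)

lemma comult_gr: "comult C u = finsum PP.T (\<lambda>n. gr_comult_hom k B n (representative (u n))) (supp u)"
  by (simp add: gr_def poisson.defs)

lemma gr_sum:
  assumes u: "u \<in> carrier CP" and f: "f \<in> dual k CP"
  shows "f u = (\<Oplus>\<^bsub>k\<^esub>n\<in>supp u. f (gr_elem k B n (representative (u n))))"
proof -
  note uD = componentsD[OF gr_representative(1)[OF u]]
  have "finsum CP (\<lambda>n. gr_elem k B n (representative (u n))) S =
      grf (\<lambda>m. if m \<in> S then representative (u m) else \<zero>\<^bsub>B\<^esub>)" if "finite S" for S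
    using that
  proof (induction S rule: finite_induct)
    case empty
    show ?case by (simp add: gr_zero)
  next
    case (insert a S)
    have "finsum CP (\<lambda>n. gr_elem k B n (representative (u n))) (insert a S) =
        grf (\<lambda>m. if m = a then representative (u a) else \<zero>\<^bsub>B\<^esub>) \<oplus>\<^bsub>CP\<^esub>
        grf (\<lambda>m. if m \<in> S then representative (u m) else \<zero>\<^bsub>B\<^esub>)"
      using insert uD(1) by (subst CP.M.finsum_insert) (auto simp: gr_elem_eq[symmetric])
    also have "\<dots> = grf (\<lambda>m. if m \<in> insert a S then representative (u m) else \<zero>\<^bsub>B\<^esub>)"
      using insert.hyps uD(2) by (subst gr_add) (auto intro!: arg_cong[of _ _ grf])
    finally show ?case .
  qed
  from this[OF finite_supp[OF u]]
  have "finsum CP (\<lambda>n. gr_elem k B n (representative (u n))) (supp u) = u"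
    using gr_representative(2)[OF u] by (auto simp: grf_def fun_eq_iff)
  then show ?thesis
    using CP.dual_finsum[OF f finite_supp[OF u], of "\<lambda>n. gr_elem k B n (representative (u n))"] uD(1)
    by (auto simp del: coradical_filt.simps)
qed

section \<open>The coinvariants\<close>

lemma gr_proj_linear: "linear_map k CP C0 (gr_proj k B)"
proof (rule linear_mapI)
  have eq: "gr_proj k B (grf x) = gr_elem k B 0 (x 0)" for x
    by (simp add: gr_proj_def grf_def gr_elem_def fun_eq_iff)
  fix u assume "u \<in> carrier CP"
  then obtain x where x: "x \<in> components" "u = grf x" by (rule grE)
  note xD = componentsD[OF x(1)]
  show "gr_proj k B u \<in> carrier C0"
    unfolding x(2) eq by (rule gr_elem_zero_closed[OF xD(1)])
  show "gr_proj k B (r \<odot>\<^bsub>CP\<^esub> u) = r \<odot>\<^bsub>C0\<^esub> gr_proj k B u" if r: "r \<in> carrier k" for r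
    unfolding x(2) gr_smult[OF r xD(2)] eq using gr_elem_smult[OF r xD(1)] by simp
  fix v assume "v \<in> carrier CP"
  then obtain y where y: "y \<in> components" "v = grf y" by (rule grE)
  note yD = componentsD[OF y(1)]
  show "gr_proj k B (u \<oplus>\<^bsub>CP\<^esub> v) = gr_proj k B u \<oplus>\<^bsub>C0\<^esub> gr_proj k B v"
    unfolding x(2) y(2) gr_add[OF xD(2) yD(2)] eq using gr_elem_add[OF xD(1) yD(1)] by simp
qed

text \<open>The bridge between the coinvariants of C and \<open>coinv\<close>. The functional h
  after \<pi> sees degree 0 only, so in the sum of the F_j * K_{n-j} just j = n survives, and
  component n of u contributes F_n * H at its representative.\<close>

lemma id_proj_comult:
  assumes u: "u \<in> carrier CP" and f: "f \<in> dual k C" and h: "h \<in> dual k C0"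
    and F: "\<And>n. F n \<in> annihilator k B (lower n)"
      "\<And>n x. x \<in> filt n \<Longrightarrow> F n x = f (gr_elem k B n x)"
    and H: "H \<in> dual k B" "\<And>x. x \<in> filt 0 \<Longrightarrow> H x = h (gr_elem k B 0 x)"
  shows "tensor_map k C C0 id (gr_proj k B) (comult C u) \<in> carrier PC.T"
    and "tensor_pairing k f h (tensor_map k C C0 id (gr_proj k B) (comult C u)) =
      (\<Oplus>\<^bsub>k\<^esub>n\<in>supp u. conv k B (F n) H (representative (u n)))"
proof -
  note uD = componentsD[OF gr_representative(1)[OF u]]
  have f': "f \<in> dual k CP" using f dual_gr by simp
  have h': "(\<lambda>v. h (gr_proj k B v)) \<in> dual k CP" by (rule dual_comp[OF gr_proj_linear h])
  \<comment> \<open>The family on B that belongs to h after \<pi>: since \<pi> vanishes in positive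
    degree, only degree 0 carries H.\<close>
  define K where "K n = (if n = 0 then H else (\<lambda>_. \<zero>\<^bsub>k\<^esub>))" for n :: nat
  have K1: "K n \<in> annihilator k B (lower n)" for n
    using H(1) zero_in_dual dual_zero[OF H(1)] by (auto simp: K_def annihilator_def)
  have K2: "K n x = h (gr_proj k B (gr_elem k B n x))" if "x \<in> filt n" for n x
  proof (cases "n = 0")
    case True
    then have "gr_proj k B (gr_elem k B n x) = gr_elem k B 0 x"
      by (simp add: gr_proj_def gr_elem_def fun_eq_iff)
    then show ?thesis using True H(2) that by (simp add: K_def del: coradical_filt.simps)
  next
    case False
    then have "gr_proj k B (gr_elem k B n x) = \<zero>\<^bsub>C0\<^esub>"
      by (simp add: gr_proj_def gr_elem_def gr_zero grf_def fun_eq_iff)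
    then show ?thesis using False C0.dual_zero[OF h] by (simp add: K_def)
  qed
  note hom = gr_comult_hom_pairing[OF F K1 K2 f' h']
  have T: "comult C u \<in> carrier PP.T"
    unfolding comult_gr using hom(1) uD(1) by (intro PP.T.M.finsum_closed) blast
  then obtain us where us: "set us \<subseteq> PP.pairs" "comult C u = PP.TS us" by (rule PP.tensorE)
  have id: "linear_map k CP C id" by (simp add: linear_map_def)
  have map: "tensor_map k C C0 id (gr_proj k B) (comult C u) = PC.TS (map (\<lambda>(a, b). (id a, gr_proj k B b)) us)"
    unfolding us(2)
    by (rule tensor_map_sum[OF PP.linear_space_pair_axioms PC.linear_space_pair_axioms id gr_proj_linear us(1)])
  have cl: "set (map (\<lambda>(a, b). (id a, gr_proj k B b)) us) \<subseteq> PC.pairs"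
    using us(1) linear_mapD(1)[OF gr_proj_linear] by auto
  then show "tensor_map k C C0 id (gr_proj k B) (comult C u) \<in> carrier PC.T" unfolding map by simp
  have "tensor_pairing k f h (tensor_map k C C0 id (gr_proj k B) (comult C u)) =
      pairing k f h (map (\<lambda>(a, b). (id a, gr_proj k B b)) us)"
    unfolding map by (rule PC.tensor_pairing_sum[OF f h cl])
  also have "\<dots> = pairing k f (\<lambda>v. h (gr_proj k B v)) us"
    by (simp add: pairing_def lsum_map)
  also have "\<dots> = tensor_pairing k f (\<lambda>v. h (gr_proj k B v)) (comult C u)"
    unfolding us(2) by (rule PP.tensor_pairing_sum[OF f' h' us(1), symmetric])
  also have "\<dots> = (\<Oplus>\<^bsub>k\<^esub>n\<in>supp u. tensor_pairing k f (\<lambda>v. h (gr_proj k B v))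
      (gr_comult_hom k B n (representative (u n))))"
    unfolding comult_gr
    by (rule PP.T.dual_finsum[OF PP.tensor_pairing_dual[OF f' h'] finite_supp[OF u]])
      (use hom(1) uD(1) in blast)
  also have "\<dots> = (\<Oplus>\<^bsub>k\<^esub>n\<in>supp u. conv k B (F n) H (representative (u n)))"
  proof (rule R.finsum_cong')
    fix n
    let ?x = "representative (u n)"
    note Fd = annihilatorD(1)[OF F(1)] and Kd = annihilatorD(1)[OF K1]
    obtain xs where xs: "set xs \<subseteq> AA.pairs" "comult B ?x = AA.TS xs" using uD(2) by (rule comultE)
    have z: "conv k B (F j) (K (n - j)) ?x = (if n = j then conv k B (F j) (K (n - j)) ?x else \<zero>\<^bsub>k\<^esub>)"
      if "j \<le> n" for j
    proof (cases "n = j")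
      case False
      then have "K (n - j) = (\<lambda>_. \<zero>\<^bsub>k\<^esub>)" using that by (simp add: K_def)
      then have "pairing k (F j) (K (n - j)) xs = \<zero>\<^bsub>k\<^esub>"
        unfolding pairing_def using xs(1) dual_closed[OF Fd] by (auto intro!: R.lsum_zero)
      then show ?thesis using False conv_sum[OF Fd Kd xs] by simp
    qed simp
    have "(\<Oplus>\<^bsub>k\<^esub>j\<in>{..n}. conv k B (F j) (K (n - j)) ?x) =
        (\<Oplus>\<^bsub>k\<^esub>j\<in>{..n}. if n = j then conv k B (F j) (K (n - j)) ?x else \<zero>\<^bsub>k\<^esub>)"
      by (rule R.finsum_cong') (use z dual_closed[OF conv_dual[OF Fd Kd] uD(2)] in auto)
    also have "\<dots> = conv k B (F n) (K (n - n)) ?x"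
      by (rule R.finsum_singleton) (use dual_closed[OF conv_dual[OF Fd Kd] uD(2)] in auto)
    finally show "tensor_pairing k f (\<lambda>v. h (gr_proj k B v)) (gr_comult_hom k B n ?x) = conv k B (F n) H ?x"
      using hom(2)[OF _ _ uD(1)] by (simp add: K_def)
  qed (use dual_closed[OF conv_dual[OF annihilatorD(1)[OF F(1)] H(1)] uD(2)] in auto)
  finally show "tensor_pairing k f h (tensor_map k C C0 id (gr_proj k B) (comult C u)) =
      (\<Oplus>\<^bsub>k\<^esub>n\<in>supp u. conv k B (F n) H (representative (u n)))" .
qed

lemma one_filt: "\<one>\<^bsub>B\<^esub> \<in> filt 0"
  using grouplike_coradical[OF one_grouplike] by simp

text \<open>Tested against f \<otimes> h, the left side is a sum of terms F_n * H. Coinvariance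
  makes them F_n(u_n) H(1), and these add up to f(u) h(1).\<close>

lemma coinv_imp_coinvariants:
  assumes "u \<in> gr_coinv \<one>\<^bsub>B\<^esub>"
  shows "u \<in> gr_coinvariants k B"
proof -
  note u = gr_coinvD[OF assms]
  note uD = componentsD[OF u(3)]
  have one: "\<one>\<^bsub>C0\<^esub> \<in> carrier C0" using gr_elem_zero_closed[OF one_filt] by (simp add: gr_one)
  have exF: "\<exists>F. (\<forall>n. F n \<in> annihilator k B (lower n)) \<and> (\<forall>n. \<forall>x\<in>filt n. F n x = f (gr_elem k B n x))"
    if "f \<in> dual k CP" for f using gr_functionals[OF that] by metis
  have exH: "\<exists>H\<in>dual k B. \<forall>x\<in>filt 0. H x = h (gr_elem k B 0 x)" if h: "h \<in> dual k C0" for h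
  proof -
    have "linear_map k (B\<lparr>carrier := filt 0\<rparr>) C0 (gr_elem k B 0)"
      using linear_mapD[OF gr_elem_linear[of 0]] gr_elem_zero_closed by (intro linear_mapI) auto
    then have "(\<lambda>x. h (gr_elem k B 0 x)) \<in> dual k (B\<lparr>carrier := filt 0\<rparr>)" using h by (rule dual_comp)
    \<comment> \<open>With an empty X this is plain extension from B_0 to B: in degree 0 the
      subspace divided out is zero.\<close>
    then obtain H where "H \<in> annihilator k B {}" "\<And>x. x \<in> filt 0 \<Longrightarrow> H x = h (gr_elem k B 0 x)"
      using extend_functional[OF submodule_filt[of 0], of "{}" "\<lambda>x. h (gr_elem k B 0 x)"] by blast
    then show ?thesis using annihilatorD(1) by blast
  qed
  have pair: "tensor_pairing k f h (tensor_map k C C0 id (gr_proj k B) (comult C u)) =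
      tensor_pairing k f h (pure_tensor k C C0 u \<one>\<^bsub>C0\<^esub>) \<and>
      tensor_map k C C0 id (gr_proj k B) (comult C u) \<in> carrier PC.T"
    if f: "f \<in> dual k C" and h: "h \<in> dual k C0" for f h
  proof -
    have f': "f \<in> dual k CP" using f dual_gr by simp
    obtain F where F: "\<And>n. F n \<in> annihilator k B (lower n)"
      "\<And>n x. x \<in> filt n \<Longrightarrow> F n x = f (gr_elem k B n x)" using exF[OF f'] by metis
    obtain H where H: "H \<in> dual k B" "\<And>x. x \<in> filt 0 \<Longrightarrow> H x = h (gr_elem k B 0 x)"
      using exH[OF h] by metis
    note Fd = annihilatorD(1)[OF F(1)]
    have Fc: "F n (representative (u n)) \<in> carrier k" for n using dual_closed[OF Fd uD(2)] .
    have Hc: "H \<one>\<^bsub>B\<^esub> \<in> carrier k" using dual_closed[OF H(1)] by simp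
    have "(\<Oplus>\<^bsub>k\<^esub>n\<in>supp u. conv k B (F n) H (representative (u n))) =
        (\<Oplus>\<^bsub>k\<^esub>n\<in>supp u. F n (representative (u n)) \<otimes>\<^bsub>k\<^esub> H \<one>\<^bsub>B\<^esub>)"
      by (rule R.finsum_cong') (use u(2) F(1) H(1) Fc Hc in \<open>auto simp: coinv_def\<close>)
    also have "\<dots> = (\<Oplus>\<^bsub>k\<^esub>n\<in>supp u. F n (representative (u n))) \<otimes>\<^bsub>k\<^esub> H \<one>\<^bsub>B\<^esub>"
      by (rule R.finsum_ldistr[symmetric]) (use finite_supp[OF u(1)] Hc Fc in auto)
    also have "(\<Oplus>\<^bsub>k\<^esub>n\<in>supp u. F n (representative (u n))) = f u"
      using gr_sum[OF u(1) f'] F(2)[OF uD(1)] by simp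
    also have "H \<one>\<^bsub>B\<^esub> = h \<one>\<^bsub>C0\<^esub>" using H(2)[OF one_filt] by (simp add: gr_one)
    finally show ?thesis
      using id_proj_comult[OF u(1) f h F H] PC.tensor_pairing_pure[OF f h _ one] u(1) by simp
  qed
  have "tensor_map k C C0 id (gr_proj k B) (comult C u) = pure_tensor k C C0 u \<one>\<^bsub>C0\<^esub>"
  proof (rule PC.tensor_ext)
    \<comment> \<open>Membership was proved along with the equality of pairings; the zero
      functionals serve to extract it.\<close>
    show "tensor_map k C C0 id (gr_proj k B) (comult C u) \<in> carrier PC.T"
      using pair[OF C.zero_in_dual C0.zero_in_dual] by blast
    show "pure_tensor k C C0 u \<one>\<^bsub>C0\<^esub> \<in> carrier PC.T" using u(1) one by (intro PC.pure_closed) simp_all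
  qed (use pair in blast)
  then show ?thesis using u(1) by (simp add: gr_coinvariants_def)
qed

text \<open>The reverse of \<open>gr_functionals\<close>: since f kills \<open>lower n\<close>, its
  value does not depend on the representative, and so it is linear on C.\<close>

lemma component_functional:
  assumes f: "f \<in> annihilator k B (lower n)"
  shows "(\<lambda>u. f (representative (u n))) \<in> dual k CP"
    and "x \<in> carrier B \<Longrightarrow> f (representative (cls n x)) = f x"
proof -
  note fd = annihilatorD(1)[OF f]
  have eq: "f (representative (cls n x)) = f x" if x: "x \<in> carrier B" for x
  proof -
    obtain h where h: "h \<in> lower n" "representative (cls n x) = h \<oplus>\<^bsub>B\<^esub> x"
      using x by (rule representative_cls)
    then show ?thesis using x lower_closed[OF h(1)] annihilatorD(2)[OF f h(1)] fd by simp
  qed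
  then show "x \<in> carrier B \<Longrightarrow> f (representative (cls n x)) = f x" .
  show "(\<lambda>u. f (representative (u n))) \<in> dual k CP"
  proof (rule dualI)
    fix u assume "u \<in> carrier CP"
    then obtain x where x: "x \<in> components" "u = grf x" by (rule grE)
    note xD = componentsD(2)[OF x(1)]
    show "f (representative (u n)) \<in> carrier k" using dual_closed[OF fd] xD by (simp add: x(2) grf_def)
    show "f (representative ((r \<odot>\<^bsub>CP\<^esub> u) n)) = r \<otimes>\<^bsub>k\<^esub> f (representative (u n))" if r: "r \<in> carrier k" for r
      unfolding x(2) gr_smult[OF r xD] using r xD fd by (simp add: grf_def eq)
    fix v assume "v \<in> carrier CP"
    then obtain y where y: "y \<in> components" "v = grf y" by (rule grE)
    note yD = componentsD(2)[OF y(1)]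
    show "f (representative ((u \<oplus>\<^bsub>CP\<^esub> v) n)) = f (representative (u n)) \<oplus>\<^bsub>k\<^esub> f (representative (v n))"
      unfolding x(2) y(2) gr_add[OF xD yD] using xD yD fd by (simp add: grf_def eq)
  qed
qed

text \<open>The test functionals are concentrated in one degree: \<phi> reads component n through f
  and \<psi> reads component 0 through g. The sum in \<open>id_proj_comult\<close> then has a single
  nonzero term.\<close>

lemma coinvariants_imp_coinv:
  assumes "u \<in> gr_coinvariants k B"
  shows "u \<in> gr_coinv \<one>\<^bsub>B\<^esub>"
proof -
  have u: "u \<in> carrier CP"
    and eq: "tensor_map k C C0 id (gr_proj k B) (comult C u) = pure_tensor k C C0 u \<one>\<^bsub>C0\<^esub>"
    using assms by (auto simp: gr_coinvariants_def)
  note uD = componentsD[OF gr_representative(1)[OF u]]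
  have one: "\<one>\<^bsub>C0\<^esub> \<in> carrier C0" using gr_elem_zero_closed[OF one_filt] by (simp add: gr_one)
  have "coinv \<one>\<^bsub>B\<^esub> n (representative (u n))" for n
  proof (cases "n \<in> supp u")
    \<comment> \<open>Outside the support the representative need not be 0, but it lies in
      \<open>lower n\<close>.\<close>
    case False
    then have "representative (u n) \<in> lower n"
      using cls_lower[OF uD(2), of n n] fun_cong[OF gr_representative(2)[OF u], of n] by (simp add: grf_def)
    then show ?thesis by (intro coinv_lower) simp_all
  next
    case True
    show ?thesis
      unfolding coinv_def
    proof (intro conjI ballI uD(1))
      fix f g assume f: "f \<in> annihilator k B (lower n)" and g: "g \<in> dual k B"
      note fd = annihilatorD(1)[OF f]
      define \<phi> where "\<phi> v = f (representative (v n))" for v :: "nat \<Rightarrow> 'b set"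
      define \<psi> where "\<psi> v = g (representative (v 0))" for v :: "nat \<Rightarrow> 'b set"
      define F where "F m = (if m = n then f else (\<lambda>_. \<zero>\<^bsub>k\<^esub>))" for m
      \<comment> \<open>As \<open>lower 0\<close> is zero, every functional on B induces one on
        component 0.\<close>
      have g0: "g \<in> annihilator k B (lower 0)" using g dual_zero[OF g] by (simp add: annihilator_def)
      have \<phi>: "\<phi> \<in> dual k C"
        using component_functional(1)[OF f] by (simp add: dual_gr \<phi>_def[abs_def])
      have \<psi>: "\<psi> \<in> dual k C0"
      proof (rule dualI)
        have d: "\<psi> \<in> dual k CP" using component_functional(1)[OF g0] by (simp add: \<psi>_def[abs_def])
        fix u assume "u \<in> carrier C0"
        then have u: "u \<in> carrier CP" by (simp add: gr_zero_carrier)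
        show "\<psi> u \<in> carrier k" using CP.dual_closed[OF d u] .
        show "\<psi> (r \<odot>\<^bsub>C0\<^esub> u) = r \<otimes>\<^bsub>k\<^esub> \<psi> u" if "r \<in> carrier k" for r
          using CP.dual_smult[OF d that u] by simp
        fix v assume "v \<in> carrier C0"
        then have v: "v \<in> carrier CP" by (simp add: gr_zero_carrier)
        show "\<psi> (u \<oplus>\<^bsub>C0\<^esub> v) = \<psi> u \<oplus>\<^bsub>k\<^esub> \<psi> v" using CP.dual_add[OF d u v] by simp
      qed
      have F1: "F m \<in> annihilator k B (lower m)" for m
        using f zero_in_dual by (simp add: F_def annihilator_def)
      have F2: "F m x = \<phi> (gr_elem k B m x)" if "x \<in> filt m" for m x
        using component_functional(2)[OF f, of "if n = m then x else \<zero>\<^bsub>B\<^esub>"] filt_closed[OF that]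
          dual_zero[OF fd] by (simp add: F_def \<phi>_def gr_elem_def)
      have H2: "g x = \<psi> (gr_elem k B 0 x)" if "x \<in> filt 0" for x
        using component_functional(2)[OF g0 filt_closed[OF that]] by (simp add: \<psi>_def gr_elem_def)
      have cc: "conv k B f g (representative (u m)) \<in> carrier k" for m
        using dual_closed[OF conv_dual[OF fd g] uD(2)] .
      have zz: "conv k B (\<lambda>_. \<zero>\<^bsub>k\<^esub>) g (representative (u m)) = \<zero>\<^bsub>k\<^esub>" for m
      proof -
        obtain xs where xs: "set xs \<subseteq> AA.pairs" "comult B (representative (u m)) = AA.TS xs"
          using uD(2) by (rule comultE)
        have "pairing k (\<lambda>_. \<zero>\<^bsub>k\<^esub>) g xs = \<zero>\<^bsub>k\<^esub>"
          unfolding pairing_def using xs(1) dual_closed[OF g] by (auto intro!: R.lsum_zero)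
        then show ?thesis using conv_sum[OF zero_in_dual g xs] by simp
      qed
      have "\<phi> u \<otimes>\<^bsub>k\<^esub> \<psi> \<one>\<^bsub>C0\<^esub> = tensor_pairing k \<phi> \<psi> (pure_tensor k C C0 u \<one>\<^bsub>C0\<^esub>)"
        using PC.tensor_pairing_pure[OF \<phi> \<psi> _ one] u by simp
      also have "\<dots> = (\<Oplus>\<^bsub>k\<^esub>m\<in>supp u. conv k B (F m) g (representative (u m)))"
        unfolding eq[symmetric] by (rule id_proj_comult(2)[OF u \<phi> \<psi> F1 F2 g H2])
      also have "\<dots> = (\<Oplus>\<^bsub>k\<^esub>m\<in>supp u. if n = m then conv k B f g (representative (u m)) else \<zero>\<^bsub>k\<^esub>)"
        by (rule R.finsum_cong') (use cc zz in \<open>auto simp: F_def\<close>)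
      also have "\<dots> = conv k B f g (representative (u n))"
        by (rule R.finsum_singleton) (use True finite_supp[OF u] cc in auto)
      finally have "conv k B f g (representative (u n)) = \<phi> u \<otimes>\<^bsub>k\<^esub> \<psi> \<one>\<^bsub>C0\<^esub>" by simp
      then show "conv k B f g (representative (u n)) = f (representative (u n)) \<otimes>\<^bsub>k\<^esub> g \<one>\<^bsub>B\<^esub>"
        using H2[OF one_filt] by (simp add: \<phi>_def gr_one)
    qed
  qed
  then show ?thesis using u by (simp add: gr_coinv_def)
qed

lemma gr_coinvariants_eq: "gr_coinvariants k B = gr_coinv \<one>\<^bsub>B\<^esub>"
  using coinv_imp_coinvariants coinvariants_imp_coinv by blast

section \<open>The Poisson subalgebra and the action of group-likes\<close>

lemma submodule_gr_coinv:
  assumes h: "h \<in> carrier B"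
  shows "submodule (gr_coinv h) k C"
proof -
  have grE: "\<exists>x. x \<in> components \<and> (\<forall>n. coinv h n (x n)) \<and> u = grf x" if "u \<in> gr_coinv h" for u
    using gr_coinvD[OF that] by (intro exI[of _ "\<lambda>n. representative (u n)"]) auto
  note S = submoduleE[OF submodule_coinv[OF h]]
  show ?thesis
  proof (rule C.submoduleI)
    show "gr_coinv h \<subseteq> carrier C" using gr_coinvD(1) by auto
    show "\<zero>\<^bsub>C\<^esub> \<in> gr_coinv h"
      using grf_coinv[OF h components_zero] coinv_lower[OF h lower_zero] by (simp add: gr_zero)
    fix u assume u: "u \<in> gr_coinv h"
    then obtain x where x: "x \<in> components" "\<And>n. coinv h n (x n)" "u = grf x" using grE by blast
    note xD = componentsD(2)[OF x(1)]
    show s: "r \<odot>\<^bsub>C\<^esub> u \<in> gr_coinv h" if r: "r \<in> carrier k" for r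
      using grf_coinv[OF h components_smult[OF r x(1)]] S(4)[OF r] x(2) gr_smult[OF r xD]
      by (simp add: x(3))
    have "\<ominus>\<^bsub>C\<^esub> u = (\<ominus>\<^bsub>k\<^esub> \<one>\<^bsub>k\<^esub>) \<odot>\<^bsub>C\<^esub> u"
      using gr_coinvD(1)[OF u] C.smult_l_minus[of "\<one>\<^bsub>k\<^esub>" u] C.smult_one[of u] by simp
    then show "\<ominus>\<^bsub>C\<^esub> u \<in> gr_coinv h" using s[of "\<ominus>\<^bsub>k\<^esub> \<one>\<^bsub>k\<^esub>"] by simp
    fix v assume "v \<in> gr_coinv h"
    then obtain y where y: "y \<in> components" "\<And>n. coinv h n (y n)" "v = grf y" using grE by blast
    note yD = componentsD(2)[OF y(1)]
    show "u \<oplus>\<^bsub>C\<^esub> v \<in> gr_coinv h"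
      using grf_coinv[OF h components_add[OF x(1) y(1)]] S(5) x(2) y(2) gr_add[OF xD yD]
      by (simp add: x(3) y(3))
  qed
qed

lemma poisson_subalgebra_coinvariants: "poisson_subalgebra k C (gr_coinvariants k B)"
  unfolding gr_coinvariants_eq poisson_subalgebra_def
proof (intro conjI ballI)
  have one: "\<one>\<^bsub>B\<^esub> \<in> carrier B" by simp
  show sub: "submodule (gr_coinv \<one>\<^bsub>B\<^esub>) k C" by (rule submodule_gr_coinv[OF one])
  show "subring (gr_coinv \<one>\<^bsub>B\<^esub>) C"
  proof (intro subring.intro submodule.axioms(1)[OF sub] submonoid.intro)
    show "gr_coinv \<one>\<^bsub>B\<^esub> \<subseteq> carrier C" using gr_coinvD(1) by auto
    show "\<one>\<^bsub>C\<^esub> \<in> gr_coinv \<one>\<^bsub>B\<^esub>" using gr_elem_coinv[OF one_grouplike] by (simp add: gr_one)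
    show "u \<otimes>\<^bsub>C\<^esub> v \<in> gr_coinv \<one>\<^bsub>B\<^esub>" if "u \<in> gr_coinv \<one>\<^bsub>B\<^esub>" "v \<in> gr_coinv \<one>\<^bsub>B\<^esub>" for u v
      using gr_coinv_mult[OF one one that] by simp
  qed
  show "bracket C u v \<in> gr_coinv \<one>\<^bsub>B\<^esub>" if "u \<in> gr_coinv \<one>\<^bsub>B\<^esub>" "v \<in> gr_coinv \<one>\<^bsub>B\<^esub>" for u v
    using gr_coinv_bracket[OF one one bracket_alternating[OF one] that] by simp
qed

lemma grouplike_coinvariants:
  assumes y: "y \<in> gr_coinvariants k B" and g: "g \<in> gr_elem k B 0 ` G"
  shows "bracket C g (bracket C y (inv\<^bsub>C\<^esub> g)) \<in> gr_coinvariants k B"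
    and "inv\<^bsub>C\<^esub> g \<otimes>\<^bsub>C\<^esub> bracket C g y \<in> gr_coinvariants k B"
proof -
  obtain t where t: "t \<in> G" "g = gr_elem k B 0 t" using g by blast
  obtain s where s: "s \<in> G" "s \<otimes>\<^bsub>B\<^esub> t = \<one>\<^bsub>B\<^esub>" using t(1) by (rule grouplike_inverse)
  have c: "t \<in> carrier B" "s \<in> carrier B" "\<one>\<^bsub>B\<^esub> \<in> carrier B" using t s grouplikeD(1) by auto
  have ts: "t \<otimes>\<^bsub>B\<^esub> s = \<one>\<^bsub>B\<^esub>" using s(2) c by (simp add: m_comm)
  have "inv\<^bsub>C\<^esub> g = inv\<^bsub>CP\<^esub> g" by (simp add: m_inv_def)
  then have inv: "inv\<^bsub>C\<^esub> g = gr_elem k B 0 s" using gr_elem_inverse[OF t(1) s] t(2) by simp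
  have y1: "y \<in> gr_coinv \<one>\<^bsub>B\<^esub>" using y gr_coinvariants_eq by simp
  note gc = gr_elem_coinv[OF t(1)] and sc = gr_elem_coinv[OF s(1)]
  \<comment> \<open>The label is 1 s = s, and the condition {1, s} = 0 is the hypothesis for the
    group-likes 1 and s. The outer bracket then has label t s = 1 and uses {t, s} = 0.\<close>
  have "bracket CP y (gr_elem k B 0 s) \<in> gr_coinv s"
    using gr_coinv_bracket[OF c(3,2) grouplike_bracket[OF one_grouplike s(1)] y1 sc] c by simp
  from gr_coinv_bracket[OF c(1,2) grouplike_bracket[OF t(1) s(1)] gc this]
  show "bracket C g (bracket C y (inv\<^bsub>C\<^esub> g)) \<in> gr_coinvariants k B"
    using ts t(2) inv gr_coinvariants_eq by simp
  have "bracket CP g y \<in> gr_coinv t"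
    using gr_coinv_bracket[OF c(1,3) grouplike_bracket[OF t(1) one_grouplike] gc y1] c t(2) by simp
  from gr_coinv_mult[OF c(2,1) sc this]
  show "inv\<^bsub>C\<^esub> g \<otimes>\<^bsub>C\<^esub> bracket C g y \<in> gr_coinvariants k B"
    using s(2) inv gr_coinvariants_eq by simp
qed

end

theorem lemma7p4:
  fixes k :: "('k, 'r) ring_scheme"
    and B :: "('k, 'b, 'm) poisson_hopf_scheme"
    and C :: "('k, nat \<Rightarrow> 'b set) poisson_hopf"
    and R :: "(nat \<Rightarrow> 'b set) set"
    and G :: "'b set"
  assumes "poisson_hopf_algebra k B"
    and "pointed k B"
    and "G = grouplikes k B"
    and "\<forall>g\<in>G. \<forall>t\<in>G. bracket B g t = \<zero>\<^bsub>B\<^esub>"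
    and "C = gr k B"
    and "R = gr_coinvariants k B"
  shows "poisson_subalgebra k C R \<and>
    (\<forall>y\<in>R. \<forall>g\<in>gr_elem k B 0 ` G.
       bracket C g (bracket C y (inv\<^bsub>C\<^esub> g)) \<in> R \<and>
       inv\<^bsub>C\<^esub> g \<otimes>\<^bsub>C\<^esub> bracket C g y \<in> R)"
proof -
  interpret pointed_poisson_hopf k B
    using assms(1-4) by (intro pointed_poisson_hopf.intro pointed_poisson_hopf_axioms.intro) auto
  show ?thesis
    unfolding assms(3,5,6)
    using poisson_subalgebra_coinvariants grouplike_coinvariants by blast
qed

end
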